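(* Let $0<\theta_1,\theta_2<+\infty$, $\frac12<q<1$ and $q''=q/(2q-1)$. Suppose $u$ is a continuous complex-valued function in the quarter-plane $\mathbb{R}_{\ge0}\times\mathbb{R}_{\le0}$ which solves the Klein-Gordon equation $u''_{xy}+u=0$ in the sense of distribution theory in the interior quarter-plane $\mathbb{R}_{>0}\times\mathbb{R}_{<0}$. Suppose moreover that $u$ vanishes along the semi-axis $\{0\}\times\mathbb{R}_{\le0}$. Finally, assume that $u$ meets the uniform growth bound $$|u(x,y)|=\mathrm{O}\big(\exp(\theta_1|x|^{q}+\theta_2|y|^{q''})\big),\qquad (x,y)\in\mathbb{R}_{\ge0}\times\mathcal{Y},$$ where $0\in\mathcal{Y}$ and the subset $\mathcal{Y}\subset\mathbb{R}_{\le0}$ induces an asymptotic $q$-covering of $\mathbb{R}_{\le0}$. If $$\theta_1^{1/q}\theta_2^{1/q''}<\bigg(\frac{1}{q}\bigg)^{1/q}\bigg(\frac{1}{q''}\bigg)^{1/q''}\sin^2\frac{\pi}{2q},$$ it then follows that $u=0$ on all of $\mathbb{R}_{\ge0}\times\mathbb{R}_{\le0}$.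
   Context: Here $u''_{xy}=\partial_x\partial_y u$. The uniform growth bound means that there is a constant $C$, independent of $(x,y)$, such that $|u(x,y)|\le C\exp(\theta_1|x|^{q}+\theta_2|y|^{q''})$ for all $(x,y)\in\mathbb{R}_{\ge0}\times\mathcal{Y}$. For $\frac12<q<1$ and $q'':=q/(2q-1)$, a subset $\mathcal{Y}\subset\mathbb{R}_{\le0}$ is said to induce an asymptotic $q$-covering of $\mathbb{R}_{\le0}$ if there exists a constant $M\in\mathbb{R}_{>0}$ such that $$(-\infty,y_1]\subset\bigcup_{y\in\mathcal{Y}}[y-MR(y,q),\,y+MR(y,q)]$$ holds for some $y_1\in\mathbb{R}_{<0}$, where $R(y,q):=|y|\min\{1,|y|^{-q''/2}\}$ (with $R(0,q)=0$). *)

theory Defs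
  imports "HOL-Analysis.Analysis"
begin

definition directional_derivative ::
    "'a::real_normed_vector \<Rightarrow> ('a \<Rightarrow> 'b::real_normed_vector) \<Rightarrow> 'a \<Rightarrow> 'b" where
  "directional_derivative v f p = frechet_derivative f (at p) v"

definition partial_x :: "(real \<times> real \<Rightarrow> complex) \<Rightarrow> real \<times> real \<Rightarrow> complex" where
  "partial_x = directional_derivative (1, 0)"

definition partial_y :: "(real \<times> real \<Rightarrow> complex) \<Rightarrow> real \<times> real \<Rightarrow> complex" where
  "partial_y = directional_derivative (0, 1)"

text \<open>On a finite-dimensional domain this is the usual class \<open>C\<^sup>k\<close>: since \<open>frechet_derivative\<close> is
  arbitrary at points of non-differentiability, differentiability is required separately.\<close>

primrec C_k :: "nat \<Rightarrow> ('a::euclidean_space \<Rightarrow> 'b::real_normed_vector) \<Rightarrow> bool" where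
  "C_k 0 f \<longleftrightarrow> continuous_on UNIV f"
| "C_k (Suc k) f \<longleftrightarrow> f differentiable_on UNIV \<and> (\<forall>v. C_k k (directional_derivative v f))"

definition smooth :: "('a::euclidean_space \<Rightarrow> 'b::real_normed_vector) \<Rightarrow> bool" where
  "smooth f \<longleftrightarrow> (\<forall>k. C_k k f)"

definition test_function :: "'a::euclidean_space set \<Rightarrow> ('a \<Rightarrow> complex) \<Rightarrow> bool" where
  "test_function \<Omega> \<phi> \<longleftrightarrow>
     smooth \<phi> \<and> compact (closure {p. \<phi> p \<noteq> 0}) \<and> closure {p. \<phi> p \<noteq> 0} \<subseteq> \<Omega>"

text \<open>The function \<open>u\<close> acts on test functions by \<open>\<phi> \<mapsto> \<integral> u \<phi>\<close>. The two derivatives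
  moved onto \<open>\<phi>\<close> contribute the sign \<open>(-1)(-1) = 1\<close>. The definition is meant for open \<open>\<Omega>\<close> and
  \<open>u\<close> locally integrable on \<open>\<Omega>\<close>.\<close>

definition klein_gordon_distributional ::
    "(real \<times> real) set \<Rightarrow> (real \<times> real \<Rightarrow> complex) \<Rightarrow> bool" where
  "klein_gordon_distributional \<Omega> u \<longleftrightarrow>
     (\<forall>\<phi>. test_function \<Omega> \<phi> \<longrightarrow>
        (LINT p:\<Omega>|lborel. u p * (partial_x (partial_y \<phi>) p + \<phi> p)) = 0)"

definition dual_exponent :: "real \<Rightarrow> real" where
  "dual_exponent q = q / (2 * q - 1)"

text \<open>Since \<open>0 powr a = 0\<close>, the value at \<open>y = 0\<close> is \<open>0\<close>, as it should be.\<close>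

definition covering_radius :: "real \<Rightarrow> real \<Rightarrow> real" where
  "covering_radius y q = \<bar>y\<bar> * min 1 (\<bar>y\<bar> powr (- dual_exponent q / 2))"

text \<open>Meant for \<open>1/2 < q < 1\<close>.\<close>

definition asymptotic_covering :: "real \<Rightarrow> real set \<Rightarrow> bool" where
  "asymptotic_covering q Y \<longleftrightarrow> Y \<subseteq> {..0} \<and>
     (\<exists>M>0. \<exists>y\<^sub>1<0. {..y\<^sub>1} \<subseteq>
        (\<Union>y\<in>Y. {y - M * covering_radius y q .. y + M * covering_radius y q}))"

end

theory Submission
  imports Defs "HOL-Complex_Analysis.Complex_Analysis"
begin

text \<open>
  Put \<open>v (x, t) = u (x, - t)\<close> and let \<open>F\<close> be the Laplace transform of \<open>v (\<cdot>, 0)\<close>. Since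
  \<open>v\<^sub>x\<^sub>t = v\<close> and \<open>v (0, t) = 0\<close>, the Laplace transform of \<open>v (\<cdot>, t)\<close> is \<open>F z * exp (t / z)\<close>, so the
  growth bound gives, with \<open>\<alpha> = q / (1 - q)\<close> and up to a factor \<open>1 / Re z\<close>,
  \<open>\<bar>F z\<bar> \<le> exp (A * (Re z) powr (- \<alpha>) + \<theta>\<^sub>2 * t powr q'' - t * Re (1 / z))\<close> whenever \<open>- t \<in> Y\<close>. The covering
  property makes the optimal \<open>t\<close> available asymptotically, and the hypothesis on \<open>\<theta>\<^sub>1\<close> and \<open>\<theta>\<^sub>2\<close> says
  exactly that \<open>F z\<close> then decays like \<open>exp (- \<epsilon> * \<bar>z\<bar> powr (- \<alpha>))\<close> on the two rays
  \<open>Arg z = \<plusminus> pi / (2 * \<alpha>)\<close>. In the variable \<open>\<zeta> = z powr (- \<alpha>)\<close> these rays bound a half-plane in which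
  \<open>F\<close> is of exponential type. By Phragmen-Lindeloef such an \<open>F\<close> vanishes. Hence \<open>v (\<cdot>, 0) = 0\<close>, and so
  \<open>v = 0\<close>.
\<close>

section \<open>Smooth cutoff functions\<close>

text \<open>The equation is known only weakly and \<open>u\<close> is only continuous, so the
  analysis starts from an identity over rectangles, obtained by testing with products of cutoffs.
  Growth is controlled only on the lines of \<open>Y\<close>. The line \<open>y = 0\<close> gives
  \<open>v (x, 0)\<close> growth below every exponential; an a priori estimate carries this to all
  \<open>t\<close>, which is enough to relate the transforms at different \<open>t\<close>.

  The constant arises at the points \<open>z = exp (+-i pi / (2 * \<alpha>)) / \<rho>\<close>, where
  \<open>Re z = c / \<rho>\<close> and \<open>Re (1 / z) = c * \<rho>\<close> with
  \<open>c = cos (pi / (2 * \<alpha>)) = sin (pi / (2 * q))\<close>. Growth in \<open>x\<close>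
  costs \<open>A * c powr (- \<alpha>) * \<rho> powr \<alpha>\<close> by Legendre duality. The
  minimum over \<open>t\<close> of \<open>\<theta>\<^sub>2 * t powr q'' - c * \<rho> * t\<close> is
  a negative multiple of \<open>c powr \<alpha> * \<rho> powr \<alpha>\<close>, because
  \<open>q'' * (\<alpha> - 1) = \<alpha>\<close>. Each coefficient contributes one factor
  \<open>c\<close>, hence the squared sine. Since \<open>q > 1/2\<close> means
  \<open>\<alpha> > 1\<close>, the rays lie inside the half-plane where \<open>F\<close> is
  defined.\<close>

primrec times_differentiable :: "nat \<Rightarrow> (real \<Rightarrow> real) \<Rightarrow> bool" where
  "times_differentiable 0 g \<longleftrightarrow> continuous_on UNIV g"
| "times_differentiable (Suc k) g \<longleftrightarrow>
     (\<exists>g'. (\<forall>x. (g has_real_derivative g' x) (at x)) \<and> times_differentiable k g')"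

text \<open>The product rule leaves one factor undifferentiated, and the induction hypothesis wants
  that factor in the lower class.\<close>

lemma times_differentiable_SucD: "times_differentiable (Suc k) g \<Longrightarrow> times_differentiable k g"
proof (induction k arbitrary: g)
  case 0
  then show ?case by (auto intro!: continuous_at_imp_continuous_on dest: DERIV_isCont)
next
  case (Suc k)
  then obtain g' where "\<forall>x. (g has_real_derivative g' x) (at x)" "times_differentiable (Suc k) g'"
    by (meson times_differentiable.simps(2))
  then show ?case using Suc.IH[of g'] by auto
qed

lemma times_differentiable_add:
  "times_differentiable k f \<Longrightarrow> times_differentiable k g \<Longrightarrow> times_differentiable k (\<lambda>x. f x + g x)"
proof (induction k arbitrary: f g)
  case 0
  then show ?case by (simp add: continuous_on_add)
next
  case (Suc k)
  then obtain f' g' where "\<forall>x. (f has_real_derivative f' x) (at x)" "times_differentiable k f'"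
      "\<forall>x. (g has_real_derivative g' x) (at x)" "times_differentiable k g'"
    by auto
  then show ?case using Suc.IH[of f' g'] by (auto intro!: exI[of _ "\<lambda>x. f' x + g' x"] DERIV_add)
qed

lemma times_differentiable_const: "times_differentiable k (\<lambda>x. c)"
  by (induction k arbitrary: c) (auto intro!: exI[of _ "\<lambda>x. 0"])

lemma times_differentiable_mult:
  "times_differentiable k f \<Longrightarrow> times_differentiable k g \<Longrightarrow> times_differentiable k (\<lambda>x. f x * g x)"
proof (induction k arbitrary: f g)
  case 0
  then show ?case by (simp add: continuous_on_mult)
next
  case (Suc k)
  then obtain f' g' where *: "\<forall>x. (f has_real_derivative f' x) (at x)" "times_differentiable k f'"
      "\<forall>x. (g has_real_derivative g' x) (at x)" "times_differentiable k g'"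
    by auto
  have "times_differentiable k (\<lambda>x. f' x * g x + g' x * f x)"
    using Suc.prems[THEN times_differentiable_SucD] *
    by (intro times_differentiable_add Suc.IH)
  then show ?case using *(1,3) by (auto intro!: exI[of _ "\<lambda>x. f' x * g x + g' x * f x"] DERIV_mult)
qed

lemma times_differentiable_affine:
  "times_differentiable k g \<Longrightarrow> times_differentiable k (\<lambda>x. g (a * x + b))"
proof (induction k arbitrary: g)
  case 0
  then show ?case by (auto intro!: continuous_on_compose2[of UNIV g] continuous_intros)
next
  case (Suc k)
  then obtain g' where *: "\<And>x. (g has_real_derivative g' x) (at x)" "times_differentiable k g'"
    by auto
  have "((\<lambda>x. g (a * x + b)) has_real_derivative g' (a * x + b) * a) (at x)" for x
    by (rule DERIV_chain2[OF *(1)]) (auto intro!: derivative_eq_intros)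
  moreover have "times_differentiable k (\<lambda>x. g' (a * x + b) * a)"
    by (rule times_differentiable_mult[OF Suc.IH[OF *(2)] times_differentiable_const])
  ultimately show ?case by (auto intro!: exI[of _ "\<lambda>x. g' (a * x + b) * a"])
qed

text \<open>The powers of \<open>inverse x\<close> make the family of the classical flat function
  \<open>exp (- 1 / x)\<close> closed under differentiation up to linear combinations, so smoothness
  becomes an induction over all \<open>n\<close> at once.\<close>

definition flat :: "nat \<Rightarrow> real \<Rightarrow> real" where
  "flat n x = (if 0 < x then inverse x ^ n * exp (- inverse x) else 0)"

lemma flat_has_real_derivative:
  "(flat n has_real_derivative flat (n + 2) x - real n * flat (n + 1) x) (at x)"
proof (cases x "0::real" rule: linorder_cases)
  case less
  have "(flat n has_real_derivative 0) (at x)"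
    by (rule has_field_derivative_transform_within_open[where f = "\<lambda>_. 0" and S = "{..<0}"])
      (use less in \<open>simp_all add: flat_def\<close>)
  then show ?thesis using less by (simp add: flat_def)
next
  case greater
  have "((\<lambda>x. inverse x ^ n * exp (- inverse x)) has_real_derivative
      flat (n + 2) x - real n * flat (n + 1) x) (at x)"
  proof -
    have i: "(inverse has_real_derivative - (inverse x ^ 2)) (at x)"
      using DERIV_inverse[of x UNIV] greater by (simp add: numeral_2_eq_2)
    have p: "((\<lambda>x. inverse x ^ n) has_real_derivative real n * inverse x ^ (n - 1) * - (inverse x ^ 2)) (at x)"
      using DERIV_power[OF i, of n] by (simp add: mult_ac)
    have e: "((\<lambda>x. exp (- inverse x)) has_real_derivative exp (- inverse x) * - (- (inverse x ^ 2))) (at x)"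
      by (rule DERIV_chain2[OF DERIV_exp]) (rule DERIV_minus[OF i])
    show ?thesis
      by (rule DERIV_cong[OF DERIV_mult[OF p e]])
        (use greater in \<open>cases n; simp add: flat_def power_add algebra_simps power2_eq_square\<close>)
  qed
  then show ?thesis
    by (rule has_field_derivative_transform_within_open[where S = "{0<..}"])
      (use greater in \<open>simp_all add: flat_def\<close>)
next
  case equal
  have r: "(flat (n + 1) \<longlongrightarrow> 0) (at_right 0)"
  proof -
    have "((\<lambda>x. inverse x ^ (n + 1) / exp (inverse x)) \<longlongrightarrow> 0) (at_right (0::real))"
      by (rule filterlim_compose[OF tendsto_power_div_exp_0 filterlim_inverse_at_top_right])
    then show ?thesis
      by (rule Lim_transform_eventually) (auto simp: flat_def eventually_at_filter exp_minus divide_inverse)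
  qed
  have l: "(flat (n + 1) \<longlongrightarrow> 0) (at_left 0)"
    by (rule Lim_transform_eventually[OF tendsto_const]) (auto simp: flat_def eventually_at_filter)
  have "(flat (n + 1) \<longlongrightarrow> 0) (at 0)" using l r by (simp add: filterlim_split_at)
  \<comment> \<open>The difference quotient \<open>flat n h / h\<close> is
    \<open>flat (n + 1) h\<close> for \<open>h > 0\<close> and 0 for \<open>h < 0\<close>.\<close>
  then have "((\<lambda>h. (flat n (0 + h) - flat n 0) / h) \<longlongrightarrow> 0) (at 0)"
    by (rule Lim_transform_eventually) (auto simp: flat_def eventually_at_filter divide_inverse)
  then have "(flat n has_real_derivative 0) (at 0)" by (simp add: DERIV_def)
  then show ?thesis using equal by (simp add: flat_def)
qed

lemma times_differentiable_flat: "times_differentiable k (flat n)"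
proof (induction k arbitrary: n)
  case 0
  then show ?case
    by (auto intro!: continuous_at_imp_continuous_on DERIV_isCont[OF flat_has_real_derivative])
next
  case (Suc k)
  have "times_differentiable k (\<lambda>x. flat (n + 2) x + (- real n) * flat (n + 1) x)"
    by (rule times_differentiable_add[OF Suc.IH times_differentiable_mult[OF times_differentiable_const Suc.IH]])
  then show ?case using flat_has_real_derivative[of n]
    by (auto intro!: exI[of _ "\<lambda>x. flat (n + 2) x - real n * flat (n + 1) x"])
qed

text \<open>The support \<open>[1, 2]\<close> keeps rescaled bumps away from the axes.\<close>

lemma smooth_step_exists:
  obtains \<eta> S :: "real \<Rightarrow> real" where
    "\<And>k. times_differentiable k \<eta>" "\<And>x. 0 \<le> \<eta> x" "\<And>x. x \<notin> {1..2} \<Longrightarrow> \<eta> x = 0"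
    "\<And>x. (S has_real_derivative \<eta> x) (at x)" "\<And>x. x \<le> 1 \<Longrightarrow> S x = 0" "\<And>x. 2 \<le> x \<Longrightarrow> S x = 1"
proof -
  \<comment> \<open>A smooth bump, positive exactly on the open interval from 1 to 2;
    \<open>S\<close> is its normalised primitive.\<close>
  define \<beta> where "\<beta> x = flat 0 (x - 1) * flat 0 (2 - x)" for x
  have sm: "times_differentiable k \<beta>" for k
  proof -
    have "times_differentiable k (\<lambda>x. flat 0 (1 * x + (-1)) * flat 0 ((-1) * x + 2))"
      by (rule times_differentiable_mult; rule times_differentiable_affine; rule times_differentiable_flat)
    then show ?thesis by (simp add: \<beta>_def[abs_def])
  qed
  have nn: "0 \<le> \<beta> x" for x by (simp add: \<beta>_def flat_def)
  have supp: "x \<notin> {1..2} \<Longrightarrow> \<beta> x = 0" for x by (auto simp: \<beta>_def flat_def)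
  have cont: "continuous_on A \<beta>" for A using sm[of 0] continuous_on_subset by auto
  define B where "B = integral {0..3} \<beta>"
  have B0: "0 \<le> B" unfolding B_def
    by (rule integral_nonneg) (auto intro: integrable_continuous_interval cont nn)
  have "B \<noteq> 0"
  proof
    assume "B = 0"
    then have "\<beta> (3/2) = 0" using integral_eq_0_iff[OF cont, of 0 3] nn by (simp add: B_def)
    then show False by (simp add: \<beta>_def flat_def)
  qed
  with B0 have B: "0 < B" by simp
  \<comment> \<open>For negative \<open>x\<close> the interval is empty and the integral is 0, which
    is the value required there.\<close>
  define S where "S x = integral {0..x} \<beta> / B" for x
  have S0: "S x = 0" if "x \<le> 1" for x
  proof -
    have "integral {0..x} \<beta> = integral {0..x} (\<lambda>_. 0)"
      by (rule integral_spike[of "{1}"]) (use supp that in auto)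
    then show ?thesis by (simp add: S_def)
  qed
  have S1: "S x = 1" if "2 \<le> x" for x
  proof -
    have int: "\<beta> integrable_on {c..d}" for c d by (rule integrable_continuous_interval[OF cont])
    have z: "integral {2..y} \<beta> = 0" for y
    proof -
      have "integral {2..y} \<beta> = integral {2..y} (\<lambda>_. 0)"
        by (rule integral_spike[of "{2}"]) (use supp in auto)
      then show ?thesis by simp
    qed
    have "integral {0..2} \<beta> + integral {2..x} \<beta> = integral {0..x} \<beta>"
         "integral {0..2} \<beta> + integral {2..3} \<beta> = integral {0..3} \<beta>"
      by (rule Henstock_Kurzweil_Integration.integral_combine; use that int in simp)+
    then show ?thesis using B by (simp add: z S_def B_def)
  qed
  have S': "(S has_real_derivative \<beta> x / B) (at x)" for x
  proof (cases "x < 1")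
    case True
    have "(S has_real_derivative 0) (at x)"
      by (rule has_field_derivative_transform_within_open[where f = "\<lambda>_. 0" and S = "{..<1}"])
        (use True S0 in simp_all)
    then show ?thesis using True supp by simp
  next
    case False
    have "((\<lambda>x. integral {0..x} \<beta>) has_real_derivative \<beta> x) (at x within {0..x+1})"
      by (rule integral_has_real_derivative[OF cont]) (use False in auto)
    then have "((\<lambda>x. integral {0..x} \<beta>) has_real_derivative \<beta> x) (at x)"
      using False by (simp add: at_within_Icc_at)
    then show ?thesis unfolding S_def by (rule DERIV_cdivide)
  qed
  have "times_differentiable k (\<lambda>x. \<beta> x / B)" for k
    using times_differentiable_mult[OF sm times_differentiable_const[of _ "inverse B"]]
    by (simp add: divide_inverse)
  then show thesis
    using that[of "\<lambda>x. \<beta> x / B" S] nn supp S' S0 S1 B by auto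
qed

section \<open>Product test functions\<close>

lemma C_k_add: "C_k k f \<Longrightarrow> C_k k g \<Longrightarrow> C_k k (\<lambda>x. f x + g x)"
proof (induction k arbitrary: f g)
  case 0
  then show ?case by (simp add: continuous_on_add)
next
  case (Suc k)
  then have d: "f differentiable (at p)" "g differentiable (at p)" for p
    by (simp_all add: differentiable_on_def)
  have dir: "directional_derivative v (\<lambda>x. f x + g x) = (\<lambda>p. directional_derivative v f p + directional_derivative v g p)" for v
  proof
    fix p
    have "((\<lambda>x. f x + g x) has_derivative (\<lambda>h. frechet_derivative f (at p) h + frechet_derivative g (at p) h)) (at p)"
      using d by (intro has_derivative_add) (simp_all add: frechet_derivative_works[symmetric])
    from frechet_derivative_at[OF this]
    show "directional_derivative v (\<lambda>x. f x + g x) p = directional_derivative v f p + directional_derivative v g p"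
      unfolding directional_derivative_def by (rule fun_cong[OF sym])
  qed
  have "C_k k (directional_derivative v (\<lambda>x. f x + g x))" for v
    unfolding dir using Suc.prems by (intro Suc.IH) simp_all
  then show ?case using d by (simp add: differentiable_on_def)
qed

text \<open>The scalars \<open>fst v\<close> and \<open>snd v\<close> are attached to
  \<open>g'\<close> and \<open>h'\<close> so that both summands are again a function of
  \<open>x\<close> times a function of \<open>y\<close>. This lets \<open>C_k_product\<close> be an
  induction within the class of products.\<close>

lemma directional_derivative_product:
  fixes g h :: "real \<Rightarrow> real"
  assumes "\<And>x. (g has_real_derivative g' x) (at x)" "\<And>x. (h has_real_derivative h' x) (at x)"
  defines "\<Phi> \<equiv> \<lambda>p. complex_of_real (g (fst p) * h (snd p))"
  shows "\<Phi> differentiable (at p)"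
    and "directional_derivative v \<Phi> =
      (\<lambda>p. complex_of_real ((g' (fst p) * fst v) * h (snd p)) + complex_of_real (g (fst p) * (h' (snd p) * snd v)))"
proof -
  have d: "(\<Phi> has_derivative (\<lambda>v. complex_of_real ((g' (fst p) * fst v) * h (snd p)) + complex_of_real (g (fst p) * (h' (snd p) * snd v)))) (at p)" for p
  proof -
    have 1: "((\<lambda>p. g (fst p)) has_derivative (\<lambda>v. fst v * g' (fst p))) (at p)"
      by (rule DERIV_compose_FDERIV[OF assms(1) has_derivative_fst[OF has_derivative_ident]])
    have 2: "((\<lambda>p. h (snd p)) has_derivative (\<lambda>v. snd v * h' (snd p))) (at p)"
      by (rule DERIV_compose_FDERIV[OF assms(2) has_derivative_snd[OF has_derivative_ident]])
    show ?thesis unfolding \<Phi>_def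
      by (rule has_derivative_eq_rhs[OF has_derivative_of_real[OF has_derivative_mult[OF 1 2]]])
        (simp add: add.commute mult.commute)
  qed
  show "\<Phi> differentiable (at p)" unfolding differentiable_def by (rule exI, rule d)
  show "directional_derivative v \<Phi> =
      (\<lambda>p. complex_of_real ((g' (fst p) * fst v) * h (snd p)) + complex_of_real (g (fst p) * (h' (snd p) * snd v)))"
    unfolding directional_derivative_def by (rule ext) (rule fun_cong[OF frechet_derivative_at[OF d, symmetric]])
qed

lemma C_k_product:
  "times_differentiable k g \<Longrightarrow> times_differentiable k h \<Longrightarrow>
    C_k k (\<lambda>p. complex_of_real (g (fst p) * h (snd p)))"
proof (induction k arbitrary: g h)
  case 0
  then have "continuous_on UNIV (\<lambda>p::real \<times> real. g (fst p))" "continuous_on UNIV (\<lambda>p::real \<times> real. h (snd p))"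
    using continuous_on_compose2[of UNIV g UNIV fst] continuous_on_compose2[of UNIV h UNIV snd]
    by (simp_all add: continuous_on_fst continuous_on_snd)
  then show ?case by (simp add: continuous_on_mult continuous_on_of_real del: of_real_mult)
next
  case (Suc k)
  then obtain g' h' where *: "\<And>x. (g has_real_derivative g' x) (at x)" "times_differentiable k g'"
      "\<And>x. (h has_real_derivative h' x) (at x)" "times_differentiable k h'"
    by auto
  have "C_k k (directional_derivative v (\<lambda>p. complex_of_real (g (fst p) * h (snd p))))" for v
    unfolding directional_derivative_product(2)[OF *(1,3)]
    by (rule C_k_add[OF Suc.IH[OF times_differentiable_mult[OF *(2) times_differentiable_const]
            Suc.prems(2)[THEN times_differentiable_SucD]]
          Suc.IH[OF Suc.prems(1)[THEN times_differentiable_SucD]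
            times_differentiable_mult[OF *(4) times_differentiable_const]]])
  then show ?case
    using directional_derivative_product(1)[OF *(1,3)] by (simp add: differentiable_on_def)
qed

text \<open>On a product the mixed derivative is \<open>g' (x) * h' (y)\<close>. The Lebesgue
  integral over the open quarter-plane is traded for a gauge integral over a compact
  \<open>R\<close>, which may touch the axes because \<open>u\<close> is continuous up to
  them.\<close>

lemma klein_gordon_product:
  fixes u :: "real \<times> real \<Rightarrow> complex"
  assumes kg: "klein_gordon_distributional ({0<..} \<times> {..<0}) u"
    and cont: "continuous_on R u" and R: "compact R"
    and g: "\<And>k. times_differentiable k g" "\<And>x. (g has_real_derivative g' x) (at x)"
    and h: "\<And>k. times_differentiable k h" "\<And>y. (h has_real_derivative h' y) (at y)"
    and deriv: "times_differentiable 0 g'" "times_differentiable 1 h'"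
    and supp: "\<And>x. x \<notin> {a..b} \<Longrightarrow> g x = 0 \<and> g' x = 0" "\<And>y. y \<notin> {c..d} \<Longrightarrow> h y = 0 \<and> h' y = 0"
    and ab: "0 < a" "d < 0" and sub: "{a..b} \<times> {c..d} \<subseteq> R"
  shows "integral R (\<lambda>p. u p * of_real (g' (fst p) * h' (snd p) + g (fst p) * h (snd p))) = 0"
proof -
  define \<Phi> where "\<Phi> p = complex_of_real (g (fst p) * h (snd p))" for p
  define \<Psi> where "\<Psi> p = complex_of_real (g' (fst p) * h' (snd p) + g (fst p) * h (snd p))" for p
  have D: "closed ({a..b} \<times> {c..d})" "{a..b} \<times> {c..d} \<subseteq> {0<..} \<times> {..<0}"
    using ab by (auto intro: closed_Times)
  have "test_function ({0<..} \<times> {..<0}) \<Phi>"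
  proof -
    have "{p. \<Phi> p \<noteq> 0} \<subseteq> {a..b} \<times> {c..d}"
    proof
      fix p assume "p \<in> {p. \<Phi> p \<noteq> 0}"
      then have "g (fst p) \<noteq> 0" "h (snd p) \<noteq> 0" by (auto simp: \<Phi>_def)
      then show "p \<in> {a..b} \<times> {c..d}" using supp by (metis mem_Times_iff)
    qed
    then have cl: "closure {p. \<Phi> p \<noteq> 0} \<subseteq> {a..b} \<times> {c..d}"
      using D(1) by (rule closure_minimal)
    have "compact ({a..b} \<times> {c..d})" by (intro compact_Times compact_Icc)
    from compact_Int_closed[OF this closed_closure[of "{p. \<Phi> p \<noteq> 0}"]]
    have "compact (closure {p. \<Phi> p \<noteq> 0})" using cl by (simp add: Int_absorb1)
    moreover have "smooth \<Phi>" unfolding smooth_def \<Phi>_def[abs_def] by (intro allI C_k_product g(1) h(1))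
    ultimately show ?thesis using cl D(2) by (simp add: test_function_def)
  qed
  then have "(LINT p:{0<..} \<times> {..<0}|lborel. u p * (partial_x (partial_y \<Phi>) p + \<Phi> p)) = 0"
    using kg by (simp add: klein_gordon_distributional_def)
  moreover have "partial_y \<Phi> = (\<lambda>p. complex_of_real (g (fst p) * h' (snd p)))"
    unfolding partial_y_def \<Phi>_def[abs_def]
    by (subst directional_derivative_product(2)[OF g(2) h(2)]) simp
  moreover have "partial_x (\<lambda>p. complex_of_real (g (fst p) * h' (snd p))) = (\<lambda>p. complex_of_real (g' (fst p) * h' (snd p)))"
  proof -
    \<comment> \<open>Although only the \<open>x\<close>-derivative is taken here, it is defined
      through the Frechet derivative in both variables, so \<open>h'\<close> must be differentiable
      too.\<close>
    obtain h'' where k: "\<And>y. (h' has_real_derivative h'' y) (at y)"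
      using deriv(2) by auto
    show ?thesis unfolding partial_x_def
      by (subst directional_derivative_product(2)[OF g(2) k]) simp
  qed
  ultimately have "(LINT p:{0<..} \<times> {..<0}|lborel. u p * \<Psi> p) = 0"
    by (simp add: \<Psi>_def \<Phi>_def)
  moreover have "(LINT p:{0<..} \<times> {..<0}|lborel. u p * \<Psi> p) = (LINT p:R|lborel. u p * \<Psi> p)"
  proof -
    have "\<Psi> p = 0" if "p \<notin> {a..b} \<times> {c..d}" for p
    proof -
      have "fst p \<notin> {a..b} \<or> snd p \<notin> {c..d}" using that by (simp add: mem_Times_iff)
      then show ?thesis using supp by (auto simp: \<Psi>_def)
    qed
    \<comment> \<open>The integrands agree pointwise: off the supporting rectangle both vanish, and
      on it both indicators are 1.\<close>
    then have "indicat_real ({0<..} \<times> {..<0}) p *\<^sub>R (u p * \<Psi> p) = indicat_real R p *\<^sub>R (u p * \<Psi> p)" for p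
      using sub D(2) by (cases "p \<in> {a..b} \<times> {c..d}") (auto simp: indicator_def)
    then show ?thesis unfolding set_lebesgue_integral_def by (simp only:)
  qed
  moreover have "(LINT p:R|lborel. u p * \<Psi> p) = integral R (\<lambda>p. u p * \<Psi> p)"
  proof (rule set_borel_integral_eq_integral(2))
    have "continuous_on UNIV g" "continuous_on UNIV h" "continuous_on UNIV g'" "continuous_on UNIV h'"
      using g(1)[of 0] h(1)[of 0] deriv(1) times_differentiable_SucD[of 0 h'] deriv(2) by simp_all
    moreover have "continuous_on R (\<lambda>p. f (fst p))" "continuous_on R (\<lambda>p. f (snd p))"
      if "continuous_on UNIV f" for f :: "real \<Rightarrow> real"
      by (rule continuous_on_compose2[OF that]; intro continuous_intros subset_UNIV)+
    ultimately have "continuous_on R (\<lambda>p. g (fst p))" "continuous_on R (\<lambda>p. h (snd p))"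
        "continuous_on R (\<lambda>p. g' (fst p))" "continuous_on R (\<lambda>p. h' (snd p))"
      by blast+
    then have "continuous_on R (\<lambda>p. u p * \<Psi> p)" unfolding \<Psi>_def
      by (intro continuous_on_mult continuous_on_add continuous_on_of_real cont)
    then show "set_integrable lborel R (\<lambda>p. u p * \<Psi> p)"
      unfolding set_integrable_def by (rule borel_integrable_compact[OF R])
  qed
  ultimately show ?thesis by (simp add: \<Psi>_def)
qed

text \<open>\<open>E n \<alpha>\<close> has mass 1 and lives on
  \<open>[\<alpha> + 1 / (n + 1), \<alpha> + 2 / (n + 1)]\<close>. The approximation is thus
  one-sided, from inside the quarter-plane, and remains valid at corners on the axes. The margin 2
  in \<open>R\<close> accommodates the largest shift, at \<open>n = 0\<close>.\<close>

lemma product_mollifier_limit: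
  fixes u :: "real \<times> real \<Rightarrow> complex" and \<eta> S :: "real \<Rightarrow> real" and a b \<alpha> \<beta> :: real
  assumes \<eta>: "continuous_on UNIV \<eta>" "\<And>x. 0 \<le> \<eta> x" "\<And>x. x \<notin> {1..2} \<Longrightarrow> \<eta> x = 0"
    and S: "\<And>x. (S has_real_derivative \<eta> x) (at x)" "\<And>x. x \<le> 1 \<Longrightarrow> S x = 0" "\<And>x. 2 \<le> x \<Longrightarrow> S x = 1"
  defines "E \<equiv> \<lambda>n \<alpha> x. real (Suc n) * \<eta> (real (Suc n) * x + - (real (Suc n) * \<alpha>))"
    and "R \<equiv> cbox (0, - b - 2) (a + 2, 0)"
  assumes u: "continuous_on R u" and \<alpha>: "\<alpha> \<in> {0..a}" and \<beta>: "\<beta> \<in> {0..b}"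
  shows "(\<lambda>n. integral R (\<lambda>p. u p * of_real (E n \<alpha> (fst p) * E n \<beta> (- snd p)))) \<longlonglongrightarrow> u (\<alpha>, - \<beta>)"
proof (rule LIMSEQ_I)
  fix e :: real assume e: "0 < e"
  define c where "c = u (\<alpha>, - \<beta>)"
  define K where "K n p = E n \<alpha> (fst p) * E n \<beta> (- snd p)" for n and p :: "real \<times> real"
  have mem: "(\<alpha>, - \<beta>) \<in> R" using \<alpha> \<beta> by (auto simp: R_def mem_box Basis_prod_def)
  have Econt: "continuous_on A (\<lambda>p. E n \<gamma> (f p))" if "continuous_on A f" for A n \<gamma> and f :: "'x::topological_space \<Rightarrow> real"
    unfolding E_def by (intro continuous_on_mult continuous_on_const continuous_on_compose2[OF \<eta>(1)]
      continuous_on_add that subset_UNIV)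
  have Kcont: "continuous_on A (K n)" for A n
    unfolding K_def by (intro continuous_on_mult Econt continuous_on_minus continuous_on_fst continuous_on_snd continuous_on_id)
  have K0: "0 \<le> K n p" for n p using \<eta>(2) by (simp add: K_def E_def)
  have G: "((\<lambda>x. S (real (Suc n) * x + - (real (Suc n) * \<gamma>))) has_real_derivative E n \<gamma> x) (at x)" for n \<gamma> x
    unfolding E_def by (rule DERIV_cong[OF DERIV_chain2[OF S(1)]]) (auto intro!: derivative_eq_intros)
  have N2: "2 \<le> real (Suc n) * x + - (real (Suc n) * \<gamma>)" if "\<gamma> + 2 \<le> x" for n x \<gamma>
  proof -
    have "1 * 2 \<le> real (Suc n) * (x - \<gamma>)" using that by (intro mult_mono) auto
    then show ?thesis by (simp add: right_diff_distrib)
  qed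
  have I1: "integral {0..a+2} (E n \<alpha>) = 1" for n
  proof -
    have "(E n \<alpha> has_integral S (real (Suc n) * (a + 2) + - (real (Suc n) * \<alpha>)) - S (real (Suc n) * 0 + - (real (Suc n) * \<alpha>))) {0..a+2}"
      by (rule fundamental_theorem_of_calculus)
        (use G \<alpha> in \<open>auto simp: has_real_derivative_iff_has_vector_derivative[symmetric] intro: has_field_derivative_at_within\<close>)
    moreover have "S (real (Suc n) * (a + 2) + - (real (Suc n) * \<alpha>)) = 1"
      by (rule S(3), rule N2) (use \<alpha> in simp)
    moreover have "S (real (Suc n) * 0 + - (real (Suc n) * \<alpha>)) = 0"
      by (rule S(2)) (use \<alpha> in \<open>auto intro: order_trans[of _ 0]\<close>)
    ultimately show ?thesis by (simp add: integral_unique)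
  qed
  have I2: "integral {-b-2..0} (\<lambda>y. E n \<beta> (- y)) = 1" for n
  proof -
    have "((\<lambda>y. E n \<beta> (- y)) has_integral - S (real (Suc n) * (- 0) + - (real (Suc n) * \<beta>)) - - S (real (Suc n) * (- (- b - 2)) + - (real (Suc n) * \<beta>))) {-b-2..0}"
    proof (rule fundamental_theorem_of_calculus)
      fix y :: real
      have "((\<lambda>y. - S (real (Suc n) * (- y) + - (real (Suc n) * \<beta>))) has_real_derivative - (E n \<beta> (- y) * - 1)) (at y)"
        by (rule DERIV_minus[OF DERIV_chain2[OF G]]) (auto intro!: derivative_eq_intros)
      then show "((\<lambda>y. - S (real (Suc n) * (- y) + - (real (Suc n) * \<beta>))) has_vector_derivative E n \<beta> (- y)) (at y within {-b-2..0})"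
        by (simp add: has_real_derivative_iff_has_vector_derivative[symmetric] has_field_derivative_at_within)
    qed (use \<beta> in auto)
    moreover have "S (real (Suc n) * (- (- b - 2)) + - (real (Suc n) * \<beta>)) = 1"
      by (rule S(3), rule N2) (use \<beta> in simp)
    moreover have "S (real (Suc n) * (- 0) + - (real (Suc n) * \<beta>)) = 0"
      by (rule S(2)) (use \<beta> in \<open>auto intro: order_trans[of _ 0]\<close>)
    ultimately show ?thesis by (simp add: integral_unique)
  qed
  have IK: "integral R (K n) = 1" for n
  proof -
    have "integral R (K n) = integral (cbox 0 (a+2)) (\<lambda>x. integral (cbox (-b-2) 0) (\<lambda>y. K n (x, y)))"
      unfolding R_def by (rule integral_prod_continuous[OF Kcont])
    also have "\<dots> = 1" by (simp add: K_def I1 I2)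
    finally show ?thesis .
  qed
  obtain d where d: "0 < d" "\<And>p. p \<in> R \<Longrightarrow> dist p (\<alpha>, - \<beta>) < d \<Longrightarrow> dist (u p) c < e / 2"
    using u mem e unfolding continuous_on_iff c_def by (metis half_gt_zero)
  \<comment> \<open>On the support of \<open>K n\<close> each coordinate is within
    \<open>2 / (n + 1)\<close> of the target, so the distance is at most
    \<open>4 / (n + 1)\<close>.\<close>
  obtain n0 where n0: "4 / d < real n0" using reals_Archimedean2 by blast
  show "\<exists>no. \<forall>n\<ge>no. norm (integral R (\<lambda>p. u p * of_real (E n \<alpha> (fst p) * E n \<beta> (- snd p))) - u (\<alpha>, - \<beta>)) < e"
  proof (intro exI[of _ n0] allI impI)
    fix n assume n: "n0 \<le> n"
    have N: "4 / real (Suc n) < d"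
    proof -
      have "4 / d < real (Suc n)" using n0 n by linarith
      then show ?thesis using d(1) by (simp add: field_simps)
    qed
    have uK: "(\<lambda>p. u p * of_real (K n p)) integrable_on R" unfolding R_def
      by (intro integrable_continuous continuous_on_mult continuous_on_of_real Kcont u[unfolded R_def])
    have cK: "(\<lambda>p. c * of_real (K n p)) integrable_on R" unfolding R_def
      by (intro integrable_continuous continuous_on_mult continuous_on_of_real continuous_on_const Kcont)
    have Kint: "K n integrable_on R" unfolding R_def by (rule integrable_continuous[OF Kcont])
    have "((\<lambda>p. complex_of_real (K n p)) has_integral complex_of_real 1) R"
      using has_integral_of_real[OF integrable_integral[OF Kint]] by (simp only: IK)
    then have "integral R (\<lambda>p. c * of_real (K n p)) = c"
      by (simp add: integral_unique)
    then have "integral R (\<lambda>p. u p * of_real (K n p)) - c = integral R (\<lambda>p. u p * of_real (K n p) - c * of_real (K n p))"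
      using uK cK by (simp add: Henstock_Kurzweil_Integration.integral_diff)
    moreover have "norm (integral R (\<lambda>p. u p * of_real (K n p) - c * of_real (K n p))) \<le> integral R (\<lambda>p. e / 2 * K n p)"
    proof (rule integral_norm_bound_integral)
      show "(\<lambda>p. u p * of_real (K n p) - c * of_real (K n p)) integrable_on R" by (rule integrable_diff[OF uK cK])
      show "(\<lambda>p. e / 2 * K n p) integrable_on R" by (rule integrable_on_mult_right[OF Kint])
      fix p assume p: "p \<in> R"
      show "norm (u p * of_real (K n p) - c * of_real (K n p)) \<le> e / 2 * K n p"
      proof (cases "K n p = 0")
        case False
        then have "real (Suc n) * fst p + - (real (Suc n) * \<alpha>) \<in> {1..2}"
            "real (Suc n) * (- snd p) + - (real (Suc n) * \<beta>) \<in> {1..2}"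
          using \<eta>(3) unfolding K_def E_def by (metis mult_zero_left mult_zero_right)+
        then have "\<bar>real (Suc n) * (fst p - \<alpha>)\<bar> \<le> 2" "\<bar>real (Suc n) * (snd p + \<beta>)\<bar> \<le> 2"
          by (auto simp: algebra_simps)
        then have "real (Suc n) * \<bar>fst p - \<alpha>\<bar> \<le> 2" "real (Suc n) * \<bar>snd p + \<beta>\<bar> \<le> 2"
          by (simp_all only: abs_mult abs_of_nat)
        then have "real (Suc n) * (\<bar>fst p - \<alpha>\<bar> + \<bar>snd p + \<beta>\<bar>) \<le> 4"
          unfolding distrib_left by linarith
        then have "\<bar>fst p - \<alpha>\<bar> + \<bar>snd p + \<beta>\<bar> \<le> 4 / real (Suc n)"
          by (simp add: field_simps)
        moreover have "dist p (\<alpha>, - \<beta>) \<le> \<bar>fst p - \<alpha>\<bar> + \<bar>snd p + \<beta>\<bar>"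
          using sqrt_sum_squares_le_sum_abs[of "fst p - \<alpha>" "snd p + \<beta>"]
          by (cases p) (simp add: dist_Pair_Pair dist_real_def)
        ultimately have "dist (u p) c < e / 2" using d(2)[OF p] N by linarith
        then have "norm (u p - c) * K n p \<le> e / 2 * K n p"
          by (intro mult_right_mono K0) (simp add: dist_norm)
        then show ?thesis using K0[of n p] by (simp add: left_diff_distrib[symmetric] norm_mult)
      qed simp
    qed
    moreover have "integral R (\<lambda>p. e / 2 * K n p) = e / 2" by (simp add: IK)
    ultimately show "norm (integral R (\<lambda>p. u p * of_real (E n \<alpha> (fst p) * E n \<beta> (- snd p))) - u (\<alpha>, - \<beta>)) < e"
      using e by (simp add: K_def c_def)
  qed
qed

text \<open>The test function is \<open>\<kappa> n a x * \<kappa> n b (- y)\<close>, where \<open>\<kappa> n c\<close> is a smoothed indicator function of \<open>[0, c]\<close>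
  whose derivative is the difference of two mollifiers at the end points.\<close>

lemma klein_gordon_integrated:
  fixes u :: "real \<times> real \<Rightarrow> complex"
  assumes u: "continuous_on ({0..} \<times> {..0}) u"
    and kg: "klein_gordon_distributional ({0<..} \<times> {..<0}) u"
    and a: "0 \<le> a" and b: "0 \<le> b"
  shows "u (a, - b) = u (a, 0) + u (0, - b) - u (0, 0) + integral (cbox (0, - b) (a, 0)) u"
proof -
  obtain \<eta> S :: "real \<Rightarrow> real" where \<eta>: "\<And>k. times_differentiable k \<eta>" "\<And>x. 0 \<le> \<eta> x" "\<And>x. x \<notin> {1..2} \<Longrightarrow> \<eta> x = 0"
    and S: "\<And>x. (S has_real_derivative \<eta> x) (at x)" "\<And>x. x \<le> 1 \<Longrightarrow> S x = 0" "\<And>x. 2 \<le> x \<Longrightarrow> S x = 1"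
    using smooth_step_exists by blast
  have Sk: "times_differentiable k S" for k
    by (rule times_differentiable_SucD) (use S(1) \<eta>(1) in auto)
  have S01: "0 \<le> S x" "S x \<le> 1" for x
  proof -
    have mono: "S x \<le> S y" if "x \<le> y" for x y
      by (rule DERIV_nonneg_imp_nondecreasing[OF that]) (use S(1) \<eta>(2) in blast)
    show "0 \<le> S x" using mono[of "min x 1" x] S(2)[of "min x 1"] by simp
    show "S x \<le> 1" using mono[of x "max x 2"] S(3)[of "max x 2"] by simp
  qed
  define R where "R = cbox (0, - b - 2) (a + 2, 0 :: real)"
  have R: "R = {0..a+2} \<times> {-b-2..0}" unfolding R_def by (auto simp: cbox_Pair_eq)
  have uR: "continuous_on R u" by (rule continuous_on_subset[OF u]) (auto simp: R)
  define E where "E n \<gamma> x = real (Suc n) * \<eta> (real (Suc n) * x + - (real (Suc n) * \<gamma>))" for n \<gamma> x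
  define G where "G n \<gamma> x = S (real (Suc n) * x + - (real (Suc n) * \<gamma>))" for n \<gamma> x
  define \<kappa> where "\<kappa> n a x = G n 0 x - G n a x" for n a x
  define \<kappa>' where "\<kappa>' n a x = E n 0 x - E n a x" for n a x
  \<comment> \<open>The factor \<open>s\<close> lets one set of facts serve both variables:
    \<open>s = 1\<close> for \<open>x\<close> and \<open>s = -1\<close> for the reflected variable
    \<open>y\<close>.\<close>
  have G': "((\<lambda>x. G n \<gamma> (s * x)) has_real_derivative E n \<gamma> (s * x) * s) (at x)" for n \<gamma> s x
    unfolding G_def E_def by (rule DERIV_cong[OF DERIV_chain2[OF S(1)]]) (auto intro!: derivative_eq_intros)
  have sm: "times_differentiable k (\<lambda>x. f (real (Suc n) * (s * x) + - (real (Suc n) * \<gamma>)))"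
    if "\<And>k. times_differentiable k f" for k f n s \<gamma>
    using times_differentiable_affine[OF that, of k "real (Suc n) * s" "- (real (Suc n) * \<gamma>)"] by (simp only: mult.assoc)
  have \<kappa>_sm: "times_differentiable k (\<lambda>x. \<kappa> n a (s * x))" for k n a s
    using times_differentiable_add[OF sm[OF Sk] times_differentiable_mult[OF times_differentiable_const[of _ "-1"] sm[OF Sk]], of k n s 0 n s a]
    by (simp add: \<kappa>_def G_def)
  have \<kappa>'_sm: "times_differentiable k (\<lambda>x. s * \<kappa>' n a (s * x))" for k n a s
    using times_differentiable_mult[OF times_differentiable_const[of _ "s * real (Suc n)"]
      times_differentiable_add[OF sm[OF \<eta>(1)] times_differentiable_mult[OF times_differentiable_const[of _ "-1"] sm[OF \<eta>(1)]]], of k n s 0 n s a]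
    by (simp add: \<kappa>'_def E_def algebra_simps)
  have \<kappa>': "((\<lambda>x. \<kappa> n a (s * x)) has_real_derivative s * \<kappa>' n a (s * x)) (at x)" for n a s x
    unfolding \<kappa>_def \<kappa>'_def by (rule DERIV_cong[OF DERIV_diff[OF G' G']]) (simp add: algebra_simps)
  have \<kappa>_supp: "\<kappa> n c x = 0 \<and> \<kappa>' n c x = 0" if "0 \<le> c" "x \<notin> {1 / real (Suc n)..c + 2}" for n c x
  proof (cases "x < 1 / real (Suc n)")
    case True
    then have "real (Suc n) * x < 1" by (simp add: field_simps)
    moreover have "0 \<le> real (Suc n) * c" using that by simp
    ultimately have "real (Suc n) * x + - (real (Suc n) * 0) < 1" "real (Suc n) * x + - (real (Suc n) * c) < 1" by linarith+
    then show ?thesis using S(2) \<eta>(3) by (simp add: \<kappa>_def \<kappa>'_def G_def E_def del: of_nat_Suc)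
  next
    case False
    then have "c + 2 < x" using that by auto
    then have "1 * 2 < real (Suc n) * (x - c)" "1 * 2 < real (Suc n) * (x - 0)"
      using that by (intro mult_le_less_imp_less; simp)+
    then have "2 < real (Suc n) * x + - (real (Suc n) * 0)" "2 < real (Suc n) * x + - (real (Suc n) * c)"
      by (simp_all add: right_diff_distrib del: of_nat_Suc)
    then show ?thesis using S(3) \<eta>(3) by (simp add: \<kappa>_def \<kappa>'_def G_def E_def del: of_nat_Suc)
  qed
  define I where "I n \<alpha> \<beta> = integral R (\<lambda>p. u p * of_real (E n \<alpha> (fst p) * E n \<beta> (- snd p)))" for n \<alpha> \<beta>
  define J where "J n = integral R (\<lambda>p. u p * of_real (\<kappa> n a (fst p) * \<kappa> n b (- snd p)))" for n
  have \<eta>c: "continuous_on UNIV \<eta>" using \<eta>(1)[of 0] by simp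
  have cf: "continuous_on R (\<lambda>p. f (fst p))" "continuous_on R (\<lambda>p. f (- snd p))"
    if "continuous_on UNIV f" for f :: "real \<Rightarrow> real"
    by (rule continuous_on_compose2[OF that]; intro continuous_intros subset_UNIV)+
  have Ec: "continuous_on UNIV (E n \<gamma>)" for n \<gamma>
    unfolding E_def by (intro continuous_on_mult continuous_on_const continuous_on_compose2[OF \<eta>c]
      continuous_on_add continuous_on_id subset_UNIV)
  have \<kappa>c: "continuous_on UNIV (\<kappa> n c)" for n c using \<kappa>_sm[of 0 n c 1] by simp
  have Iint: "(\<lambda>p. u p * of_real (E n \<alpha> (fst p) * E n \<beta> (- snd p))) integrable_on R" for n \<alpha> \<beta>
    unfolding R_def by (rule integrable_continuous, fold R_def)
      (intro continuous_on_mult continuous_on_of_real uR cf Ec)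
  have Jint: "(\<lambda>p. u p * of_real (\<kappa> n a (fst p) * \<kappa> n b (- snd p))) integrable_on R" for n
    unfolding R_def by (rule integrable_continuous, fold R_def)
      (intro continuous_on_mult continuous_on_of_real uR cf \<kappa>c)
  \<comment> \<open>Expanding the product of the two differences of mollifiers gives four terms, one
    for each corner of the rectangle.\<close>
  have eq: "J n = I n 0 0 - I n a 0 - I n 0 b + I n a b" for n
  proof -
    have "integral R (\<lambda>p. u p * of_real ((1 * \<kappa>' n a (1 * fst p)) * (- 1 * \<kappa>' n b (- 1 * snd p)) + \<kappa> n a (1 * fst p) * \<kappa> n b (- 1 * snd p))) = 0"
    proof (rule klein_gordon_product[OF kg uR])
      show "compact R" by (simp add: R_def)
      show "x \<notin> {1 / real (Suc n)..a + 2} \<Longrightarrow> \<kappa> n a (1 * x) = 0 \<and> 1 * \<kappa>' n a (1 * x) = 0" for x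
        using \<kappa>_supp[OF a] by simp
      show "\<kappa> n b (- 1 * y) = 0 \<and> - 1 * \<kappa>' n b (- 1 * y) = 0" if "y \<notin> {- (b + 2)..- (1 / real (Suc n))}" for y
        using \<kappa>_supp[OF b, of "- y" n] that by auto
      show "{1 / real (Suc n)..a + 2} \<times> {- (b + 2)..- (1 / real (Suc n))} \<subseteq> R"
      proof -
        have "0 \<le> 1 / real (Suc n)" by simp
        then show ?thesis unfolding R by (intro Sigma_mono) (auto simp del: of_nat_Suc)
      qed
    qed (rule \<kappa>_sm \<kappa>' \<kappa>'_sm | simp)+
    then have "integral R (\<lambda>p. u p * of_real (\<kappa> n a (fst p) * \<kappa> n b (- snd p)) -
        (u p * of_real (E n 0 (fst p) * E n 0 (- snd p)) - u p * of_real (E n a (fst p) * E n 0 (- snd p))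
         - u p * of_real (E n 0 (fst p) * E n b (- snd p)) + u p * of_real (E n a (fst p) * E n b (- snd p)))) = 0"
      by (simp add: \<kappa>'_def algebra_simps)
    moreover have "((\<lambda>p. u p * of_real (\<kappa> n a (fst p) * \<kappa> n b (- snd p)) -
        (u p * of_real (E n 0 (fst p) * E n 0 (- snd p)) - u p * of_real (E n a (fst p) * E n 0 (- snd p))
         - u p * of_real (E n 0 (fst p) * E n b (- snd p)) + u p * of_real (E n a (fst p) * E n b (- snd p))))
       has_integral J n - (I n 0 0 - I n a 0 - I n 0 b + I n a b)) R"
      unfolding I_def J_def
      by (intro has_integral_diff has_integral_add integrable_integral Iint Jint)
    ultimately show ?thesis by (simp add: integral_unique)
  qed
  have Ilim: "(\<lambda>n. I n \<alpha> \<beta>) \<longlonglongrightarrow> u (\<alpha>, - \<beta>)" if "\<alpha> \<in> {0..a}" "\<beta> \<in> {0..b}" for \<alpha> \<beta>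
    unfolding I_def E_def R_def
    by (rule product_mollifier_limit[OF \<eta>c \<eta>(2,3) S uR[unfolded R_def] that])
  have "J \<longlonglongrightarrow> u (0, 0) - u (a, 0) - u (0, - b) + u (a, - b)"
    unfolding eq[abs_def] using Ilim[of 0 0] Ilim[of a 0] Ilim[of 0 b] Ilim[of a b] a b
    by (intro tendsto_add tendsto_diff) simp_all
  moreover have "J \<longlonglongrightarrow> integral (cbox (0, - b) (a, 0)) u"
  proof -
    \<comment> \<open>The cutoffs \<open>G n \<gamma>\<close> converge to 0 at
      \<open>\<gamma>\<close> itself, since \<open>S 0 = 0\<close>. The limit domain is therefore
      half-open and differs from the closed box by a null set.\<close>
    define A where "A = {0<..a} \<times> {-b..<0::real}"
    have Glim: "(\<lambda>n. G n \<gamma> x) \<longlonglongrightarrow> (if \<gamma> < x then 1 else 0)" for \<gamma> x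
    proof (cases "\<gamma> < x")
      case True
      have "eventually (\<lambda>n. 2 / (x - \<gamma>) < real (Suc n)) sequentially"
        using filterlim_real_sequentially filterlim_Suc
        by (metis filterlim_compose filterlim_at_top_dense)
      then have "eventually (\<lambda>n. G n \<gamma> x = 1) sequentially"
      proof eventually_elim
        case (elim n)
        then have "2 < real (Suc n) * (x - \<gamma>)" using True by (simp add: field_simps)
        then show ?case unfolding G_def by (intro S(3)) (simp add: right_diff_distrib)
      qed
      then show ?thesis using True by (simp add: tendsto_eventually)
    next
      case False
      have "G n \<gamma> x = 0" for n
      proof -
        have "real (Suc n) * x \<le> real (Suc n) * \<gamma>" using False by (intro mult_left_mono) auto
        then show ?thesis unfolding G_def by (intro S(2)) linarith
      qed
      then show ?thesis using False by simp
    qed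
    have \<kappa>lim: "(\<lambda>n. \<kappa> n c x) \<longlonglongrightarrow> (if x \<in> {0<..c} then 1 else 0)" if "0 \<le> c" for c x
    proof -
      have "(\<lambda>n. \<kappa> n c x) \<longlonglongrightarrow> (if 0 < x then 1 else 0) - (if c < x then 1 else 0)"
        unfolding \<kappa>_def by (intro tendsto_diff Glim)
      moreover have "(if 0 < x then 1 else 0) - (if c < x then 1 else 0) = (if x \<in> {0<..c} then 1 else (0::real))"
        using that by auto
      ultimately show ?thesis by simp
    qed
    have \<kappa>1: "\<bar>\<kappa> n c x\<bar> \<le> 1" for n c x
      unfolding \<kappa>_def G_def
      using S01[of "real (Suc n) * x + - (real (Suc n) * 0)"] S01[of "real (Suc n) * x + - (real (Suc n) * c)"]
      by linarith
    have "(\<lambda>n. integral R (\<lambda>p. u p * of_real (\<kappa> n a (fst p) * \<kappa> n b (- snd p)))) \<longlonglongrightarrow> integral R (\<lambda>p. if p \<in> A then u p else 0)"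
    proof (rule dominated_convergence(2)[where h = "\<lambda>p. norm (u p)"])
      show "(\<lambda>p. norm (u p)) integrable_on R" unfolding R_def
        by (rule integrable_continuous, fold R_def) (intro continuous_on_norm uR)
      show "norm (u p * of_real (\<kappa> n a (fst p) * \<kappa> n b (- snd p))) \<le> norm (u p)" for n p
      proof -
        have "\<bar>\<kappa> n a (fst p)\<bar> * \<bar>\<kappa> n b (- snd p)\<bar> \<le> 1 * 1" by (intro mult_mono \<kappa>1) auto
        then have "norm (u p) * (\<bar>\<kappa> n a (fst p)\<bar> * \<bar>\<kappa> n b (- snd p)\<bar>) \<le> norm (u p) * 1" by (intro mult_left_mono) auto
        then show ?thesis by (simp add: norm_mult)
      qed
      show "(\<lambda>n. u p * of_real (\<kappa> n a (fst p) * \<kappa> n b (- snd p))) \<longlonglongrightarrow> (if p \<in> A then u p else 0)" for p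
      proof -
        have "(\<lambda>n. u p * of_real (\<kappa> n a (fst p) * \<kappa> n b (- snd p))) \<longlonglongrightarrow>
          u p * of_real ((if fst p \<in> {0<..a} then 1 else 0) * (if - snd p \<in> {0<..b} then 1 else 0))"
          by (intro tendsto_mult tendsto_const tendsto_of_real \<kappa>lim a b)
        moreover have "u p * of_real ((if fst p \<in> {0<..a} then 1 else 0) * (if - snd p \<in> {0<..b} then 1 else 0)) = (if p \<in> A then u p else 0)"
          by (cases p) (auto simp: A_def)
        ultimately show ?thesis by simp
      qed
    qed (rule Jint)
    also have "integral R (\<lambda>p. if p \<in> A then u p else 0) = integral (A \<inter> R) u"
      by (rule Henstock_Kurzweil_Integration.integral_restrict_Int)
    also have "A \<inter> R = A" by (auto simp: A_def R)
    also have "integral A u = integral (cbox (0, - b) (a, 0)) u"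
    proof (rule integral_subset_negligible)
      show "A \<subseteq> cbox (0, - b) (a, 0)" by (auto simp: A_def cbox_Pair_eq)
      have "cbox (0, - b) (a, 0) - A \<subseteq> cbox (0, - b) (a, 0) - box (0, - b) (a, 0)"
        by (auto simp: A_def cbox_Pair_eq box_def Basis_prod_def)
      then show "negligible (cbox (0, - b) (a, 0) - A)"
        by (rule negligible_subset[OF negligible_frontier_interval])
    qed
    finally show ?thesis unfolding J_def .
  qed
  ultimately have "u (0, 0) - u (a, 0) - u (0, - b) + u (a, - b) = integral (cbox (0, - b) (a, 0)) u"
    by (rule LIMSEQ_unique)
  then show ?thesis by (simp add: algebra_simps)
qed

section \<open>The Goursat problem\<close>

text \<open>Integrated form of the Goursat problem \<open>v\<^sub>x\<^sub>t = v\<close>, \<open>v (0, t) = 0\<close>.\<close>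

definition goursat :: "(real \<Rightarrow> real \<Rightarrow> complex) \<Rightarrow> bool" where
  "goursat v \<longleftrightarrow> continuous_on ({0..} \<times> {0..}) (\<lambda>(x, t). v x t) \<and>
     (\<forall>x\<ge>0. \<forall>t\<ge>0. v x t = v x 0 + integral {0..t} (\<lambda>s. integral {0..x} (\<lambda>\<xi>. v \<xi> s)))"

lemma goursat_eq:
  assumes "goursat v" "0 \<le> x" "0 \<le> t"
  shows "v x t = v x 0 + integral {0..t} (\<lambda>s. integral {0..x} (\<lambda>\<xi>. v \<xi> s))"
  using assms unfolding goursat_def by blast

lemma goursat_continuous_x:
  assumes "goursat v" "0 \<le> t" "0 \<le> a"
  shows "continuous_on {a..b} (\<lambda>x. v x t)"
proof -
  have "continuous_on {a..b} (\<lambda>x. case (x, t) of (x, t) \<Rightarrow> v x t)"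
    by (rule continuous_on_compose2[of "{0..} \<times> {0..}" _ "{a..b}" "\<lambda>x. (x, t)"])
      (use assms in \<open>auto simp: goursat_def intro!: continuous_on_Pair continuous_on_id continuous_on_const\<close>)
  then show ?thesis by simp
qed

lemma goursat_continuous:
  assumes "goursat v" "0 \<le> a" "0 \<le> c"
  shows "continuous_on ({a..b} \<times> {c..d}) (\<lambda>(x, t). v x t)"
  by (rule continuous_on_subset[of "{0..} \<times> {0..}"]) (use assms in \<open>auto simp: goursat_def\<close>)

lemma goursat_inner_continuous:
  assumes "goursat v" "0 \<le> x"
  shows "continuous_on {0..b} (\<lambda>s. integral {0..x} (\<lambda>\<xi>. v \<xi> s))"
proof -
  have "continuous_on ({0..b} \<times> cbox 0 x) (\<lambda>(s, \<xi>). v \<xi> s)"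
  proof -
    have "continuous_on ({0..b} \<times> {0..x}) (\<lambda>p. case prod.swap p of (x, t) \<Rightarrow> v x t)"
      by (rule continuous_on_compose2[OF goursat_continuous[OF assms(1) order_refl order_refl, of x b] continuous_on_swap]) auto
    then show ?thesis by (simp add: case_prod_beta')
  qed
  from integral_continuous_on_param[OF this] show ?thesis by simp
qed

text \<open>The upper limit varies together with the parameter. Substituting
  \<open>\<xi> = s * x\<close> moves it into an integrand over the fixed interval
  \<open>[0, 1]\<close>, where continuity of parameter integrals applies.\<close>

lemma goursat_inner_continuous2:
  assumes v: "goursat v"
  shows "continuous_on ({0..T} \<times> {0..X}) (\<lambda>p. integral {0..snd p} (\<lambda>\<xi>. v \<xi> (fst p)))"
proof -
  have eq: "integral {0..x} (\<lambda>\<xi>. v \<xi> t) = integral {0..1} (\<lambda>s. x *\<^sub>R v (s * x) t)" if "0 \<le> x" "0 \<le> t" for x t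
  proof -
    have "((\<lambda>s. x *\<^sub>R v (s * x) t) has_integral integral {0 * x..1 * x} (\<lambda>\<xi>. v \<xi> t)) {0..1}"
      by (rule has_integral_substitution[where c = 0 and d = x])
        (use that goursat_continuous_x[OF v] in \<open>auto intro!: derivative_eq_intros mult_left_le_one_le\<close>)
    from integral_unique[OF this] show ?thesis by (simp only: mult_zero_left mult_1_left)
  qed
  have "continuous_on (({0..T} \<times> {0..X}) \<times> {0..1}) (\<lambda>q. case (snd q * snd (fst q), fst (fst q)) of (x, t) \<Rightarrow> v x t)"
  proof (rule continuous_on_compose2[of "{0..} \<times> {0..}"])
    show "continuous_on ({0..} \<times> {0..}) (\<lambda>(x, t). v x t)" using v by (simp only: goursat_def)
  qed (intro continuous_intros, auto)
  then have "continuous_on (({0..T} \<times> {0..X}) \<times> {0..1})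
      (\<lambda>q. snd (fst q) *\<^sub>R v (snd q * snd (fst q)) (fst (fst q)))"
    by (intro continuous_on_scaleR continuous_intros) simp
  then have "continuous_on (({0..T} \<times> {0..X}) \<times> cbox 0 1) (\<lambda>(p, s). snd p *\<^sub>R v (s * snd p) (fst p))"
    by (simp add: case_prod_beta')
  from integral_continuous_on_param[OF this]
  have "continuous_on ({0..T} \<times> {0..X}) (\<lambda>p. integral {0..1} (\<lambda>s. snd p *\<^sub>R v (s * snd p) (fst p)))"
    by simp
  then show ?thesis
    by (rule continuous_on_eq) (auto simp: eq)
qed

lemma exp_weighted_integral_le:
  fixes a :: real
  assumes "0 < a" "0 \<le> x"
  shows "(\<lambda>s. exp (a * s)) integrable_on {0..x}" "integral {0..x} (\<lambda>s. exp (a * s)) \<le> exp (a * x) / a"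
proof -
  have "((\<lambda>s. exp (a * s)) has_integral exp (a * x) / a - exp (a * 0) / a) {0..x}"
    by (rule fundamental_theorem_of_calculus)
      (use assms in \<open>auto intro!: derivative_eq_intros simp: has_real_derivative_iff_has_vector_derivative[symmetric]\<close>)
  then show "(\<lambda>s. exp (a * s)) integrable_on {0..x}" "integral {0..x} (\<lambda>s. exp (a * s)) \<le> exp (a * x) / a"
    using assms by (auto simp: integral_unique has_integral_integrable)
qed

text \<open>In the norm weighted by \<open>exp (- \<sigma> x - 2 t / \<sigma>)\<close> the integral operator has norm at most \<open>1/2\<close>.\<close>

lemma goursat_exp_bound:
  assumes v: "goursat v" and \<sigma>: "0 < \<sigma>"
    and K: "\<And>x. 0 \<le> x \<Longrightarrow> cmod (v x 0) \<le> K * exp (\<sigma> * x)"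
    and xt: "0 \<le> x" "0 \<le> t"
  shows "cmod (v x t) \<le> 2 * K * exp (\<sigma> * x + 2 / \<sigma> * t)"
proof -
  define w where "w p = cmod (case p of (x, t) \<Rightarrow> v x t) * exp (- \<sigma> * fst p - 2 / \<sigma> * snd p)" for p
  \<comment> \<open>The maximum is taken over a compact rectangle, so it is finite without any
    growth assumption for \<open>t > 0\<close>; the integral equation at points of this rectangle
    uses only values of \<open>v\<close> inside it.\<close>
  have "\<exists>p0\<in>{0..x} \<times> {0..t}. \<forall>p\<in>{0..x} \<times> {0..t}. w p \<le> w p0"
  proof (rule continuous_attains_sup)
    show "continuous_on ({0..x} \<times> {0..t}) w" unfolding w_def
      by (intro continuous_intros goursat_continuous[OF v]) simp_all
  qed (use xt in \<open>simp_all add: compact_Times\<close>)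
  then obtain p0 where p0: "p0 \<in> {0..x} \<times> {0..t}" "\<And>p. p \<in> {0..x} \<times> {0..t} \<Longrightarrow> w p \<le> w p0"
    by blast
  define N where "N = w p0"
  have N0: "0 \<le> N" by (simp add: N_def w_def)
  have vN: "cmod (v a b) \<le> N * exp (\<sigma> * a + 2 / \<sigma> * b)" if "a \<in> {0..x}" "b \<in> {0..t}" for a b
  proof -
    have "cmod (v a b) * exp (- \<sigma> * a - 2 / \<sigma> * b) * exp (\<sigma> * a + 2 / \<sigma> * b) \<le> N * exp (\<sigma> * a + 2 / \<sigma> * b)"
      using p0(2)[of "(a, b)"] that unfolding N_def w_def by (intro mult_right_mono) auto
    then show ?thesis by (simp add: mult.assoc exp_add[symmetric])
  qed
  \<comment> \<open>Integrating the weight costs \<open>1 / \<sigma>\<close> in \<open>x\<close> and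
    \<open>\<sigma> / 2\<close> in \<open>t\<close>, together \<open>1 / 2\<close>. At a maximum
    point this reads \<open>N \<le> K + N / 2\<close>.\<close>
  have step: "cmod (v a b) \<le> (K + N / 2) * exp (\<sigma> * a + 2 / \<sigma> * b)" if ab: "a \<in> {0..x}" "b \<in> {0..t}" for a b
  proof -
    have ab0: "0 \<le> a" "0 \<le> b" using ab by auto
    have inner: "cmod (integral {0..a} (\<lambda>\<xi>. v \<xi> s)) \<le> N / \<sigma> * exp (\<sigma> * a) * exp (2 / \<sigma> * s)" if s: "s \<in> {0..b}" for s
    proof -
      have "cmod (integral {0..a} (\<lambda>\<xi>. v \<xi> s)) \<le> integral {0..a} (\<lambda>\<xi>. N * exp (2 / \<sigma> * s) * exp (\<sigma> * \<xi>))"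
      proof (rule integral_norm_bound_integral)
        show "(\<lambda>\<xi>. v \<xi> s) integrable_on {0..a}"
          by (intro integrable_continuous_interval goursat_continuous_x[OF v]) (use s in auto)
        show "(\<lambda>\<xi>. N * exp (2 / \<sigma> * s) * exp (\<sigma> * \<xi>)) integrable_on {0..a}"
          by (intro integrable_on_mult_right exp_weighted_integral_le \<sigma> ab0)
        show "cmod (v \<xi> s) \<le> N * exp (2 / \<sigma> * s) * exp (\<sigma> * \<xi>)" if "\<xi> \<in> {0..a}" for \<xi>
          using vN[of \<xi> s] that s ab by (simp add: exp_add mult_ac)
      qed
      also have "\<dots> \<le> N * exp (2 / \<sigma> * s) * (exp (\<sigma> * a) / \<sigma>)"
        unfolding integral_mult_right
        by (intro mult_left_mono exp_weighted_integral_le(2) \<sigma> ab0 mult_nonneg_nonneg N0) simp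
      finally show ?thesis by (simp add: mult_ac)
    qed
    have "cmod (integral {0..b} (\<lambda>s. integral {0..a} (\<lambda>\<xi>. v \<xi> s)))
        \<le> integral {0..b} (\<lambda>s. N / \<sigma> * exp (\<sigma> * a) * exp (2 / \<sigma> * s))"
    proof (rule integral_norm_bound_integral)
      show "(\<lambda>s. integral {0..a} (\<lambda>\<xi>. v \<xi> s)) integrable_on {0..b}"
        by (intro integrable_continuous_interval goursat_inner_continuous[OF v] ab0)
      show "(\<lambda>s. N / \<sigma> * exp (\<sigma> * a) * exp (2 / \<sigma> * s)) integrable_on {0..b}"
        by (intro integrable_on_mult_right exp_weighted_integral_le ab0 divide_pos_pos \<sigma>) simp
    qed (rule inner)
    also have "\<dots> \<le> N / \<sigma> * exp (\<sigma> * a) * (exp (2 / \<sigma> * b) / (2 / \<sigma>))"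
      unfolding integral_mult_right
      by (intro mult_left_mono exp_weighted_integral_le(2) ab0 mult_nonneg_nonneg divide_nonneg_pos N0 \<sigma>)
        (simp_all add: \<sigma>)
    also have "\<dots> = N / 2 * exp (\<sigma> * a + 2 / \<sigma> * b)"
      using \<sigma> by (simp add: exp_add)
    finally have J: "cmod (integral {0..b} (\<lambda>s. integral {0..a} (\<lambda>\<xi>. v \<xi> s))) \<le> N / 2 * exp (\<sigma> * a + 2 / \<sigma> * b)" .
    have K0: "0 \<le> K" using K[of 0] norm_ge_zero[of "v 0 0"] by (simp del: norm_ge_zero)
    have "cmod (v a 0) \<le> K * exp (\<sigma> * a)" using K ab0 by simp
    also have "\<dots> \<le> K * exp (\<sigma> * a + 2 / \<sigma> * b)" using K0 \<sigma> ab0 by (intro mult_left_mono) auto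
    finally have "cmod (v a 0) \<le> K * exp (\<sigma> * a + 2 / \<sigma> * b)" .
    moreover have "cmod (v a b) \<le> cmod (v a 0) + cmod (integral {0..b} (\<lambda>s. integral {0..a} (\<lambda>\<xi>. v \<xi> s)))"
      unfolding goursat_eq[OF v ab0] by (rule norm_triangle_ineq)
    ultimately have "cmod (v a b) \<le> K * exp (\<sigma> * a + 2 / \<sigma> * b) + N / 2 * exp (\<sigma> * a + 2 / \<sigma> * b)"
      using J by linarith
    then show ?thesis by (simp only: distrib_right)
  qed
  obtain a b where ab: "p0 = (a, b)" "a \<in> {0..x}" "b \<in> {0..t}" using p0(1) by (rule SigmaE)
  have "N \<le> (K + N / 2) * exp (\<sigma> * a + 2 / \<sigma> * b) * exp (- \<sigma> * a - 2 / \<sigma> * b)"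
    using mult_right_mono[OF step[OF ab(2,3)], of "exp (- \<sigma> * a - 2 / \<sigma> * b)"]
    by (simp add: N_def w_def ab(1))
  then have "N \<le> 2 * K" by (simp add: mult.assoc exp_add[symmetric])
  then have "N * exp (\<sigma> * x + 2 / \<sigma> * t) \<le> 2 * K * exp (\<sigma> * x + 2 / \<sigma> * t)" by (intro mult_right_mono) auto
  moreover have "cmod (v x t) \<le> N * exp (\<sigma> * x + 2 / \<sigma> * t)" by (rule vN) (use xt in auto)
  ultimately show ?thesis by linarith
qed

text \<open>Here \<open>v\<^sub>t(x, t) = \<integral>\<^sub>0\<^sup>x v(\<xi>, t) d\<xi>\<close>, and integration by parts in \<open>x\<close> shows that \<open>exp (- t / z) W t\<close> is
  constant in \<open>t\<close> up to a boundary term at \<open>X\<close>.\<close>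

lemma goursat_Laplace_step:
  assumes v: "goursat v" and z: "z \<noteq> 0" and X: "0 \<le> X" and T: "0 \<le> T"
  defines "W \<equiv> \<lambda>t. integral {0..X} (\<lambda>x. v x t * exp (- z * of_real x))"
    and "P \<equiv> \<lambda>t. integral {0..X} (\<lambda>x. v x t)"
  shows "((\<lambda>t. - exp (- z * of_real X) / z * P t * exp (- of_real t / z)) has_integral
     exp (- of_real T / z) * W T - W 0) {0..T}"
proof -
  define Q where "Q x t = integral {0..x} (\<lambda>\<xi>. v \<xi> t)" for x t
  have Qd: "((\<lambda>x. Q x t) has_vector_derivative v x t) (at x within {0..X})" if "x \<in> {0..X}" "0 \<le> t" for x t
    unfolding Q_def
    by (rule integral_has_vector_derivative[OF goursat_continuous_x[OF v]]) (use that in auto)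
  \<comment> \<open>Integration by parts in \<open>x\<close>: the boundary term at 0 vanishes since
    \<open>Q 0 t = 0\<close>, the one at \<open>X\<close> stays.\<close>
  have parts: "((\<lambda>x. Q x t * exp (- z * of_real x)) has_integral
      (W t - exp (- z * of_real X) * P t) / z) {0..X}" if t: "0 \<le> t" for t
  proof -
    have Qd': "((\<lambda>x. - (Q x t * exp (- z * of_real x))) has_vector_derivative
        z * (Q x t * exp (- z * of_real x)) - v x t * exp (- z * of_real x)) (at x within {0..X})" if "x \<in> {0..X}" for x
    proof -
      have e: "((\<lambda>x. exp (- z * of_real x)) has_vector_derivative - z * exp (- z * of_real x)) (at x within {0..X})"
        by (rule has_vector_derivative_real_field) (auto intro!: derivative_eq_intros)
      show ?thesis
        by (rule has_vector_derivative_eq_rhs[OF has_vector_derivative_minus[OF has_vector_derivative_mult[OF Qd[OF that t] e]]])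
          (simp add: algebra_simps)
    qed
    have "((\<lambda>x. z * (Q x t * exp (- z * of_real x)) - v x t * exp (- z * of_real x)) has_integral
        - (Q X t * exp (- z * of_real X)) - - (Q 0 t * exp (- z * of_real 0))) {0..X}"
      by (rule fundamental_theorem_of_calculus[OF X Qd'])
    moreover have "((\<lambda>x. v x t * exp (- z * of_real x)) has_integral W t) {0..X}"
      unfolding W_def
      by (intro integrable_integral integrable_continuous_interval continuous_intros goursat_continuous_x[OF v] t) auto
    ultimately have "((\<lambda>x. z * (Q x t * exp (- z * of_real x)) - v x t * exp (- z * of_real x)
        + v x t * exp (- z * of_real x)) has_integral
        - (Q X t * exp (- z * of_real X)) - - (Q 0 t * exp (- z * of_real 0)) + W t) {0..X}"
      by (rule has_integral_add)
    then have "((\<lambda>x. z * (Q x t * exp (- z * of_real x))) has_integral W t - exp (- z * of_real X) * P t) {0..X}"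
      by (simp add: Q_def P_def mult.commute)
    from has_integral_mult_right[OF this, of "1 / z"] show ?thesis using z by simp
  qed
  have vd: "((\<lambda>t. v x t) has_vector_derivative Q x t) (at t within {0..T})" if x: "0 \<le> x" and t: "t \<in> {0..T}" for x t
  proof -
    have "((\<lambda>t. integral {0..t} (\<lambda>s. Q x s)) has_vector_derivative Q x t) (at t within {0..T})"
      by (rule integral_has_vector_derivative[OF _ t])
        (use goursat_inner_continuous[OF v x] in \<open>simp add: Q_def\<close>)
    then have d: "((\<lambda>t. v x 0 + integral {0..t} (\<lambda>s. Q x s)) has_vector_derivative Q x t) (at t within {0..T})"
      by (subst add.commute) (simp only: has_vector_derivative_add_const)
    have eq: "v x t = v x 0 + integral {0..t} (\<lambda>s. Q x s)" if "t \<in> {0..T}" for t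
      unfolding Q_def by (rule goursat_eq[OF v x]) (use that in simp)
    show ?thesis by (rule has_vector_derivative_transform[OF t eq d])
  qed
  \<comment> \<open>Differentiation under the integral sign, with \<open>Q x t\<close> as the
    \<open>t\<close>-derivative of \<open>v x t\<close>; the joint continuity of \<open>Q\<close>
    that it requires is \<open>goursat_inner_continuous2\<close>.\<close>
  have Wd: "(W has_vector_derivative integral {0..X} (\<lambda>x. Q x t * exp (- z * of_real x))) (at t within {0..T})"
    if t: "t \<in> {0..T}" for t
  proof -
    have "((\<lambda>t. integral (cbox 0 X) (\<lambda>x. v x t * exp (- z * of_real x))) has_vector_derivative
        integral (cbox 0 X) (\<lambda>x. Q x t * exp (- z * of_real x))) (at t within {0..T})"
    proof (rule leibniz_rule_vector_derivative)
      show "((\<lambda>t. v x t * exp (- z * of_real x)) has_vector_derivative Q x t * exp (- z * of_real x)) (at t within {0..T})"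
        if "t \<in> {0..T}" "x \<in> cbox 0 X" for t x
        using that by (intro has_vector_derivative_mult_left vd) auto
      show "(\<lambda>x. v x t * exp (- z * of_real x)) integrable_on cbox 0 X" if "t \<in> {0..T}" for t
        unfolding cbox_interval
        by (intro integrable_continuous_interval continuous_intros goursat_continuous_x[OF v]) (use that in auto)
      have "continuous_on ({0..T} \<times> {0..X}) (\<lambda>p. Q (snd p) (fst p))"
        unfolding Q_def by (rule goursat_inner_continuous2[OF v])
      then have "continuous_on ({0..T} \<times> {0..X}) (\<lambda>p. Q (snd p) (fst p) * exp (- z * of_real (snd p)))"
        by (intro continuous_intros)
      then show "continuous_on ({0..T} \<times> cbox 0 X) (\<lambda>(t, x). Q x t * exp (- z * of_real x))"
        by (simp add: case_prod_beta')
    qed (use t in auto)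
    then show ?thesis by (simp add: W_def)
  qed
  have "((\<lambda>t. - exp (- z * of_real X) / z * P t * exp (- of_real t / z)) has_integral
     exp (- of_real T / z) * W T - exp (- of_real 0 / z) * W 0) {0..T}"
  proof (rule fundamental_theorem_of_calculus[OF T])
    fix t assume t: "t \<in> {0..T}"
    have e: "((\<lambda>t. exp (- of_real t / z)) has_vector_derivative - (1 / z) * exp (- of_real t / z)) (at t within {0..T})"
      by (rule has_vector_derivative_real_field) (use z in \<open>auto intro!: derivative_eq_intros\<close>)
    have Wt: "integral {0..X} (\<lambda>x. Q x t * exp (- z * of_real x)) = (W t - exp (- z * of_real X) * P t) / z"
      by (rule integral_unique[OF parts]) (use t in simp)
    have "a * ((w - b * p) / z) + - (1 / z) * a * w = - b / z * p * a" for a b p w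
      using z 
      by (simp add: divide_inverse ring_distribs mult_ac)
    from this[of "exp (- of_real t / z)" "W t" "exp (- z * of_real X)" "P t"]
    show "((\<lambda>t. exp (- of_real t / z) * W t) has_vector_derivative
        - exp (- z * of_real X) / z * P t * exp (- of_real t / z)) (at t within {0..T})"
      by (rule has_vector_derivative_eq_rhs[OF has_vector_derivative_mult[OF e Wd[OF t], unfolded Wt]])
  qed
  then show ?thesis by (simp only: of_real_0 minus_zero div_0 exp_zero mult_1_left)
qed

section \<open>Phragmen-Lindeloef theorems\<close>

lemma Arg_sector:
  assumes "0 < k" and "\<bar>Im z\<bar> \<le> k * Re z" and "z \<noteq> 0"
  shows "0 < Re z" and "\<bar>Arg z\<bar> \<le> arctan k"
proof -
  have "0 \<le> Re z" using assms(1,2) abs_ge_zero[of "Im z"] by (metis order_trans mult.commute zero_le_mult_iff not_le)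
  moreover have "Re z \<noteq> 0" using assms by (auto simp: complex_eq_iff)
  ultimately show re: "0 < Re z" by simp
  have A: "Arg z = arctan (Im z / Re z)"
    using re by (simp add: arg_conv_arctan)
  have "\<bar>Im z / Re z\<bar> \<le> k" using re assms(2) by (simp add: field_simps)
  then have "arctan \<bar>Im z / Re z\<bar> \<le> arctan k" by (rule arctan_monotone')
  then show "\<bar>Arg z\<bar> \<le> arctan k" unfolding A
    using arctan_minus[of "Im z / Re z"] by (auto simp: abs_if split: if_splits)
qed

lemma mult_le_abs_mult:
  fixes a x y :: real
  assumes "\<bar>x\<bar> \<le> y"
  shows "a * x \<le> \<bar>a\<bar> * y"
  using mult_left_mono[OF assms, of "\<bar>a\<bar>"] abs_ge_self[of "a * x"] by (simp add: abs_mult)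

text \<open>The half-angle \<open>\<beta> = arctan k\<close> is below \<open>pi / 2\<close>, so
  there is room for an exponent \<open>\<gamma>\<close> with
  \<open>1 < \<gamma> < pi / (2 * \<beta>)\<close>. The factor
  \<open>exp (- \<delta> * z powr \<gamma>)\<close> then beats exponential growth on the whole
  closed sector, because \<open>Re (z powr \<gamma>)\<close> is at least
  \<open>cos (\<gamma> * \<beta>) * cmod z powr \<gamma>\<close>. The maximum principle on a
  truncated sector and \<open>\<delta> \<rightarrow> 0\<close> finish.\<close>

lemma phragmen_lindelof_sector:
  fixes f :: "complex \<Rightarrow> complex"
  assumes k: "0 < k"
    and hol: "f holomorphic_on {z. \<bar>Im z\<bar> < k * Re z}"
    and cont: "continuous_on {z. \<bar>Im z\<bar> \<le> k * Re z} f"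
    and growth: "\<And>z. \<bar>Im z\<bar> \<le> k * Re z \<Longrightarrow> cmod (f z) \<le> C * exp (K * cmod z)"
    and bound: "\<And>z. \<bar>Im z\<bar> = k * Re z \<Longrightarrow> cmod (f z) \<le> M"
    and z0: "\<bar>Im z0\<bar> \<le> k * Re z0"
  shows "cmod (f z0) \<le> M"
proof (cases "\<bar>Im z0\<bar> = k * Re z0")
  case True
  then show ?thesis by (rule bound)
next
  case False
  define S where "S = {z. \<bar>Im z\<bar> \<le> k * Re z}"
  define \<beta> where "\<beta> = arctan k"
  have \<beta>: "0 < \<beta>" "\<beta> < pi/2" using k arctan_ubound by (auto simp: \<beta>_def)
  \<comment> \<open>The midpoint between 1 and \<open>pi / (2 * \<beta>)\<close>.\<close>
  define \<gamma> where "\<gamma> = (1 + pi / (2*\<beta>)) / 2"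
  have pb: "pi / (2*\<beta>) > 1" using \<beta> by (simp add: field_simps)
  have \<gamma>: "1 < \<gamma>" using pb by (simp add: \<gamma>_def)
  have "\<gamma> < pi / (2*\<beta>)" using pb by (simp add: \<gamma>_def)
  then have \<gamma>\<beta>: "\<gamma> * \<beta> < pi/2" using \<beta> by (simp add: field_simps)
  define c where "c = cos (\<gamma> * \<beta>)"
  have c: "0 < c" unfolding c_def
    by (rule cos_gt_zero_pi) (use \<gamma> \<beta> \<gamma>\<beta> in \<open>auto intro: less_trans[of _ 0]\<close>)
  have M0: "0 \<le> M" using bound[of 0] norm_ge_zero[of "f 0"] by (simp del: norm_ge_zero)
  have C0: "0 \<le> C" using growth[of 0] norm_ge_zero[of "f 0"] by (simp del: norm_ge_zero)
  have Rep: "c * cmod z powr \<gamma> \<le> Re (z powr \<gamma>)" if "z \<in> S" for z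
  proof (cases "z = 0")
    case False
    have A: "\<bar>Arg z\<bar> \<le> \<beta>"
      using Arg_sector(2)[OF k _ False] that by (simp add: S_def \<beta>_def)
    have "Re (z powr \<gamma>) = cmod z powr \<gamma> * cos (\<gamma> * Arg z)"
      using False by (simp add: powr_def Re_exp Arg_eq_Im_Ln)
    moreover have "c \<le> cos (\<gamma> * Arg z)"
    proof -
      have "\<bar>\<gamma> * Arg z\<bar> \<le> \<gamma> * \<beta>" using A \<gamma> by (simp add: abs_mult)
      then have "cos (\<gamma> * \<beta>) \<le> cos \<bar>\<gamma> * Arg z\<bar>"
        by (intro cos_monotone_0_pi_le) (use \<gamma>\<beta> pi_gt_zero in linarith)+
      then show ?thesis by (simp add: c_def)
    qed
    ultimately show ?thesis using mult_left_mono[of c "cos (\<gamma> * Arg z)" "cmod z powr \<gamma>"]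
      by (simp add: mult.commute)
  qed auto
  \<comment> \<open>The vertex 0 lies on the branch cut; there continuity comes from the modulus
    \<open>cmod z powr \<gamma>\<close> tending to 0, and \<open>0 powr \<gamma> = 0\<close> is the
    right value.\<close>
  have contp: "continuous_on S (\<lambda>z. z powr (of_real \<gamma> :: complex))"
  proof -
    have "continuous (at z within S) (\<lambda>z. z powr (of_real \<gamma> :: complex))" if "z \<in> S" for z
    proof (cases "z = 0")
      case True
      have "((\<lambda>z::complex. z powr (of_real \<gamma> :: complex)) \<longlongrightarrow> 0) (at 0)"
      proof (rule tendsto_norm_zero_cancel)
        have "((\<lambda>z::complex. cmod z powr \<gamma>) \<longlongrightarrow> 0 powr \<gamma>) (at 0)"
          by (rule tendsto_powr2) (use \<gamma> in \<open>auto intro!: tendsto_norm_zero always_eventually\<close>)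
        then show "((\<lambda>z::complex. cmod (z powr (of_real \<gamma> :: complex))) \<longlongrightarrow> 0) (at 0)"
          using \<gamma> by (simp add: norm_powr_real_powr')
      qed
      then show ?thesis using True
        by (simp add: continuous_within tendsto_within_subset[OF _ subset_UNIV])
    next
      case False
      then have "0 < Re z" using Arg_sector(1)[OF k] that by (simp add: S_def)
      then have "z \<notin> \<real>\<^sub>\<le>\<^sub>0" by (auto simp: complex_nonpos_Reals_iff)
      then show ?thesis unfolding continuous_within
        by (rule tendsto_powr_complex) (auto intro!: tendsto_intros)
    qed
    then show ?thesis by (simp add: continuous_on_eq_continuous_within)
  qed
  \<comment> \<open>One \<open>\<delta>\<close> serves twice: as damping parameter, and as the bound
    on the arc \<open>cmod z = R\<close>, where the damped function is below \<open>\<delta>\<close>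
    for a suitable large \<open>R\<close>.\<close>
  have main: "cmod (f z0 * exp (- of_real \<delta> * z0 powr of_real \<gamma>)) \<le> M + \<delta>" if \<delta>: "0 < \<delta>" for \<delta>
  proof -
    define g where "g z = f z * exp (- of_real \<delta> * z powr of_real \<gamma>)" for z
    have gn: "cmod (g z) \<le> cmod (f z) * exp (- \<delta> * c * cmod z powr \<gamma>)" if "z \<in> S" for z
      using Rep[OF that] \<delta> by (auto simp: g_def norm_mult mult_left_mono mult.assoc)
    have "((\<lambda>R. C * exp (K * R - \<delta> * c * R powr \<gamma>)) \<longlongrightarrow> 0) at_top"
    proof -
      have "filterlim (\<lambda>R. R powr (\<gamma> - 1)) at_top at_top"
        by (rule real_powr_at_top) (use \<gamma> in simp)
      then have "filterlim (\<lambda>R. (\<delta>*c) * R powr (\<gamma> - 1)) at_top at_top"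
        by (rule filterlim_tendsto_pos_mult_at_top[rotated 2, OF _ tendsto_const]) (use \<delta> c in simp)
      then have "filterlim (\<lambda>R. - K + (\<delta>*c) * R powr (\<gamma> - 1)) at_top at_top"
        by (rule filterlim_tendsto_add_at_top[OF tendsto_const])
      then have "filterlim (\<lambda>R. R * (- K + (\<delta>*c) * R powr (\<gamma> - 1))) at_top at_top"
        by (rule filterlim_at_top_mult_at_top[OF filterlim_ident])
      then have "filterlim (\<lambda>R. - (R * (- K + (\<delta>*c) * R powr (\<gamma> - 1)))) at_bot at_top"
        by (simp add: filterlim_uminus_at_bot)
      then have "((\<lambda>R. exp (- (R * (- K + (\<delta>*c) * R powr (\<gamma> - 1))))) \<longlongrightarrow> 0) at_top"
        by (rule filterlim_compose[OF exp_at_bot])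
      moreover have "eventually (\<lambda>R. exp (- (R * (- K + (\<delta>*c) * R powr (\<gamma> - 1)))) = exp (K * R - \<delta> * c * R powr \<gamma>)) at_top"
        using eventually_gt_at_top[of 0]
        by eventually_elim (simp add: powr_diff field_simps)
      ultimately have "((\<lambda>R. exp (K * R - \<delta> * c * R powr \<gamma>)) \<longlongrightarrow> 0) at_top"
        by (rule Lim_transform_eventually)
      then show ?thesis by (rule tendsto_mult_right_zero)
    qed
    then have "eventually (\<lambda>R. C * exp (K * R - \<delta> * c * R powr \<gamma>) < \<delta>) at_top"
      using \<delta> by (rule order_tendstoD)
    then have "eventually (\<lambda>R. C * exp (K * R - \<delta> * c * R powr \<gamma>) < \<delta> \<and> cmod z0 < R) at_top"
      using eventually_gt_at_top by (rule eventually_conj)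
    then obtain R where R: "C * exp (K * R - \<delta> * c * R powr \<gamma>) < \<delta>" "cmod z0 < R"
      by (auto dest!: eventually_happens)
    define T where "T = {z. \<bar>Im z\<bar> < k * Re z} \<inter> ball 0 R"
    have oT: "open T" unfolding T_def
      by (intro open_Int open_Collect_less continuous_intros) auto
    have cS: "closed S" unfolding S_def
      by (rule closed_Collect_le) (intro continuous_intros)+
    have clT: "closure T \<subseteq> S \<inter> cball 0 R"
      by (rule closure_minimal[OF _ closed_Int[OF cS closed_cball]]) (auto simp: T_def S_def)
    have "cmod (g z0) \<le> M + \<delta>"
    proof (rule maximum_modulus_frontier[of g T])
      have "z \<notin> \<real>\<^sub>\<le>\<^sub>0" if "z \<in> T" for z
      proof -
        have "0 < k * Re z" using that abs_ge_zero[of "Im z"] unfolding T_def by auto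
        then show ?thesis using k by (auto simp: complex_nonpos_Reals_iff zero_less_mult_iff)
      qed
      then show "g holomorphic_on interior T" unfolding g_def interior_open[OF oT]
        by (intro holomorphic_intros holomorphic_on_subset[OF hol]) (auto simp: T_def)
      show "continuous_on (closure T) g" unfolding g_def
        by (intro continuous_intros continuous_on_subset[OF contp] continuous_on_subset[OF cont])
          (use clT in \<open>auto simp: S_def\<close>)
      show "bounded T" by (rule bounded_subset[of "ball 0 R"]) (auto simp: T_def)
      show "z0 \<in> T" using z0 False R by (auto simp: T_def)
      fix z assume z: "z \<in> frontier T"
      then have zS: "z \<in> S" "cmod z \<le> R" "z \<notin> T"
        using clT by (auto simp: frontier_def interior_open[OF oT])
      have e1: "exp (- \<delta> * c * cmod z powr \<gamma>) \<le> 1" using \<delta> c by simp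
      show "cmod (g z) \<le> M + \<delta>"
      proof (cases "\<bar>Im z\<bar> = k * Re z")
        case True
        have "cmod (g z) \<le> cmod (f z) * 1"
          by (rule order_trans[OF gn[OF zS(1)]]) (use e1 in \<open>intro mult_left_mono, auto\<close>)
        then show ?thesis using bound[OF True] \<delta> by simp
      next
        case False
        then have zR: "cmod z = R" using zS by (auto simp: T_def S_def)
        have "cmod (g z) \<le> C * exp (K * cmod z) * exp (- \<delta> * c * cmod z powr \<gamma>)"
          by (rule order_trans[OF gn[OF zS(1)]]) (use growth[of z] zS in \<open>intro mult_right_mono, auto simp: S_def\<close>)
        also have "\<dots> = C * exp (K * R - \<delta> * c * R powr \<gamma>)"
          using zR by (simp add: exp_add[symmetric] mult.assoc exp_diff exp_minus divide_inverse)
        also have "\<dots> < \<delta>" by (rule R)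
        finally show ?thesis using M0 by simp
      qed
    qed
    then show ?thesis by (simp add: g_def)
  qed
  have "((\<lambda>\<delta>. cmod (f z0 * exp (- of_real \<delta> * z0 powr of_real \<gamma>))) \<longlongrightarrow> cmod (f z0 * exp (- of_real 0 * z0 powr of_real \<gamma>))) (at_right (0::real))"
    by (intro tendsto_intros)
  moreover have "((\<lambda>\<delta>. M + \<delta>) \<longlongrightarrow> M + 0) (at_right (0::real))" by (intro tendsto_intros)
  ultimately show ?thesis
    using tendsto_le[of "at_right (0::real)" "\<lambda>\<delta>. M + \<delta>" "M+0" "\<lambda>\<delta>. cmod (f z0 * exp (- of_real \<delta> * z0 powr of_real \<gamma>))"] main
    by (auto simp: eventually_at_right_less eventually_at_filter)
qed

text \<open>Multiplying \<open>f\<close> by an exponential turns the two-ray bound on a quadrant into boundedness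
  on the rotated sector.\<close>

lemma quadrant_bound:
  fixes f :: "complex \<Rightarrow> complex"
  assumes hol: "f holomorphic_on {z. 0 < Re z}"
    and cont: "continuous_on {z. 0 \<le> Re z} f"
    and growth: "\<And>z. 0 \<le> Re z \<Longrightarrow> cmod (f z) \<le> K * exp (L * cmod z)"
    and decay: "\<And>y. 0 \<le> y \<Longrightarrow> cmod (f (Complex 0 y)) \<le> K * exp (- \<epsilon> * y)"
    and z: "0 \<le> Re z" "0 \<le> Im z"
  shows "cmod (f z) \<le> K * exp (L * Re z - \<epsilon> * Im z)"
proof -
  \<comment> \<open>Multiplication by \<open>1 + i\<close> rotates the sector
    \<open>\<bar>Im w\<bar> \<le> Re w\<close> onto the first quadrant. The exponential in
    \<open>g\<close> has modulus \<open>exp (\<epsilon> * Im z - L * Re z)\<close> at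
    \<open>z = \<omega> * w\<close>, which cancels the given bound exactly on each of the two
    edges.\<close>
  define \<omega> where "\<omega> = Complex 1 1"
  define g where "g w = f (\<omega> * w) * exp (Complex (- L) (- \<epsilon>) * (\<omega> * w))" for w
  have K0: "0 \<le> K" using growth[of 0] norm_ge_zero[of "f 0"] by (simp del: norm_ge_zero)
  have re: "Re (\<omega> * w) = Re w - Im w" "Im (\<omega> * w) = Re w + Im w" for w
    by (auto simp: \<omega>_def)
  have nomega: "cmod \<omega> = sqrt 2" by (simp add: \<omega>_def cmod_def)
  have ng: "cmod (g w) = cmod (f (\<omega> * w)) * exp (\<epsilon> * Im (\<omega>*w) - L * Re (\<omega> * w))" for w
    by (simp add: g_def norm_mult)
  have B: "cmod (g w) \<le> K" if "\<bar>Im w\<bar> \<le> 1 * Re w" for w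
  proof (rule phragmen_lindelof_sector[where f = g and k = 1 and C = K and K = "(\<bar>L\<bar> + \<bar>\<epsilon>\<bar> + \<bar>L\<bar>) * sqrt 2"])
    show "(0::real) < 1" by simp
    have "(\<lambda>w. f (\<omega> * w)) holomorphic_on {w. \<bar>Im w\<bar> < 1 * Re w}"
      by (rule holomorphic_on_compose_gen[OF _ hol, unfolded o_def]) (auto intro!: holomorphic_intros simp: re simp del: times_complex.simps)
    then show "g holomorphic_on {w. \<bar>Im w\<bar> < 1 * Re w}"
      unfolding g_def by (intro holomorphic_intros)
    have "continuous_on {w. \<bar>Im w\<bar> \<le> 1 * Re w} (\<lambda>w. f (\<omega> * w))"
      by (rule continuous_on_compose2[OF cont])
        (auto intro!: continuous_intros simp: re simp del: times_complex.simps)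
    then show "continuous_on {w. \<bar>Im w\<bar> \<le> 1 * Re w} g"
      unfolding g_def by (intro continuous_intros)
    show "\<bar>Im w\<bar> \<le> 1 * Re w" by fact
  next
    fix w assume w: "\<bar>Im w\<bar> \<le> 1 * Re w"
    have n: "cmod (\<omega> * w) = sqrt 2 * cmod w" by (simp add: norm_mult nomega)
    have "L * cmod (\<omega>*w) + (\<epsilon> * Im (\<omega>*w) - L * Re (\<omega> * w)) \<le> (\<bar>L\<bar> + \<bar>\<epsilon>\<bar> + \<bar>L\<bar>) * cmod (\<omega>*w)"
    proof -
      have "\<epsilon> * Im (\<omega>*w) \<le> \<bar>\<epsilon>\<bar> * cmod (\<omega>*w)"
        by (rule mult_le_abs_mult[OF abs_Im_le_cmod])
      moreover have "- (L * Re (\<omega>*w)) \<le> \<bar>L\<bar> * cmod (\<omega>*w)"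
        using mult_le_abs_mult[OF abs_Re_le_cmod, of "- L"] by (simp del: times_complex.simps)
      moreover have "L * cmod (\<omega>*w) \<le> \<bar>L\<bar> * cmod (\<omega>*w)" by (intro mult_right_mono) auto
      ultimately show ?thesis by (simp add: algebra_simps)
    qed
    then have e: "exp (L * cmod (\<omega>*w) + (\<epsilon> * Im (\<omega>*w) - L * Re (\<omega> * w))) \<le> exp ((\<bar>L\<bar> + \<bar>\<epsilon>\<bar> + \<bar>L\<bar>) * sqrt 2 * cmod w)"
      unfolding n by (simp only: mult.assoc exp_le_cancel_iff)
    have "cmod (g w) \<le> K * exp (L * cmod (\<omega>*w)) * exp (\<epsilon> * Im (\<omega>*w) - L * Re (\<omega> * w))"
      unfolding ng by (intro mult_right_mono growth) (use w in \<open>auto simp: re simp del: times_complex.simps\<close>)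
    also have "\<dots> = K * exp (L * cmod (\<omega>*w) + (\<epsilon> * Im (\<omega>*w) - L * Re (\<omega> * w)))"
      by (simp only: exp_add mult.assoc)
    also have "\<dots> \<le> K * exp ((\<bar>L\<bar> + \<bar>\<epsilon>\<bar> + \<bar>L\<bar>) * sqrt 2 * cmod w)"
      by (rule mult_left_mono[OF e K0])
    finally show "cmod (g w) \<le> K * exp ((\<bar>L\<bar> + \<bar>\<epsilon>\<bar> + \<bar>L\<bar>) * sqrt 2 * cmod w)" .
  next
    fix w assume w: "\<bar>Im w\<bar> = 1 * Re w"
    show "cmod (g w) \<le> K"
    proof (cases "Im w \<ge> 0")
      case True
      then have *: "\<omega> * w = Complex 0 (Im (\<omega> * w))" "0 \<le> Im (\<omega> * w)"
        using w by (auto simp: re complex_eq_iff simp del: times_complex.simps)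
      have "cmod (f (\<omega> * w)) \<le> K * exp (- \<epsilon> * Im (\<omega> * w))"
        using decay[OF *(2)] by (subst *(1))
      then have "cmod (g w) \<le> K * exp (- \<epsilon> * Im (\<omega> * w)) * exp (\<epsilon> * Im (\<omega>*w) - L * Re (\<omega> * w))"
        unfolding ng by (intro mult_right_mono) auto
      also have "\<dots> = K" using w True by (simp add: re mult.assoc exp_add[symmetric] del: times_complex.simps)
      finally show ?thesis .
    next
      case False
      then have *: "\<omega> * w = of_real (Re (\<omega> * w))" "0 \<le> Re (\<omega> * w)"
        using w by (auto simp: re complex_eq_iff simp del: times_complex.simps)
      have "cmod (\<omega> * w) = Re (\<omega> * w)" using *(2) by (subst *(1)) (simp del: times_complex.simps)
      then have "cmod (f (\<omega> * w)) \<le> K * exp (L * Re (\<omega> * w))"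
        using growth[OF *(2)] by simp
      then have "cmod (g w) \<le> K * exp (L * Re (\<omega> * w)) * exp (\<epsilon> * Im (\<omega>*w) - L * Re (\<omega> * w))"
        unfolding ng by (intro mult_right_mono) auto
      also have "\<dots> = K" using w False by (simp add: re mult.assoc exp_add[symmetric] del: times_complex.simps)
      finally show ?thesis .
    qed
  qed
  define w where "w = z / \<omega>"
  have "\<omega> \<noteq> 0" by (auto simp: \<omega>_def complex_eq_iff)
  then have zw: "\<omega> * w = z" by (simp add: w_def)
  have "\<bar>Im w\<bar> \<le> 1 * Re w" using z re[of w] unfolding zw by auto
  from B[OF this] have "cmod (f z) * exp (\<epsilon> * Im z - L * Re z) \<le> K" unfolding ng zw .
  then have "cmod (f z) * exp (\<epsilon> * Im z - L * Re z) * exp (L * Re z - \<epsilon> * Im z) \<le> K * exp (L * Re z - \<epsilon> * Im z)"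
    by (intro mult_right_mono) auto
  then show ?thesis by (simp add: mult.assoc exp_add[symmetric])
qed

text \<open>A variant of Carlson's theorem: for every \<open>N\<close>, the function \<open>f z * exp (N * z)\<close> is bounded by \<open>K\<close> on
  the sector \<open>\<bar>Im z\<bar> \<le> (N + L) / \<epsilon> * Re z\<close>.\<close>

lemma half_plane_exponential_type_eq_0:
  fixes f :: "complex \<Rightarrow> complex"
  assumes hol: "f holomorphic_on {z. 0 < Re z}"
    and cont: "continuous_on {z. 0 \<le> Re z} f"
    and growth: "\<And>z. 0 \<le> Re z \<Longrightarrow> cmod (f z) \<le> K * exp (L * cmod z)"
    and decay: "\<And>y. cmod (f (Complex 0 y)) \<le> K * exp (- \<epsilon> * \<bar>y\<bar>)"
    and "0 < \<epsilon>" and x: "0 < x"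
  shows "f (of_real x) = 0"
proof -
  have K0: "0 \<le> K" using growth[of 0] norm_ge_zero[of "f 0"] by (simp del: norm_ge_zero)
  have quad: "cmod (f z) \<le> K * exp (L * Re z - \<epsilon> * \<bar>Im z\<bar>)" if z: "0 \<le> Re z" for z
  proof (cases "0 \<le> Im z")
    case True
    then show ?thesis
      using quadrant_bound[OF hol cont growth _ z True, of \<epsilon>] decay
      by (metis abs_of_nonneg)
  next
    case False
    \<comment> \<open>The lower quadrant is reduced to the upper one by the reflection
      \<open>cnj\<close>, which preserves holomorphy when applied on both sides.\<close>
    define g where "g = cnj \<circ> f \<circ> cnj"
    have [simp]: "cnj ` {z. 0 < Re z} = {z. 0 < Re z}"
      by (auto simp: image_iff intro!: exI[of _ "cnj _"])
    have "cmod (g (cnj z)) \<le> K * exp (L * Re (cnj z) - \<epsilon> * Im (cnj z))"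
    proof (rule quadrant_bound)
      show "g holomorphic_on {z. 0 < Re z}" unfolding g_def
        by (rule holomorphic_on_compose_cnj_cnj) (auto intro!: hol open_halfspace_Re_gt)
      show "continuous_on {z. 0 \<le> Re z} g" unfolding g_def o_def
        by (intro continuous_intros continuous_on_compose2[OF cont]) auto
      show "cmod (g z) \<le> K * exp (L * cmod z)" if "0 \<le> Re z" for z
        using growth[of "cnj z"] that by (simp add: g_def)
      show "cmod (g (Complex 0 y)) \<le> K * exp (- \<epsilon> * y)" if "0 \<le> y" for y
        using decay[of "-y"] that by (simp add: g_def complex_cnj)
    qed (use z False in auto)
    then show ?thesis using False by (simp add: g_def)
  qed
  have le: "cmod (f (of_real x)) \<le> K * exp (- N * x)" if N: "0 < N + L" for N
  proof -
    \<comment> \<open>With this slope the exponent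
      \<open>L * Re z - \<epsilon> * \<bar>Im z\<bar> + N * Re z\<close> is 0 on both edges.\<close>
    define k where "k = (N + L) / \<epsilon>"
    define g where "g z = f z * exp (of_real N * z)" for z
    have k: "0 < k" using N \<open>0 < \<epsilon>\<close> by (simp add: k_def)
    have sec: "0 \<le> Re z" if "\<bar>Im z\<bar> \<le> k * Re z" for z
      using that k by (metis abs_ge_zero order_trans zero_le_mult_iff not_le)
    have "cmod (g (of_real x)) \<le> K"
    proof (rule phragmen_lindelof_sector[where f = g and k = k and C = K and K = "L + \<bar>N\<bar>"])
      show "g holomorphic_on {z. \<bar>Im z\<bar> < k * Re z}" unfolding g_def
      proof (intro holomorphic_intros holomorphic_on_subset[OF hol], safe)
        fix z assume "\<bar>Im z\<bar> < k * Re z"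
        then have "0 < k * Re z" by linarith
        then show "0 < Re z" using k by (simp add: zero_less_mult_iff)
      qed
      show "continuous_on {z. \<bar>Im z\<bar> \<le> k * Re z} g" unfolding g_def
        by (intro continuous_intros continuous_on_subset[OF cont]) (auto intro: sec)
    next
      fix z assume z: "\<bar>Im z\<bar> \<le> k * Re z"
      have "N * Re z \<le> \<bar>N\<bar> * cmod z"
        by (rule mult_le_abs_mult[OF abs_Re_le_cmod])
      then have "exp (N * Re z) \<le> exp (\<bar>N\<bar> * cmod z)" by simp
      then have "cmod (g z) \<le> K * exp (L * cmod z) * exp (\<bar>N\<bar> * cmod z)"
        unfolding g_def norm_mult using K0
        by (intro mult_mono growth) (auto simp: sec[OF z])
      then show "cmod (g z) \<le> K * exp ((L + \<bar>N\<bar>) * cmod z)"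
        by (simp add: exp_add distrib_right mult.assoc)
    next
      fix z assume z: "\<bar>Im z\<bar> = k * Re z"
      have "cmod (g z) \<le> K * exp (L * Re z - \<epsilon> * \<bar>Im z\<bar>) * exp (N * Re z)"
        unfolding g_def norm_mult using quad[of z] sec[of z] z by (simp add: mult_right_mono)
      also have "\<dots> = K" unfolding mult.assoc exp_add[symmetric] z
        using \<open>0 < \<epsilon>\<close> by (simp add: k_def field_simps)
      finally show "cmod (g z) \<le> K" .
    qed (use k x in auto)
    then have "cmod (f (of_real x)) * exp (N * x) * exp (- N * x) \<le> K * exp (- N * x)"
      by (intro mult_right_mono) (auto simp: g_def norm_mult)
    then show ?thesis by (simp add: mult.assoc exp_add[symmetric])
  qed
  have "((\<lambda>N. K * exp (- N * x)) \<longlongrightarrow> 0) at_top"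
  proof -
    have "filterlim (\<lambda>N. N * x) at_top at_top"
      using x by (simp add: filterlim_at_top_mult_tendsto_pos[OF tendsto_const _ filterlim_ident])
    then have "filterlim (\<lambda>N. - (N * x)) at_bot at_top"
      by (simp add: filterlim_uminus_at_bot)
    then have "((\<lambda>N. exp (- N * x)) \<longlongrightarrow> 0) at_top"
      by (simp add: filterlim_compose[OF exp_at_bot])
    then show ?thesis by (rule tendsto_mult_right_zero)
  qed
  moreover have "eventually (\<lambda>N. cmod (f (of_real x)) \<le> K * exp (- N * x)) at_top"
    using eventually_gt_at_top[of "- L"] by eventually_elim (rule le, simp)
  ultimately have "cmod (f (of_real x)) \<le> 0" by (rule tendsto_lowerbound) simp
  then show ?thesis by simp
qed

section \<open>Uniqueness for the Laplace transform\<close>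

lemma integral_upper_has_real_derivative:
  fixes h :: "real \<Rightarrow> real"
  assumes "continuous_on {0..} h" "0 < x"
  shows "((\<lambda>X. integral {0..X} h) has_real_derivative h x) (at x)"
proof -
  have c: "continuous_on {0..x+1} h" by (rule continuous_on_subset[OF assms(1)]) auto
  have "((\<lambda>X. integral {0..X} h) has_real_derivative h x) (at x within {0..x+1})"
    by (rule integral_has_real_derivative[OF c]) (use assms in auto)
  then show ?thesis using assms(2) by (simp add: at_within_Icc_at)
qed

text \<open>By Weierstrass, \<open>g\<close> is a uniform limit of polynomials, and it is orthogonal
  to all of them; hence the integral of its square is smaller than every positive number.\<close>

lemma moments_zero_imp_zero:
  fixes g :: "real \<Rightarrow> real"
  assumes g: "continuous_on {0..1} g"
    and mom: "\<And>n. ((\<lambda>s. g s * s ^ n) has_integral 0) {0..1}"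
    and s: "s \<in> {0..1}"
  shows "g s = 0"
proof -
  have "bounded (g ` {0..1})" by (intro compact_imp_bounded compact_continuous_image g compact_Icc)
  then obtain B where B: "\<And>s. s \<in> {0..1} \<Longrightarrow> \<bar>g s\<bar> \<le> B" "0 < B"
    by (force simp: bounded_pos)
  have le: "integral {0..1} (\<lambda>s. g s * g s) \<le> e" if e: "0 < e" for e
  proof -
    obtain p where p: "real_polynomial_function p" "\<And>x. x \<in> {0..1} \<Longrightarrow> \<bar>g x - p x\<bar> < e / B"
      using Stone_Weierstrass_real_polynomial_function[OF compact_Icc g divide_pos_pos[OF e B(2)]] by blast
    obtain a n where pa: "p = (\<lambda>x. \<Sum>i\<le>n. a i * x ^ i)"
      using p(1) by (auto simp: real_polynomial_function_iff_sum)
    have "((\<lambda>s. \<Sum>i\<le>n. a i * (g s * s ^ i)) has_integral (\<Sum>i\<le>n. a i * 0)) {0..1}"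
      by (intro has_integral_sum has_integral_mult_right mom) auto
    then have p0: "((\<lambda>s. g s * p s) has_integral 0) {0..1}"
      by (simp add: pa sum_distrib_left mult_ac)
    have ig: "(\<lambda>s. g s * g s) integrable_on {0..1}"
      by (intro integrable_continuous_interval continuous_intros g)
    have "((\<lambda>s. g s * g s - g s * p s) has_integral integral {0..1} (\<lambda>s. g s * g s) - 0) {0..1}"
      by (intro has_integral_diff p0 integrable_integral ig)
    moreover have "((\<lambda>s. e) has_integral (1 - 0) *\<^sub>R e) {0..1::real}"
      using has_integral_const_real[of e 0 1] by simp
    ultimately have "integral {0..1} (\<lambda>s. g s * g s) - 0 \<le> (1 - 0) *\<^sub>R e"
    proof (rule has_integral_le)
      fix s :: real assume s: "s \<in> {0..1}"
      have "g s * g s - g s * p s \<le> \<bar>g s\<bar> * \<bar>g s - p s\<bar>"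
        by (simp add: abs_mult[symmetric] right_diff_distrib[symmetric])
      also have "\<dots> \<le> B * (e / B)"
        using B p(2)[OF s] s by (intro mult_mono) auto
      finally show "g s * g s - g s * p s \<le> e" using B by simp
    qed
    then show ?thesis by simp
  qed
  have "integral {0..1} (\<lambda>s. g s * g s) \<le> 0" by (rule field_le_epsilon) (use le in simp)
  moreover have "0 \<le> integral {0..1} (\<lambda>s. g s * g s)"
    by (rule integral_nonneg) (intro integrable_continuous_interval continuous_on_mult g, simp)
  ultimately have "integral {0..1} (\<lambda>s. g s * g s) = 0" by simp
  then have "\<forall>s\<in>{0..1}. g s * g s = 0"
    using integral_eq_0_iff[OF continuous_on_mult[OF g g]] by simp
  then show ?thesis using s by simp
qed

text \<open>Lerch's theorem. The substitution \<open>s = exp (- x)\<close> turns the hypothesis into vanishing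
  moments of the primitive of \<open>f x * exp (- x)\<close>, a continuous function on \<open>[0, 1]\<close>.\<close>

lemma Laplace_zero_imp_zero:
  fixes f :: "real \<Rightarrow> real"
  assumes f: "continuous_on {0..} f"
    and lim: "\<And>r. 0 < r \<Longrightarrow> ((\<lambda>X. integral {0..X} (\<lambda>x. f x * exp (- r * x))) \<longlongrightarrow> 0) at_top"
    and x: "0 \<le> x"
  shows "f x = 0"
proof -
  define I where "I r X = integral {0..X} (\<lambda>x. f x * exp (- r * x))" for r X
  have cont: "continuous_on {0..} (\<lambda>x. f x * exp (- r * x))" for r
    by (intro continuous_intros f)
  have I': "((\<lambda>X. I r X) has_real_derivative f x * exp (- r * x)) (at x)" if "0 < x" for r x
    unfolding I_def by (rule integral_upper_has_real_derivative[OF cont that])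
  have I0: "I r 0 = 0" for r by (simp add: I_def)
  have Icont: "continuous_on {0..} (I r)" for r
  proof -
    have "isCont (I r) x" if "0 < x" for x using I'[OF that] by (rule DERIV_isCont)
    moreover have "continuous (at 0 within {0..}) (I r)"
    proof -
      have "continuous_on {0..1} (I r)" unfolding I_def
        by (intro indefinite_integral_continuous_1 integrable_continuous_interval continuous_on_subset[OF cont]) auto
      then have "continuous (at 0 within {0..1}) (I r)" by (simp add: continuous_on_eq_continuous_within)
      moreover have "at 0 within {0..1} = at (0::real) within {0..}"
        by (rule at_within_nhd[of _ "{..<1}"]) auto
      ultimately show ?thesis by simp
    qed
    ultimately have "continuous (at x within {0..}) (I r)" if "0 \<le> x" for x
      using that by (cases "x = 0") (simp_all add: continuous_at_imp_continuous_at_within)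
    then show ?thesis by (simp add: continuous_on_eq_continuous_within)
  qed
  have Ilim: "((\<lambda>s. I r (- ln s)) \<longlongrightarrow> 0) (at_right 0)" if "0 < r" for r
    by (rule filterlim_compose[OF lim[OF that, folded I_def]])
      (use ln_at_0 in \<open>simp add: filterlim_uminus_at_bot[symmetric] filterlim_uminus_at_top\<close>)
  define g where "g s = (if s = 0 then 0 else I 1 (- ln s))" for s
  have cont0: "continuous_on {0..1} h"
    if h0: "(h \<longlongrightarrow> h 0) (at_right 0)" and hc: "continuous_on {0<..1} h" for h :: "real \<Rightarrow> real"
  proof -
    have "continuous (at s within {0..1}) h" if "s \<in> {0..1}" for s
    proof (cases "s = 0")
      case True
      have "at 0 within {0..1} = at_right (0::real)"
        by (simp add: at_within_Icc_at_right)
      then show ?thesis using h0 True by (simp add: continuous_within)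
    next
      case False
      then have "continuous (at s within {0<..1}) h"
        using hc that by (simp add: continuous_on_eq_continuous_within)
      moreover have "at s within {0..1} = at s within {0<..1}"
        by (rule at_within_nhd[of _ "{0<..}"]) (use False that in auto)
      ultimately show ?thesis by simp
    qed
    then show ?thesis by (simp add: continuous_on_eq_continuous_within)
  qed
  have contI: "continuous_on {0<..1} (\<lambda>s. I r (- ln s))" for r
    by (rule continuous_on_compose2[OF Icont], intro continuous_intros) auto
  have g: "continuous_on {0..1} g"
  proof (rule cont0)
    show "(g \<longlongrightarrow> g 0) (at_right 0)"
      using Lim_transform_eventually[OF Ilim[of 1], of g] by (simp add: g_def eventually_at_filter)
    show "continuous_on {0<..1} g"
      using contI[of 1] by (simp add: g_def cong: continuous_on_cong_simp)
  qed
  have "((\<lambda>s. g s * s ^ n) has_integral 0) {0..1}" for n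
  proof -
    \<comment> \<open>An antiderivative found by parts: with \<open>s = exp (- x)\<close>, both
      \<open>I 1 (- ln s) * s ^ (n+1)\<close> and \<open>I (n+2) (- ln s)\<close> produce the term
      \<open>- f (- ln s) * s ^ (n+1)\<close>, which cancels. At \<open>s = 1\<close> it vanishes
      because the integrals are empty, and at \<open>s = 0\<close> it has limit 0 because the
      transforms at 1 and \<open>n + 2\<close> are zero.\<close>
    define Q where "Q s = (if s = 0 then 0 else (I 1 (- ln s) * s ^ (n+1) - I (n+2) (- ln s)) / (n+1))" for s
    have "((\<lambda>s. g s * s ^ n) has_integral Q 1 - Q 0) {0..1}"
    proof (rule fundamental_theorem_of_calculus_interior)
      show "continuous_on {0..1} Q"
      proof (rule cont0)
        have "((\<lambda>s. (I 1 (- ln s) * s ^ (n+1) - I (n+2) (- ln s)) / (n+1)) \<longlongrightarrow> (0 * 0 ^ (n+1) - 0) / (n+1)) (at_right 0)"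
          by (intro tendsto_intros Ilim) auto
        then have "((\<lambda>s. (I 1 (- ln s) * s ^ (n+1) - I (n+2) (- ln s)) / (n+1)) \<longlongrightarrow> Q 0) (at_right 0)"
          by (simp add: Q_def)
        then show "(Q \<longlongrightarrow> Q 0) (at_right 0)"
          by (rule Lim_transform_eventually) (auto simp: Q_def eventually_at_filter)
        have "continuous_on {0<..1} (\<lambda>s. (I 1 (- ln s) * s ^ (n+1) - I (n+2) (- ln s)) / (n+1))"
          by (intro continuous_intros contI) auto
        then show "continuous_on {0<..1} Q"
          by (simp add: Q_def cong: continuous_on_cong_simp)
      qed
      fix s :: real assume s: "s \<in> {0<..<1}"
      then have "0 < - ln s" by simp
      have dI: "((\<lambda>s. I r (- ln s)) has_real_derivative (f (- ln s) * exp (r * ln s)) * (- (1/s))) (at s)" for r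
      proof -
        have "((\<lambda>s. - ln s) has_real_derivative - (1/s)) (at s)"
          using s by (auto intro!: derivative_eq_intros)
        from DERIV_chain2[OF I'[OF \<open>0 < - ln s\<close>, of r] this] show ?thesis by simp
      qed
      have e: "exp ((real n+2) * ln s) = s ^ (n+2)"
        using s exp_of_nat_mult[of "n+2" "ln s"] by (simp add: add.commute)
      have "((\<lambda>s. (I 1 (- ln s) * s ^ (n+1) - I (n+2) (- ln s)) / (n+1)) has_real_derivative g s * s ^ n) (at s)"
      proof -
        have "((\<lambda>s. (I 1 (- ln s) * s ^ (n+1) - I (n+2) (- ln s)) / (n+1)) has_real_derivative
            (f (- ln s) * exp (1 * ln s) * (- (1/s)) * s ^ (n+1) + (real n + 1) * s ^ n * I 1 (- ln s)
              - f (- ln s) * exp ((real n + 2) * ln s) * (- (1/s))) / (n+1)) (at s)"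
        proof -
          have "((\<lambda>s. s ^ (n+1)) has_real_derivative (real n + 1) * s ^ n) (at s)"
            using DERIV_pow[of "n + 1"] by (simp add: add.commute)
          from DERIV_cdivide[OF DERIV_diff[OF DERIV_mult[OF dI[of 1] this] dI[of "real n + 2"]], of "real n + 1"]
          show ?thesis by (simp add: add.commute)
        qed
        also have "(f (- ln s) * exp (1 * ln s) * (- (1/s)) * s ^ (n+1) + (real n + 1) * s ^ n * I 1 (- ln s)
              - f (- ln s) * exp ((real n + 2) * ln s) * (- (1/s))) / (n+1) = g s * s ^ n"
          unfolding e using s by (simp add: g_def field_simps)
        finally show ?thesis .
      qed
      then show "(Q has_vector_derivative g s * s ^ n) (at s)"
        unfolding has_real_derivative_iff_has_vector_derivative[symmetric]
        by (rule has_field_derivative_transform_within_open[of _ _ _ "{0<..<1}"]) (use s in \<open>auto simp: Q_def\<close>)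
    qed simp
    then show ?thesis by (simp add: Q_def I0)
  qed
  then have g0: "g s = 0" if "s \<in> {0..1}" for s
    using moments_zero_imp_zero[OF g] that by blast
  have f0: "f x = 0" if "0 < x" for x
  proof -
    have I1: "I 1 y = 0" if "0 < y" for y
      using g0[of "exp (- y)"] that by (simp add: g_def)
    have "((\<lambda>x. I 1 x) has_real_derivative 0) (at x)"
      by (rule has_field_derivative_transform_within_open[where f = "\<lambda>_. 0" and S = "{0<..}"])
        (simp_all add: I1 that)
    from DERIV_unique[OF this I'[OF that]] show ?thesis by simp
  qed
  show "f x = 0"
  proof (cases "x = 0")
    case True
    have "(f \<longlongrightarrow> f 0) (at 0 within {0..})" using f by (simp add: continuous_on)
    then have "(f \<longlongrightarrow> f 0) (at_right 0)" by (rule tendsto_within_subset) auto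
    moreover have "(f \<longlongrightarrow> 0) (at_right 0)"
      by (rule Lim_transform_eventually[OF tendsto_const]) (auto simp: f0 eventually_at_filter)
    ultimately show ?thesis using True tendsto_unique[of "at_right (0::real)"] by auto
  qed (use f0 x in auto)
qed

section \<open>Laplace transforms of solutions\<close>

lemma integral_exp_decay_le:
  fixes a X Y :: real
  assumes "0 < a" "X \<le> Y"
  shows "(\<lambda>x. exp (- a * x)) integrable_on {X..Y}" "integral {X..Y} (\<lambda>x. exp (- a * x)) \<le> exp (- a * X) / a"
proof -
  have "((\<lambda>x. exp (- a * x)) has_integral - exp (- a * Y) / a - (- exp (- a * X) / a)) {X..Y}"
    by (rule fundamental_theorem_of_calculus)
      (use assms in \<open>auto intro!: derivative_eq_intros simp: has_real_derivative_iff_has_vector_derivative[symmetric]\<close>)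
  then show "(\<lambda>x. exp (- a * x)) integrable_on {X..Y}" "integral {X..Y} (\<lambda>x. exp (- a * x)) \<le> exp (- a * X) / a"
    using assms by (auto simp: integral_unique has_integral_integrable)
qed

text \<open>Positive \<open>X\<close> gives the tails that make the transform converge;
  \<open>X = 0\<close> bounds the truncated transforms uniformly in \<open>Y\<close>.\<close>

lemma norm_Laplace_integral_le:
  fixes f :: "real \<Rightarrow> complex"
  assumes f: "continuous_on {0..} f" and bound: "\<And>x. 0 \<le> x \<Longrightarrow> cmod (f x) \<le> K * exp (\<sigma> * x)"
    and z: "\<sigma> < Re z" and XY: "0 \<le> X" "X \<le> Y"
  shows "cmod (integral {X..Y} (\<lambda>x. f x * exp (- z * of_real x))) \<le> K * exp (- (Re z - \<sigma>) * X) / (Re z - \<sigma>)"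
proof -
  have K0: "0 \<le> K" using bound[of 0] norm_ge_zero[of "f 0"] by (simp del: norm_ge_zero)
  have "cmod (integral {X..Y} (\<lambda>x. f x * exp (- z * of_real x))) \<le> integral {X..Y} (\<lambda>x. K * exp (- (Re z - \<sigma>) * x))"
  proof (rule integral_norm_bound_integral)
    show "(\<lambda>x. f x * exp (- z * of_real x)) integrable_on {X..Y}"
      by (intro integrable_continuous_interval continuous_intros continuous_on_subset[OF f]) (use XY in auto)
    show "(\<lambda>x. K * exp (- (Re z - \<sigma>) * x)) integrable_on {X..Y}"
      by (intro integrable_on_mult_right integral_exp_decay_le) (use z XY in auto)
    fix x assume "x \<in> {X..Y}"
    then have "cmod (f x) * exp (- Re z * x) \<le> K * exp (\<sigma> * x) * exp (- Re z * x)"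
      using XY by (intro mult_right_mono bound) auto
    then show "cmod (f x * exp (- z * of_real x)) \<le> K * exp (- (Re z - \<sigma>) * x)"
      by (simp add: norm_mult mult.assoc exp_add[symmetric] algebra_simps)
  qed
  also have "\<dots> \<le> K * (exp (- (Re z - \<sigma>) * X) / (Re z - \<sigma>))"
    unfolding integral_mult_right using K0 z XY by (intro mult_left_mono integral_exp_decay_le) auto
  finally show ?thesis by simp
qed

text \<open>Growth below every exponential makes the truncated transforms, which are holomorphic,
  converge locally uniformly in the open right half-plane.\<close>

lemma Laplace_transform_exists:
  fixes f :: "real \<Rightarrow> complex"
  assumes f: "continuous_on {0..} f"
    and bound: "\<And>\<sigma>. 0 < \<sigma> \<Longrightarrow> \<exists>K. \<forall>x\<ge>0. cmod (f x) \<le> K * exp (\<sigma> * x)"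
  obtains F where "F holomorphic_on {z. 0 < Re z}"
    "\<And>z. 0 < Re z \<Longrightarrow> ((\<lambda>X. integral {0..X} (\<lambda>x. f x * exp (- z * of_real x))) \<longlongrightarrow> F z) at_top"
proof -
  define W where "W X z = integral {0..X} (\<lambda>x. f x * exp (- z * of_real x))" for X :: real and z :: complex
  \<comment> \<open>The limit is first taken along the integers, to which the theorem on uniform
    limits of holomorphic sequences applies; the limit over real \<open>X\<close> follows from the
    tail estimate.\<close>
  define F where "F z = lim (\<lambda>n. W (real n) z)" for z
  have tail: "cmod (W Y z - W X z) \<le> K * exp (- (Re z - \<sigma>) * X) / (Re z - \<sigma>)"
    if K: "\<And>x. 0 \<le> x \<Longrightarrow> cmod (f x) \<le> K * exp (\<sigma> * x)" and z: "\<sigma> < Re z" and XY: "0 \<le> X" "X \<le> Y" for K \<sigma> z X Y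
  proof -
    have int: "(\<lambda>x. f x * exp (- z * of_real x)) integrable_on {0..Y}"
      by (intro integrable_continuous_interval continuous_intros continuous_on_subset[OF f]) auto
    have "W X z + integral {X..Y} (\<lambda>x. f x * exp (- z * of_real x)) = W Y z"
      unfolding W_def by (rule Henstock_Kurzweil_Integration.integral_combine[OF XY int])
    then have "W Y z - W X z = integral {X..Y} (\<lambda>x. f x * exp (- z * of_real x))" by (simp add: algebra_simps)
    then show ?thesis using norm_Laplace_integral_le[OF f K z XY] by simp
  qed
  have decay: "((\<lambda>X. K * exp (- b * X) / b) \<longlongrightarrow> 0) at_top" if "0 < b" for K b :: real
  proof -
    have "filterlim (\<lambda>X. b * X) at_top at_top"
      using that by (simp add: filterlim_tendsto_pos_mult_at_top[OF tendsto_const _ filterlim_ident])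
    then have "filterlim (\<lambda>X. - (b * X)) at_bot at_top" by (simp add: filterlim_uminus_at_bot)
    then have "((\<lambda>X. exp (- b * X)) \<longlongrightarrow> 0) at_top"
      by (simp add: filterlim_compose[OF exp_at_bot])
    then show ?thesis by (intro tendsto_divide_zero tendsto_mult_right_zero)
  qed
  have seqlim: "(\<lambda>n. W (real n) z) \<longlonglongrightarrow> F z" if z: "0 < Re z" for z
  proof -
    obtain K where K: "\<And>x. 0 \<le> x \<Longrightarrow> cmod (f x) \<le> K * exp (Re z / 2 * x)"
      using bound[of "Re z / 2"] z by auto
    have z2: "Re z / 2 < Re z" using z by simp
    have "Cauchy (\<lambda>n. W (real n) z)"
    proof (rule CauchyI')
      fix e :: real assume e: "0 < e"
      have "eventually (\<lambda>X. K * exp (- (Re z - Re z / 2) * X) / (Re z - Re z / 2) < e) at_top"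
        using order_tendstoD(2)[OF decay, of "Re z - Re z / 2" e K] z e by simp
      then obtain X0 where X0: "\<And>X. X0 \<le> X \<Longrightarrow> K * exp (- (Re z - Re z / 2) * X) / (Re z - Re z / 2) < e"
        by (auto simp: eventually_at_top_linorder)
      show "\<exists>M. \<forall>m\<ge>M. \<forall>n>m. dist (W (real m) z) (W (real n) z) < e"
      proof (intro exI[of _ "nat \<lceil>X0\<rceil>"] allI impI)
        fix m n assume mn: "nat \<lceil>X0\<rceil> \<le> m" "m < n"
        have "X0 \<le> real m" using mn(1) by linarith
        moreover have "cmod (W (real n) z - W (real m) z) \<le> K * exp (- (Re z - Re z / 2) * real m) / (Re z - Re z / 2)"
          by (rule tail[OF K z2]) (use mn in auto)
        ultimately show "dist (W (real m) z) (W (real n) z) < e"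
          using X0[of "real m"] by (simp add: dist_norm norm_minus_commute)
      qed
    qed
    then show ?thesis unfolding F_def by (simp add: Cauchy_convergent_iff convergent_LIMSEQ_iff)
  qed
  have Ftail: "cmod (F z - W X z) \<le> K * exp (- (Re z - \<sigma>) * X) / (Re z - \<sigma>)"
    if K: "\<And>x. 0 \<le> x \<Longrightarrow> cmod (f x) \<le> K * exp (\<sigma> * x)" and z: "\<sigma> < Re z" "0 < Re z" and X: "0 \<le> X" for K \<sigma> z X
  proof (rule tendsto_upperbound)
    show "(\<lambda>n. cmod (W (real n) z - W X z)) \<longlonglongrightarrow> cmod (F z - W X z)"
      by (intro tendsto_norm tendsto_diff seqlim[OF z(2)] tendsto_const)
    show "\<forall>\<^sub>F n in sequentially. cmod (W (real n) z - W X z) \<le> K * exp (- (Re z - \<sigma>) * X) / (Re z - \<sigma>)"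
      using eventually_ge_at_top[of "nat \<lceil>X\<rceil>"]
    proof eventually_elim
      case (elim n)
      then have "X \<le> real n" by linarith
      from tail[OF K z(1) X this] show ?case .
    qed
  qed simp
  have "F holomorphic_on {z. 0 < Re z}"
  proof (rule holomorphic_uniform_sequence[where f = "\<lambda>n. W (real n)"])
    show "open {z. 0 < Re z}" by (rule open_halfspace_Re_gt)
    show "W (real n) holomorphic_on {z. 0 < Re z}" for n
    proof -
      have "(\<lambda>z. integral (cbox 0 (real n)) (\<lambda>x. f x * exp (- z * of_real x))) holomorphic_on {z. 0 < Re z}"
      proof (rule leibniz_rule_holomorphic)
        fix z x
        show "((\<lambda>z. f x * exp (- z * of_real x)) has_field_derivative f x * (exp (- z * of_real x) * - of_real x)) (at z within {z. 0 < Re z})"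
          by (auto intro!: derivative_eq_intros)
      next
        fix z
        show "(\<lambda>x. f x * exp (- z * of_real x)) integrable_on cbox 0 (real n)"
          unfolding cbox_interval
          by (intro integrable_continuous_interval continuous_intros continuous_on_subset[OF f]) auto
      next
        have "continuous_on ({z. 0 < Re z} \<times> cbox 0 (real n)) (\<lambda>p. f (snd p))"
          by (rule continuous_on_compose2[OF f]) (auto intro: continuous_on_snd continuous_on_id)
        then have "continuous_on ({z. 0 < Re z} \<times> cbox 0 (real n)) (\<lambda>p. f (snd p) * (exp (- fst p * of_real (snd p)) * - of_real (snd p)))"
          by (intro continuous_intros)
        then show "continuous_on ({z. 0 < Re z} \<times> cbox 0 (real n)) (\<lambda>(z, x). f x * (exp (- z * of_real x) * - of_real x))"
          by (simp add: case_prod_beta')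
      qed (rule convex_halfspace_Re_gt)
      then show ?thesis by (simp add: W_def[abs_def])
    qed
    fix z assume "z \<in> {z. 0 < Re z}"
    then have z: "0 < Re z" by simp
    \<comment> \<open>On the disc of radius \<open>Re z / 4\<close> real parts exceed
      \<open>2 * d\<close>, so a growth rate \<open>d\<close> of \<open>f\<close> leaves tails
      decaying at least at rate \<open>d\<close>, uniformly on the disc.\<close>
    define d where "d = Re z / 4"
    have d: "0 < d" using z by (simp add: d_def)
    have Rw: "2 * d < Re w" if "w \<in> cball z d" for w
    proof -
      have "\<bar>Re (z - w)\<bar> \<le> d" using that abs_Re_le_cmod[of "z - w"] by (simp add: dist_norm)
      then have "Re z - Re w \<le> d" by simp
      then show ?thesis using z unfolding d_def by linarith
    qed
    obtain K where K: "\<And>x. 0 \<le> x \<Longrightarrow> cmod (f x) \<le> K * exp (d * x)" using bound[OF d] by auto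
    have K0: "0 \<le> K" using K[of 0] norm_ge_zero[of "f 0"] by (simp del: norm_ge_zero)
    have "uniform_limit (cball z d) (\<lambda>n. W (real n)) F sequentially"
    proof (rule uniform_limitI)
      fix e :: real assume e: "0 < e"
      have "eventually (\<lambda>X. K * exp (- d * X) / d < e) at_top"
        by (rule order_tendstoD(2)[OF decay[OF d] e])
      then have "eventually (\<lambda>n. K * exp (- d * real n) / d < e) sequentially"
        by (rule eventually_compose_filterlim[OF _ filterlim_real_sequentially])
      then show "\<forall>\<^sub>F n in sequentially. \<forall>w\<in>cball z d. dist (W (real n) w) (F w) < e"
      proof eventually_elim
        case (elim n)
        show ?case
        proof
          fix w assume w: "w \<in> cball z d"
          have "cmod (F w - W (real n) w) \<le> K * exp (- (Re w - d) * real n) / (Re w - d)"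
            by (rule Ftail[OF K]) (use Rw[OF w] d in auto)
          also have "\<dots> \<le> K * exp (- d * real n) / d"
          proof (rule frac_le)
            show "K * exp (- (Re w - d) * real n) \<le> K * exp (- d * real n)"
              using Rw[OF w] mult_right_mono[of "- (Re w - d)" "- d" "real n"]
              by (intro mult_left_mono K0) simp
          qed (use K0 d Rw[OF w] in auto)
          also have "\<dots> < e" by (rule elim)
          finally show "dist (W (real n) w) (F w) < e" by (simp add: dist_norm norm_minus_commute)
        qed
      qed
    qed
    moreover have "cball z d \<subseteq> {z. 0 < Re z}" using Rw d by force
    ultimately show "\<exists>d. 0 < d \<and> cball z d \<subseteq> {z. 0 < Re z} \<and> uniform_limit (cball z d) (\<lambda>n. W (real n)) F sequentially"
      using d by blast
  qed
  moreover have "((\<lambda>X. W X z) \<longlongrightarrow> F z) at_top" if z: "0 < Re z" for z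
  proof -
    obtain K where K: "\<And>x. 0 \<le> x \<Longrightarrow> cmod (f x) \<le> K * exp (Re z / 2 * x)"
      using bound[of "Re z / 2"] z by auto
    have "((\<lambda>X. W X z - F z) \<longlongrightarrow> 0) at_top"
    proof (rule Lim_null_comparison)
      show "\<forall>\<^sub>F X in at_top. cmod (W X z - F z) \<le> K * exp (- (Re z - Re z / 2) * X) / (Re z - Re z / 2)"
        using eventually_ge_at_top[of 0]
        by eventually_elim (subst norm_minus_commute, rule Ftail[OF K], use z in auto)
      show "((\<lambda>X. K * exp (- (Re z - Re z / 2) * X) / (Re z - Re z / 2)) \<longlongrightarrow> 0) at_top"
        by (rule decay) (use z in simp)
    qed
    then show ?thesis by (rule LIM_zero_cancel)
  qed
  ultimately show thesis using that[of F] by (simp add: W_def)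
qed

text \<open>By \<open>goursat_exp_bound\<close> at rate \<open>\<sigma> = Re z / 2\<close>, data on
  the line \<open>t = 0\<close> alone control \<open>v\<close> on the whole strip up to height
  \<open>T\<close>. The boundary term in \<open>goursat_Laplace_step\<close> is therefore of order
  \<open>X * exp (- \<sigma> * X)\<close> and disappears in the limit.\<close>

lemma goursat_Laplace_limit:
  assumes v: "goursat v"
    and bound: "\<And>\<sigma>. 0 < \<sigma> \<Longrightarrow> \<exists>K. \<forall>x\<ge>0. cmod (v x 0) \<le> K * exp (\<sigma> * x)"
    and z: "0 < Re z" and T: "0 \<le> T"
    and F: "((\<lambda>X. integral {0..X} (\<lambda>x. v x 0 * exp (- z * of_real x))) \<longlongrightarrow> Fz) at_top"
  shows "((\<lambda>X. exp (- of_real T / z) * integral {0..X} (\<lambda>x. v x T * exp (- z * of_real x))) \<longlongrightarrow> Fz) at_top"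
proof -
  define W where "W X t = integral {0..X} (\<lambda>x. v x t * exp (- z * of_real x))" for X t
  define \<sigma> where "\<sigma> = Re z / 2"
  have \<sigma>: "0 < \<sigma>" using z by (simp add: \<sigma>_def)
  have z0: "z \<noteq> 0" using z by auto
  have Re_inv: "0 < Re (1 / z)" using z z0 by (simp add: Re_divide' cmod_power2[symmetric])
  obtain K where K: "\<And>x. 0 \<le> x \<Longrightarrow> cmod (v x 0) \<le> K * exp (\<sigma> * x)" using bound[OF \<sigma>] by auto
  have K0: "0 \<le> K" using K[of 0] norm_ge_zero[of "v 0 0"] by (simp del: norm_ge_zero)
  define B where "B = 2 * K * exp (2 / \<sigma> * T) / cmod z * T"
  have le: "cmod (exp (- of_real T / z) * W X T - W X 0) \<le> B * (X * exp (- \<sigma> * X))" if X: "0 \<le> X" for X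
  proof -
    define P where "P t = integral {0..X} (\<lambda>x. v x t)" for t
    have P: "cmod (P t) \<le> 2 * K * exp (\<sigma> * X + 2 / \<sigma> * T) * X" if t: "t \<in> {0..T}" for t
    proof -
      have "cmod (P t) \<le> integral {0..X} (\<lambda>x. 2 * K * exp (\<sigma> * X + 2 / \<sigma> * T))" unfolding P_def
      proof (rule integral_norm_bound_integral)
        show "(\<lambda>x. v x t) integrable_on {0..X}"
          by (intro integrable_continuous_interval goursat_continuous_x[OF v]) (use t in auto)
        fix x assume x: "x \<in> {0..X}"
        have "cmod (v x t) \<le> 2 * K * exp (\<sigma> * x + 2 / \<sigma> * t)"
          by (rule goursat_exp_bound[OF v \<sigma> K]) (use x t in auto)
        also have "\<dots> \<le> 2 * K * exp (\<sigma> * X + 2 / \<sigma> * T)"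
          using x t \<sigma> K0 by (intro mult_left_mono) (auto intro!: add_mono divide_right_mono)
        finally show "cmod (v x t) \<le> 2 * K * exp (\<sigma> * X + 2 / \<sigma> * T)" .
      qed auto
      then show ?thesis using X by (simp add: mult_ac)
    qed
    have hi: "((\<lambda>t. - exp (- z * of_real X) / z * P t * exp (- of_real t / z)) has_integral
      exp (- of_real T / z) * W X T - W X 0) {0..T}"
      unfolding P_def W_def by (rule goursat_Laplace_step[OF v z0 X T])
    have "cmod (exp (- of_real T / z) * W X T - W X 0)
        \<le> (exp (- Re z * X) / cmod z * (2 * K * exp (\<sigma> * X + 2 / \<sigma> * T) * X)) * measure lborel {0..T}"
    proof (rule has_integral_bound_real[OF _ finite.emptyI hi])
      show "0 \<le> exp (- Re z * X) / cmod z * (2 * K * exp (\<sigma> * X + 2 / \<sigma> * T) * X)"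
        using K0 X by simp
      fix t assume "t \<in> {0..T} - {}"
      then have t: "t \<in> {0..T}" by simp
      have "Re (of_real t / z) = t * Re (1 / z)" by (simp add: Re_divide')
      then have e1: "cmod (exp (- of_real t / z)) \<le> 1" using t Re_inv by simp
      have "cmod (- exp (- z * of_real X) / z * P t * exp (- of_real t / z))
          = exp (- Re z * X) / cmod z * cmod (P t) * cmod (exp (- of_real t / z))"
        by (simp add: norm_mult norm_divide)
      also have "\<dots> \<le> exp (- Re z * X) / cmod z * (2 * K * exp (\<sigma> * X + 2 / \<sigma> * T) * X) * 1"
        using X K0 by (intro mult_mono P t e1 order_refl mult_nonneg_nonneg) auto
      finally show "cmod (- exp (- z * of_real X) / z * P t * exp (- of_real t / z))
        \<le> exp (- Re z * X) / cmod z * (2 * K * exp (\<sigma> * X + 2 / \<sigma> * T) * X)" by simp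
    qed
    also have "\<dots> = B * (X * (exp (- Re z * X) * exp (\<sigma> * X)))" using T
      by (simp add: B_def exp_add field_simps)
    also have "exp (- Re z * X) * exp (\<sigma> * X) = exp (- \<sigma> * X)"
      by (simp add: \<sigma>_def exp_add[symmetric] field_simps)
    finally show ?thesis .
  qed
  have "((\<lambda>X. B * (X * exp (- \<sigma> * X))) \<longlongrightarrow> 0) at_top"
  proof -
    have "filterlim (\<lambda>X. \<sigma> * X) at_top at_top"
      using \<sigma> by (simp add: filterlim_tendsto_pos_mult_at_top[OF tendsto_const _ filterlim_ident])
    then have "((\<lambda>X. (\<sigma> * X) ^ 1 / exp (\<sigma> * X)) \<longlongrightarrow> 0) at_top"
      by (rule filterlim_compose[OF tendsto_power_div_exp_0])
    then have "((\<lambda>X. (B / \<sigma>) * ((\<sigma> * X) ^ 1 / exp (\<sigma> * X))) \<longlongrightarrow> 0) at_top"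
      by (rule tendsto_mult_right_zero)
    moreover have "(B / \<sigma>) * ((\<sigma> * X) ^ 1 / exp (\<sigma> * X)) = B * (X * exp (- \<sigma> * X))" for X
      using \<sigma> by (simp add: exp_minus field_simps)
    ultimately show ?thesis by (simp only:)
  qed
  then have "((\<lambda>X. exp (- of_real T / z) * W X T - W X 0) \<longlongrightarrow> 0) at_top"
    by (rule Lim_null_comparison[rotated]) (rule eventually_mono[OF eventually_ge_at_top[of 0] le])
  from tendsto_add[OF this F[folded W_def]] show ?thesis by (simp add: W_def)
qed

text \<open>Young's inequality with exponents \<open>1 / q\<close> and \<open>1 / (1 - q)\<close>;
  the scaling \<open>s = r / q\<close> makes the first term exactly \<open>r * x\<close>. The other
  term is the maximum of \<open>\<theta> * x powr q - r * x\<close> over \<open>x\<close>, so no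
  sharpness is lost on the way to the constant in the theorem.\<close>

lemma powr_le_linear:
  fixes \<theta> q r x :: real
  assumes \<theta>: "0 < \<theta>" and q: "0 < q" "q < 1" and r: "0 < r" and x: "0 \<le> x"
  shows "\<theta> * x powr q \<le> r * x + (1 - q) * \<theta> powr (1 / (1 - q)) * q powr (q / (1 - q)) * r powr (- (q / (1 - q)))"
proof -
  define s where "s = r / q"
  have s: "0 < s" using q r by (simp add: s_def)
  have "(s * x) powr q * (\<theta> * s powr - q) \<le> ((s * x) powr q) powr (1 / q) / (1 / q) + (\<theta> * s powr - q) powr (1 / (1 - q)) / (1 / (1 - q))"
    by (rule Youngs_inequality) (use q \<theta> x s in \<open>auto simp: field_simps\<close>)
  moreover have "(s * x) powr q * (\<theta> * s powr - q) = \<theta> * x powr q"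
    using s x by (simp add: powr_mult powr_minus field_simps)
  moreover have "((s * x) powr q) powr (1 / q) / (1 / q) = r * x"
    using r x q by (simp add: powr_powr s_def)
  moreover have "(\<theta> * s powr - q) powr (1 / (1 - q)) / (1 / (1 - q))
      = (1 - q) * \<theta> powr (1 / (1 - q)) * q powr (q / (1 - q)) * r powr (- (q / (1 - q)))"
  proof -
    have "s powr (- (q / (1 - q))) = r powr (- (q / (1 - q))) * q powr (q / (1 - q))"
      using q r by (simp add: s_def powr_divide powr_minus field_simps)
    then show ?thesis using s \<theta> by (simp add: powr_mult powr_powr)
  qed
  ultimately show ?thesis by (simp only:)
qed

text \<open>\<open>Re z\<close> is split in two: the share \<open>1 - \<kappa>\<close> absorbs the
  growth in \<open>x\<close> through \<open>powr_le_linear\<close>, and the share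
  \<open>\<kappa>\<close> keeps the integral convergent, at the price
  \<open>1 / (\<kappa> * Re z)\<close>. A small \<open>\<kappa>\<close> hardly changes the exponent.
  The term \<open>- t * Re (1 / z)\<close> is the modulus of the factor \<open>exp (- t / z)\<close>
  from \<open>goursat_Laplace_limit\<close>.\<close>

lemma goursat_Laplace_bound:
  assumes v: "goursat v" and \<theta>: "0 < \<theta>\<^sub>1" and q: "0 < q" "q < 1"
    and A: "A = (1 - q) * \<theta>\<^sub>1 powr (1 / (1 - q)) * q powr (q / (1 - q))"
    and growth: "\<And>x t. 0 \<le> x \<Longrightarrow> t \<in> T \<Longrightarrow> cmod (v x t) \<le> C * exp (\<theta>\<^sub>1 * x powr q + g t)"
    and T: "T \<subseteq> {0..}" "0 \<in> T"
    and z: "0 < Re z" and \<kappa>: "0 < \<kappa>" "\<kappa> < 1" and t: "t \<in> T"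
    and F: "((\<lambda>X. integral {0..X} (\<lambda>x. v x 0 * exp (- z * of_real x))) \<longlongrightarrow> Fz) at_top"
  shows "cmod Fz \<le> C / (\<kappa> * Re z) * exp (A * ((1 - \<kappa>) * Re z) powr (- (q / (1 - q))) + (g t - t * Re (1 / z)))"
proof -
  have vb: "cmod (v x t) \<le> (C * exp (A * \<sigma> powr (- (q / (1 - q))) + g t)) * exp (\<sigma> * x)"
    if "0 < \<sigma>" "0 \<le> x" "t \<in> T" for \<sigma> x t
  proof -
    have "0 \<le> C * exp (\<theta>\<^sub>1 * x powr q + g t)" using growth[OF that(2,3)] norm_ge_zero order_trans by blast
    then have C0: "0 \<le> C" by (simp add: zero_le_mult_iff)
    have "cmod (v x t) \<le> C * exp (\<theta>\<^sub>1 * x powr q + g t)" by (rule growth[OF that(2,3)])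
    also have "\<dots> \<le> C * exp (\<sigma> * x + A * \<sigma> powr (- (q / (1 - q))) + g t)"
      using powr_le_linear[OF \<theta> q that(1,2)] C0 by (intro mult_left_mono) (simp_all add: A)
    finally show ?thesis by (simp add: exp_add mult_ac)
  qed
  have b0: "\<exists>K. \<forall>x\<ge>0. cmod (v x 0) \<le> K * exp (\<sigma> * x)" if "0 < \<sigma>" for \<sigma>
    using vb[OF that _ T(2)] by blast
  have t0: "0 \<le> t" using t T by auto
  define \<sigma> where "\<sigma> = (1 - \<kappa>) * Re z"
  have \<sigma>: "0 < \<sigma>" "Re z - \<sigma> = \<kappa> * Re z" using \<kappa> z by (simp_all add: \<sigma>_def algebra_simps)
  have \<sigma>z: "\<sigma> < Re z" using \<sigma>(2) \<kappa> z by (metis diff_gt_0_iff_gt mult_pos_pos)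
  have vc: "continuous_on {0..} (\<lambda>x. v x t)"
  proof -
    have "continuous_on {0..} (\<lambda>x. case (x, t) of (x, t) \<Rightarrow> v x t)"
      by (rule continuous_on_compose2[of "{0..} \<times> {0..}" _ "{0..}" "\<lambda>x. (x, t)"])
        (use v t0 in \<open>auto simp only: goursat_def intro!: continuous_on_Pair continuous_on_id continuous_on_const\<close>)
    then show ?thesis by simp
  qed
  show ?thesis
  proof (rule tendsto_upperbound[OF tendsto_norm[OF goursat_Laplace_limit[OF v b0 z t0 F]]])
    show "\<forall>\<^sub>F X in at_top. cmod (exp (- of_real t / z) * integral {0..X} (\<lambda>x. v x t * exp (- z * of_real x)))
      \<le> C / (\<kappa> * Re z) * exp (A * ((1 - \<kappa>) * Re z) powr (- (q / (1 - q))) + (g t - t * Re (1 / z)))"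
      using eventually_ge_at_top[of 0]
    proof eventually_elim
      case (elim X)
      have "cmod (integral {0..X} (\<lambda>x. v x t * exp (- z * of_real x)))
          \<le> (C * exp (A * \<sigma> powr (- (q / (1 - q))) + g t)) * exp (- (Re z - \<sigma>) * 0) / (Re z - \<sigma>)"
        by (rule norm_Laplace_integral_le[OF vc vb[OF \<sigma>(1) _ t] \<sigma>z order_refl elim])
      then have I: "cmod (integral {0..X} (\<lambda>x. v x t * exp (- z * of_real x)))
          \<le> C * exp (A * \<sigma> powr (- (q / (1 - q))) + g t) / (\<kappa> * Re z)" by (simp add: \<sigma>(2))
      have "Re (of_real t / z) = t * Re (1 / z)" by (simp add: Re_divide')
      then have "cmod (exp (- of_real t / z)) = exp (- (t * Re (1 / z)))" by simp
      then have "cmod (exp (- of_real t / z) * integral {0..X} (\<lambda>x. v x t * exp (- z * of_real x)))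
         \<le> exp (- (t * Re (1 / z))) * (C * exp (A * \<sigma> powr (- (q / (1 - q))) + g t) / (\<kappa> * Re z))"
        unfolding norm_mult using I by (simp only:) (rule mult_left_mono, auto)
      also have "\<dots> = C / (\<kappa> * Re z) * exp (A * \<sigma> powr (- (q / (1 - q))) + (g t - t * Re (1 / z)))"
        by (simp add: exp_add exp_diff exp_minus field_simps)
      finally show ?case by (simp only: \<sigma>_def)
    qed
  qed simp_all
qed

section \<open>Decay on two rays\<close>

text \<open>The covering radius is of smaller order than \<open>\<bar>y\<bar>\<close>, so far out an
  interval that contains \<open>- t0\<close> has its centre within any prescribed relative distance
  of \<open>- t0\<close>.\<close>

lemma asymptotic_covering_dense:
  assumes cov: "asymptotic_covering q Y" and q: "1 / 2 < q" and \<nu>: "0 < \<nu>"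
  shows "eventually (\<lambda>t0. \<exists>t\<ge>0. - t \<in> Y \<and> \<bar>t - t0\<bar> \<le> \<nu> * t0) at_top"
proof -
  obtain M y1 where Y: "Y \<subseteq> {..0}" and M: "0 < M"
    and sub: "{..y1} \<subseteq> (\<Union>y\<in>Y. {y - M * covering_radius y q .. y + M * covering_radius y q})"
    using cov by (auto simp: asymptotic_covering_def)
  define p where "p = dual_exponent q / 2"
  have p: "0 < p" using q by (simp add: p_def dual_exponent_def)
  \<comment> \<open>The radius is measured relative to \<open>t\<close>, the claim relative to
    \<open>t0\<close>: the bound \<open>1/2\<close> yields \<open>t \<le> 2 * t0\<close>, and
    halving \<open>\<nu>\<close> pays for this factor.\<close>
  define \<nu>' where "\<nu>' = min (1/2) (\<nu> / 2)"
  have \<nu>': "0 < \<nu>'" "\<nu>' \<le> 1/2" "\<nu>' \<le> \<nu> / 2" using \<nu> by (auto simp: \<nu>'_def)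
  have "((\<lambda>t. M * t powr - p) \<longlongrightarrow> M * 0) at_top"
    by (intro tendsto_mult tendsto_const tendsto_neg_powr filterlim_ident) (use p in simp)
  then have "eventually (\<lambda>t. M * t powr - p < \<nu>') at_top"
    using \<nu>'(1) by (intro order_tendstoD(2)) auto
  then obtain t1 where t1: "\<And>t. t1 \<le> t \<Longrightarrow> M * t powr - p < \<nu>'"
    by (auto simp: eventually_at_top_linorder)
  show ?thesis
    using eventually_ge_at_top[of "max 0 (max (- y1) (t1 * (1 + M)))"]
  proof eventually_elim
    case (elim t0)
    then have t0: "0 \<le> t0" "- t0 \<le> y1" "t1 * (1 + M) \<le> t0" by auto
    have "- t0 \<in> (\<Union>y\<in>Y. {y - M * covering_radius y q .. y + M * covering_radius y q})"
      by (rule subsetD[OF sub]) (use t0 in simp)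
    then obtain y where y: "y \<in> Y" "y - M * covering_radius y q \<le> - t0" "- t0 \<le> y + M * covering_radius y q"
      by (elim UN_E) simp
    define t where "t = - y"
    have t: "0 \<le> t" "- t \<in> Y" using y(1) Y by (auto simp: t_def)
    have rad: "covering_radius y q = t * min 1 (t powr - p)"
      using t(1) by (simp add: covering_radius_def t_def p_def)
    have d: "\<bar>t - t0\<bar> \<le> M * (t * min 1 (t powr - p))"
      using y(2,3) unfolding rad t_def by linarith
    \<comment> \<open>The first entry of the minimum excludes a small centre with a huge interval:
      \<open>t\<close> is at least \<open>t0 / (1 + M)\<close>, hence large when \<open>t0\<close>
      is.\<close>
    have "M * (t * min 1 (t powr - p)) \<le> M * (t * 1)"
      using M t(1) by (intro mult_left_mono) auto
    then have "t0 \<le> t * (1 + M)" using d by (simp add: algebra_simps)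
    then have "t1 * (1 + M) \<le> t * (1 + M)" using t0(3) by linarith
    then have "t1 \<le> t" using M by simp
    have "M * (t * min 1 (t powr - p)) \<le> M * (t * t powr - p)"
      using M t(1) by (intro mult_left_mono) auto
    also have "\<dots> = (M * t powr - p) * t" by simp
    also have "\<dots> \<le> \<nu>' * t" using t1[OF \<open>t1 \<le> t\<close>] t(1) by (intro mult_right_mono) auto
    finally have d': "\<bar>t - t0\<bar> \<le> \<nu>' * t" using d by linarith
    have "\<nu>' * t \<le> 1/2 * t" using \<nu>'(2) t(1) by (intro mult_right_mono)
    then have "t \<le> 2 * t0" using d' by linarith
    then have "\<nu>' * t \<le> \<nu> / 2 * (2 * t0)" using \<nu>'(1,3) t(1) by (intro mult_mono) auto
    then show ?case using d' t by auto
  qed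
qed

text \<open>The left side is the coefficient of \<open>\<rho> powr \<alpha>\<close> lost to growth
  in \<open>x\<close> on the ray, the right side the coefficient gained at the optimal
  \<open>t\<close>. In logarithms everything is linear, and the claim is \<open>\<alpha>\<close>
  times the hypothesis because \<open>\<alpha> / q = \<alpha> + 1\<close>,
  \<open>\<alpha> / q'' = \<alpha> - 1\<close> and
  \<open>q'' - 1 = (1 - q) / q * q''\<close>.\<close>

lemma exponent_condition:
  fixes \<theta>\<^sub>1 \<theta>\<^sub>2 q q'' c :: real
  assumes \<theta>: "0 < \<theta>\<^sub>1" "0 < \<theta>\<^sub>2" and q: "1 / 2 < q" "q < 1" and q'': "q'' = dual_exponent q" and c: "0 < c"
    and less: "\<theta>\<^sub>1 powr (1 / q) * \<theta>\<^sub>2 powr (1 / q'') < (1 / q) powr (1 / q) * (1 / q'') powr (1 / q'') * c\<^sup>2"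
  shows "(1 - q) * \<theta>\<^sub>1 powr (1 / (1 - q)) * q powr (q / (1 - q)) * c powr (- (q / (1 - q)))
    < \<theta>\<^sub>2 * (c / (\<theta>\<^sub>2 * q'')) powr (q / (1 - q)) * (q'' - 1)"
proof -
  define \<alpha> where "\<alpha> = q / (1 - q)"
  have \<alpha>: "0 < \<alpha>" using q by (simp add: \<alpha>_def)
  have qq: "0 < q" "0 < 1 - q" "0 < 2 * q - 1" using q by auto
  have q''0: "0 < q''" using qq by (simp add: q'' dual_exponent_def)
  have q''1: "q'' - 1 = (1 - q) / (2 * q - 1)"
  proof -
    have "q'' * (2 * q - 1) = q" using qq(3) by (simp add: q'' dual_exponent_def)
    then have "(q'' - 1) * (2 * q - 1) = 1 - q" by (simp add: algebra_simps)
    then show ?thesis using qq(3) by (metis less_irrefl nonzero_mult_div_cancel_right)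
  qed
  have e1: "1 / (1 - q) = \<alpha> / q" using qq by (simp add: \<alpha>_def field_simps)
  have "\<alpha> * (1 - q) = q" using qq by (simp add: \<alpha>_def)
  then have "\<alpha> = (\<alpha> + 1) * q" "\<alpha> * (2 * q - 1) = (\<alpha> - 1) * q" by (simp_all add: algebra_simps)
  then have e2: "\<alpha> / q = \<alpha> + 1" and e3: "\<alpha> / q'' = \<alpha> - 1"
    using qq by (simp_all add: q'' dual_exponent_def divide_eq_eq)
  have "ln (\<theta>\<^sub>1 powr (1 / q) * \<theta>\<^sub>2 powr (1 / q'')) < ln ((1 / q) powr (1 / q) * (1 / q'') powr (1 / q'') * c\<^sup>2)"
    using less \<theta> qq q''0 c by (intro iffD2[OF ln_less_cancel_iff]) auto
  then have "ln \<theta>\<^sub>1 / q + ln \<theta>\<^sub>2 / q'' < - ln q / q - ln q'' / q'' + 2 * ln c"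
    using \<theta> qq q''0 c by (simp add: ln_mult ln_powr ln_div ln_realpow)
  then have "\<alpha> * (ln \<theta>\<^sub>1 / q + ln \<theta>\<^sub>2 / q'') < \<alpha> * (- ln q / q - ln q'' / q'' + 2 * ln c)"
    using \<alpha> by (rule mult_strict_left_mono)
  then have "\<alpha> / q * ln \<theta>\<^sub>1 + \<alpha> / q'' * ln \<theta>\<^sub>2 < - (\<alpha> / q * ln q) - \<alpha> / q'' * ln q'' + 2 * \<alpha> * ln c"
    by (simp add: algebra_simps)
  then have l: "(\<alpha> + 1) * ln \<theta>\<^sub>1 + (\<alpha> - 1) * ln \<theta>\<^sub>2 < - ((\<alpha> + 1) * ln q) - (\<alpha> - 1) * ln q'' + 2 * \<alpha> * ln c"
    unfolding e2 e3 .
  have q''1l: "ln (q'' - 1) = ln (1 - q) - ln q + ln q''"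
  proof -
    have "q'' - 1 = (1 - q) / q * q''" using qq unfolding q''1 by (simp add: q'' dual_exponent_def)
    then show ?thesis using qq q''0 by (simp add: ln_mult ln_div)
  qed
  have q''1p: "0 < q'' - 1" unfolding q''1 using qq by (intro divide_pos_pos)
  have "ln ((1 - q) * \<theta>\<^sub>1 powr (\<alpha> + 1) * q powr \<alpha> * c powr (- \<alpha>))
    = ln (1 - q) + (\<alpha> + 1) * ln \<theta>\<^sub>1 + \<alpha> * ln q - \<alpha> * ln c"
    using \<theta> qq c by (simp add: ln_mult ln_powr)
  also have "\<dots> < ln \<theta>\<^sub>2 + \<alpha> * (ln c - ln \<theta>\<^sub>2 - ln q'') + (ln (1 - q) - ln q + ln q'')"
    using l by (simp add: algebra_simps)
  also have "\<dots> = ln (\<theta>\<^sub>2 * (c / (\<theta>\<^sub>2 * q'')) powr \<alpha> * (q'' - 1))"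
    using \<theta> q''0 c q''1p by (simp add: ln_mult ln_powr ln_div q''1l)
  finally have "(1 - q) * \<theta>\<^sub>1 powr (\<alpha> + 1) * q powr \<alpha> * c powr (- \<alpha>) < \<theta>\<^sub>2 * (c / (\<theta>\<^sub>2 * q'')) powr \<alpha> * (q'' - 1)"
    using \<theta> qq q''0 c q''1p by (subst (asm) ln_less_cancel_iff) auto
  then show ?thesis by (simp only: e1 e2 \<alpha>_def[symmetric])
qed

text \<open>The exponent \<open>\<theta>\<^sub>2 t\<^sup>p - t s\<close> is minimal at \<open>t0 = (s / (\<theta>\<^sub>2 p)) powr (\<alpha> - 1)\<close>; by the covering
  property some admissible \<open>t = \<lambda> t0\<close> with \<open>\<lambda>\<close> close to 1 is available.\<close>

lemma ray_decay:
  fixes F :: "complex \<Rightarrow> complex" and T :: "real set" and A C \<theta> c p \<alpha> :: real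
  assumes bound: "\<And>\<kappa> z t. 0 < \<kappa> \<Longrightarrow> \<kappa> < 1 \<Longrightarrow> 0 < Re z \<Longrightarrow> t \<in> T \<Longrightarrow>
      cmod (F z) \<le> C / (\<kappa> * Re z) * exp (A * ((1 - \<kappa>) * Re z) powr (- \<alpha>) + (\<theta> * t powr p - t * Re (1 / z)))"
    and T: "0 \<in> T" "T \<subseteq> {0..}"
    and dense: "\<And>\<nu>. 0 < \<nu> \<Longrightarrow> eventually (\<lambda>t0. \<exists>t\<in>T. \<bar>t - t0\<bar> \<le> \<nu> * t0) at_top"
    and pos: "0 < \<theta>" "0 < c" "0 \<le> A" "1 < \<alpha>" "0 \<le> C" and p: "p * (\<alpha> - 1) = \<alpha>"
    and less: "A * c powr (- \<alpha>) < \<theta> * (c / (\<theta> * p)) powr \<alpha> * (p - 1)"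
  shows "\<exists>K \<epsilon>. 0 < \<epsilon> \<and> (\<forall>\<rho> z. 0 < \<rho> \<longrightarrow> Re z = c / \<rho> \<longrightarrow> Re (1 / z) = c * \<rho> \<longrightarrow>
    cmod (F z) \<le> K * exp (- \<epsilon> * \<rho> powr \<alpha>))"
proof -
  have p0: "0 < p" using p pos(4) by (metis diff_gt_0_iff_gt less_trans zero_less_mult_pos2 zero_less_one)
  define D where "D = \<theta> * (c / (\<theta> * p)) powr \<alpha>"
  \<comment> \<open>A third of the gap in \<open>less\<close>: one third is spent on
    \<open>\<kappa> > 0\<close>, one on \<open>l\<close> not being exactly 1, and one remains as
    decay.\<close>
  define \<epsilon> where "\<epsilon> = (D * (p - 1) - A * c powr (- \<alpha>)) / 3"
  have \<epsilon>: "0 < \<epsilon>" using less by (simp add: \<epsilon>_def D_def)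
  have "((\<lambda>\<kappa>. A * c powr (- \<alpha>) * (1 - \<kappa>) powr (- \<alpha>)) \<longlongrightarrow> A * c powr (- \<alpha>) * (1 - 0) powr (- \<alpha>)) (at_right (0::real))"
    by (intro tendsto_intros) auto
  then have "eventually (\<lambda>\<kappa>. A * c powr (- \<alpha>) * (1 - \<kappa>) powr (- \<alpha>) < A * c powr (- \<alpha>) + \<epsilon>) (at_right (0::real))"
    by (rule order_tendstoD(2)) (use \<epsilon> in simp)
  moreover have "eventually (\<lambda>\<kappa>. \<kappa> \<in> {0<..<1}) (at_right (0::real))"
    by (rule eventually_at_right_real) simp
  ultimately have "eventually (\<lambda>\<kappa>. A * c powr (- \<alpha>) * (1 - \<kappa>) powr (- \<alpha>) < A * c powr (- \<alpha>) + \<epsilon> \<and> \<kappa> \<in> {0<..<1}) (at_right (0::real))"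
    by (rule eventually_conj)
  then obtain \<kappa> where \<kappa>: "A * c powr (- \<alpha>) * (1 - \<kappa>) powr (- \<alpha>) < A * c powr (- \<alpha>) + \<epsilon>" "0 < \<kappa>" "\<kappa> < 1"
    using eventually_happens by fastforce
  have "((\<lambda>l. D * (l powr p - p * l)) \<longlongrightarrow> D * (1 powr p - p * 1)) (at (1::real))"
    by (intro tendsto_intros) auto
  then have "eventually (\<lambda>l. D * (l powr p - p * l) < - (D * (p - 1)) + \<epsilon>) (at (1::real))"
    by (rule order_tendstoD(2)) (use \<epsilon> in \<open>simp add: algebra_simps\<close>)
  then obtain d where d: "0 < d" "\<And>l. l \<noteq> 1 \<Longrightarrow> dist l 1 < d \<Longrightarrow> D * (l powr p - p * l) < - (D * (p - 1)) + \<epsilon>"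
    unfolding eventually_at by auto
  have lam: "D * (l powr p - p * l) < - (D * (p - 1)) + \<epsilon>" if "\<bar>l - 1\<bar> < d" for l
    using d(2)[of l] that \<epsilon> by (cases "l = 1") (auto simp: dist_real_def algebra_simps)
  define t0 where "t0 \<rho> = (c * \<rho> / (\<theta> * p)) powr (\<alpha> - 1)" for \<rho>
  have "filterlim (\<lambda>\<rho>. c / (\<theta> * p) * \<rho>) at_top at_top"
    by (rule filterlim_tendsto_pos_mult_at_top[OF tendsto_const _ filterlim_ident]) (use pos p0 in simp)
  then have "filterlim t0 at_top at_top"
    unfolding t0_def using filterlim_compose[OF real_powr_at_top[of "\<alpha> - 1"]] pos(4) by fastforce
  then have "eventually (\<lambda>\<rho>. \<exists>t\<in>T. \<bar>t - t0 \<rho>\<bar> \<le> d / 2 * t0 \<rho>) at_top"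
    using eventually_compose_filterlim[OF dense[of "d / 2"]] d(1) by simp
  then obtain \<rho>0 where \<rho>0: "\<And>\<rho>. \<rho>0 \<le> \<rho> \<Longrightarrow> \<exists>t\<in>T. \<bar>t - t0 \<rho>\<bar> \<le> d / 2 * t0 \<rho>"
    by (auto simp: eventually_at_top_linorder)
  define \<rho>1 where "\<rho>1 = max 1 \<rho>0"
  \<comment> \<open>\<open>K1\<close> serves large \<open>\<rho>\<close>, where half of the decay
    absorbs the prefactor \<open>\<rho>\<close> coming from \<open>1 / Re z\<close>.
    \<open>K2\<close> serves the bounded range of \<open>\<rho>\<close>, where no decay has to be
    proved.\<close>
  define K1 where "K1 = C / (\<kappa> * c) * (2 / \<epsilon>)"
  define K2 where "K2 = 2 * C * \<rho>1 / c * exp (A * (c / 2) powr (- \<alpha>) * \<rho>1 powr \<alpha>) * exp (\<epsilon> / 2 * \<rho>1 powr \<alpha>)"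
  have K12: "0 \<le> K1" "0 \<le> K2" using pos \<kappa> \<epsilon> by (simp_all add: K1_def K2_def \<rho>1_def)
  show ?thesis
  proof (rule exI[of _ "K1 + K2"], rule exI[of _ "\<epsilon> / 2"], intro conjI allI impI)
    show "0 < \<epsilon> / 2" using \<epsilon> by simp
    fix \<rho> z assume \<rho>: "0 < \<rho>" and z: "Re z = c / \<rho>" "Re (1 / z) = c * \<rho>"
    have Rz: "0 < Re z" using \<rho> pos by (simp add: z)
    have A': "A * ((1 - k) * Re z) powr (- \<alpha>) = A * c powr (- \<alpha>) * (1 - k) powr (- \<alpha>) * \<rho> powr \<alpha>" if "k < 1" for k
    proof -
      have "((1 - k) * Re z) powr (- \<alpha>) = (1 - k) powr (- \<alpha>) * (c / \<rho>) powr (- \<alpha>)"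
        unfolding z by (rule powr_mult)
      moreover have "(c / \<rho>) powr (- \<alpha>) = c powr (- \<alpha>) * \<rho> powr \<alpha>"
        by (simp add: powr_divide powr_minus_divide)
      ultimately show ?thesis by simp
    qed
    show "cmod (F z) \<le> (K1 + K2) * exp (- (\<epsilon> / 2) * \<rho> powr \<alpha>)"
    proof (cases "\<rho>1 \<le> \<rho>")
      case True
      then have \<rho>': "1 \<le> \<rho>" "\<rho>0 \<le> \<rho>" by (auto simp: \<rho>1_def)
      obtain t where t: "t \<in> T" "\<bar>t - t0 \<rho>\<bar> \<le> d / 2 * t0 \<rho>" using \<rho>0[OF \<rho>'(2)] by blast
      have s0: "0 < c * \<rho> / (\<theta> * p)" using pos p0 \<rho> by simp
      then have t0p: "0 < t0 \<rho>" using pos p0 \<rho> by (simp add: t0_def)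
      define l where "l = t / t0 \<rho>"
      have tl: "t = l * t0 \<rho>" using t0p by (simp add: l_def)
      have l0: "0 \<le> l" using t(1) T t0p by (auto simp: l_def)
      have "\<bar>l - 1\<bar> \<le> d / 2"
      proof -
        have "\<bar>l - 1\<bar> * t0 \<rho> = \<bar>t - t0 \<rho>\<bar>" 
          using abs_mult[of "l - 1" "t0 \<rho>"] t0p by (simp add: tl left_diff_distrib)
        then have "\<bar>l - 1\<bar> * t0 \<rho> \<le> d / 2 * t0 \<rho>" using t(2) by linarith
        then show ?thesis using t0p by (rule mult_right_le_imp_le)
      qed
      then have L: "D * (l powr p - p * l) < - (D * (p - 1)) + \<epsilon>" using lam d(1) by simp
      \<comment> \<open>Homogeneity: with \<open>s = c * \<rho> / (\<theta> * p)\<close> both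
        \<open>t0 \<rho> powr p\<close> and \<open>t0 \<rho> * s\<close> equal
        \<open>s powr \<alpha>\<close>, so the two terms scale alike and only the ratio
        \<open>l\<close> is left.\<close>
      have E: "\<theta> * t powr p - t * (c * \<rho>) = D * (l powr p - p * l) * \<rho> powr \<alpha>"
      proof -
        define s where "s = c * \<rho> / (\<theta> * p)"
        have s: "0 < s" "c * \<rho> = \<theta> * p * s" using s0 pos p0 by (simp_all add: s_def)
        have "(\<alpha> - 1) * p = \<alpha>" by (subst mult.commute) (rule p)
        then have "t0 \<rho> powr p = s powr \<alpha>" by (simp only: t0_def s_def powr_powr)
        then have 1: "t powr p = l powr p * s powr \<alpha>" by (simp add: tl powr_mult)
        have "t0 \<rho> * s = s powr (\<alpha> - 1) * s powr 1" using s(1) by (simp add: t0_def s_def[symmetric])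
        also have "\<dots> = s powr \<alpha>" by (simp only: powr_add[symmetric]) simp
        finally have "t0 \<rho> * s = s powr \<alpha>" .
        then have 2: "t * (c * \<rho>) = \<theta> * p * l * s powr \<alpha>" unfolding tl s(2) by (metis mult.assoc mult.commute)
        have "D * \<rho> powr \<alpha> = \<theta> * s powr \<alpha>"
        proof -
          have "s = c / (\<theta> * p) * \<rho>" by (simp add: s_def)
          then have "s powr \<alpha> = (c / (\<theta> * p)) powr \<alpha> * \<rho> powr \<alpha>" by (simp only: powr_mult)
          then show ?thesis by (simp add: D_def)
        qed
        then have "D * (l powr p - p * l) * \<rho> powr \<alpha> = (l powr p - p * l) * (\<theta> * s powr \<alpha>)"
          by (metis mult.assoc mult.commute)
        then show ?thesis unfolding 1 2 by (simp add: algebra_simps)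
      qed
      have "A * ((1 - \<kappa>) * Re z) powr (- \<alpha>) + (\<theta> * t powr p - t * Re (1 / z))
          = (A * c powr (- \<alpha>) * (1 - \<kappa>) powr (- \<alpha>) + D * (l powr p - p * l)) * \<rho> powr \<alpha>"
        unfolding A'[OF \<kappa>(3)] z(2) E by (simp add: distrib_right)
      also have "\<dots> \<le> (- \<epsilon>) * \<rho> powr \<alpha>"
        by (rule mult_right_mono) (use L \<kappa>(1) in \<open>simp_all add: \<epsilon>_def field_simps\<close>)
      finally have "exp (A * ((1 - \<kappa>) * Re z) powr (- \<alpha>) + (\<theta> * t powr p - t * Re (1 / z))) \<le> exp ((- \<epsilon>) * \<rho> powr \<alpha>)"
        by simp
      then have "C / (\<kappa> * Re z) * exp (A * ((1 - \<kappa>) * Re z) powr (- \<alpha>) + (\<theta> * t powr p - t * Re (1 / z))) \<le> C / (\<kappa> * Re z) * exp ((- \<epsilon>) * \<rho> powr \<alpha>)"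
        using pos \<kappa> Rz by (intro mult_left_mono) auto
      then have "cmod (F z) \<le> C / (\<kappa> * Re z) * exp ((- \<epsilon>) * \<rho> powr \<alpha>)"
        using bound[OF \<kappa>(2,3) Rz t(1)] by linarith
      also have "\<dots> = C / (\<kappa> * c) * (\<rho> * exp ((- \<epsilon>) * \<rho> powr \<alpha>))" by (simp add: z)
      also have "\<dots> \<le> C / (\<kappa> * c) * (2 / \<epsilon> * exp (\<epsilon> / 2 * \<rho> powr \<alpha>) * exp ((- \<epsilon>) * \<rho> powr \<alpha>))"
      proof (intro mult_left_mono mult_right_mono)
        have "\<rho> powr 1 \<le> \<rho> powr \<alpha>" using \<rho>' pos(4) by (intro powr_mono) auto
        moreover have "\<epsilon> / 2 * \<rho> powr \<alpha> \<le> exp (\<epsilon> / 2 * \<rho> powr \<alpha>)"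
          using exp_ge_add_one_self[of "\<epsilon> / 2 * \<rho> powr \<alpha>"] by linarith
        then have "\<rho> powr \<alpha> \<le> 2 / \<epsilon> * exp (\<epsilon> / 2 * \<rho> powr \<alpha>)" using \<epsilon> by (simp add: field_simps)
        ultimately show "\<rho> \<le> 2 / \<epsilon> * exp (\<epsilon> / 2 * \<rho> powr \<alpha>)" using \<rho> by simp
      qed (use pos \<kappa> in auto)
      also have "\<dots> = K1 * (exp (\<epsilon> / 2 * \<rho> powr \<alpha>) * exp ((- \<epsilon>) * \<rho> powr \<alpha>))" by (simp add: K1_def)
      also have "exp (\<epsilon> / 2 * \<rho> powr \<alpha>) * exp ((- \<epsilon>) * \<rho> powr \<alpha>) = exp (- (\<epsilon> / 2) * \<rho> powr \<alpha>)"
        by (simp add: exp_add[symmetric] field_simps)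
      also have "K1 * \<dots> \<le> (K1 + K2) * \<dots>" using K12 by (intro mult_right_mono) auto
      finally show ?thesis .
    next
      case False
      then have \<rho>1: "\<rho> powr \<alpha> \<le> \<rho>1 powr \<alpha>" "\<rho> \<le> \<rho>1" using \<rho> pos by (auto intro: powr_mono2)
      \<comment> \<open>The admissible value \<open>t = 0\<close> suffices here; both terms
        containing \<open>t\<close> vanish, as \<open>0 powr p = 0\<close>.\<close>
      have "cmod (F z) \<le> C / (1/2 * Re z) * exp (A * ((1 - 1/2) * Re z) powr (- \<alpha>) + (\<theta> * 0 powr p - 0 * Re (1 / z)))"
        by (rule bound[OF _ _ Rz T(1)]) auto
      also have "\<dots> = 2 * C * \<rho> / c * exp (A * (c / 2) powr (- \<alpha>) * \<rho> powr \<alpha>)"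
        using A'[of "1/2"] pos \<rho> by (simp add: z powr_divide powr_mult powr_minus field_simps)
      also have "\<dots> \<le> 2 * C * \<rho>1 / c * exp (A * (c / 2) powr (- \<alpha>) * \<rho>1 powr \<alpha>)"
        using pos \<rho> \<rho>1 by (intro mult_mono divide_right_mono mult_left_mono iffD2[OF exp_le_cancel_iff]) auto
      also have "\<dots> = K2 * exp (- (\<epsilon> / 2) * \<rho>1 powr \<alpha>)"
        by (simp add: K2_def mult.assoc exp_add[symmetric])
      also have "\<dots> \<le> K2 * exp (- (\<epsilon> / 2) * \<rho> powr \<alpha>)"
        using K12 \<epsilon> \<rho>1 by (intro mult_left_mono) auto
      also have "\<dots> \<le> (K1 + K2) * exp (- (\<epsilon> / 2) * \<rho> powr \<alpha>)" using K12 by (intro mult_right_mono) auto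
      finally show ?thesis .
    qed
  qed
qed

section \<open>Uniqueness\<close>

text \<open>The substitution \<open>z = \<zeta> powr (- 1 / \<alpha>)\<close> maps the half-plane \<open>Re \<zeta> > 0\<close> onto the sector
  \<open>\<bar>Arg z\<bar> < pi / (2 * \<alpha>)\<close>, on whose boundary rays \<open>F\<close> decays.\<close>

lemma sector_decay_eq_0:
  fixes F :: "complex \<Rightarrow> complex"
  assumes F: "F holomorphic_on {z. 0 < Re z}"
    and \<alpha>: "1 < \<alpha>" and c: "c = cos (pi / (2 * \<alpha>))"
    and growth: "\<And>z. 0 < Re z \<Longrightarrow> cmod (F z) \<le> C / Re z * exp (L * Re z powr (- \<alpha>))" and L: "0 \<le> L"
    and decay: "\<And>\<rho> z. 0 < \<rho> \<Longrightarrow> Re z = c / \<rho> \<Longrightarrow> Re (1 / z) = c * \<rho> \<Longrightarrow> cmod (F z) \<le> K * exp (- \<epsilon> * \<rho> powr \<alpha>)"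
    and \<epsilon>: "0 < \<epsilon>" and r: "0 < r"
  shows "F (of_real r) = 0"
proof -
  define \<beta> where "\<beta> = 1 / \<alpha>"
  have \<beta>: "0 < \<beta>" "\<beta> < 1" "\<beta> * \<alpha> = 1" using \<alpha> by (simp_all add: \<beta>_def)
  have cb: "c = cos (\<beta> * (pi / 2))" by (simp add: c \<beta>_def mult.commute)
  have b2: "0 < \<beta> * (pi / 2)" "\<beta> * (pi / 2) < pi / 2" using \<beta> by simp_all
  have c0: "0 < c" unfolding cb by (rule cos_gt_zero) (use b2 in auto)
  have C0: "0 \<le> C"
  proof -
    have "0 \<le> C * exp L" using growth[of 1] norm_ge_zero[of "F 1"] by (simp del: norm_ge_zero)
    then show ?thesis by (simp add: zero_le_mult_iff)
  qed
  \<comment> \<open>\<open>w (-1)\<close> is the substitution for \<open>z\<close>, and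
    \<open>w 1\<close> gives \<open>1 / z\<close>; the sign \<open>s\<close> lets one formula yield
    both real parts.\<close>
  define w where "w s \<zeta> = \<zeta> powr (of_real (s * \<beta>) :: complex)" for s and \<zeta> :: complex
  have Re_w: "Re (w s \<zeta>) = cmod \<zeta> powr (s * \<beta>) * cos (s * \<beta> * Arg \<zeta>)" if "\<zeta> \<noteq> 0" for s \<zeta>
    using that by (simp add: w_def powr_def Re_exp Arg_eq_Im_Ln)
  have cosb: "c \<le> cos (\<beta> * Arg \<zeta>)" if "0 \<le> Re \<zeta>" for \<zeta>
  proof -
    have "\<bar>Arg \<zeta>\<bar> \<le> pi / 2" using that Arg_Re_nonneg by blast
    then have "\<bar>\<beta> * Arg \<zeta>\<bar> \<le> \<beta> * (pi / 2)" unfolding abs_mult using \<beta> by (intro mult_mono) auto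
    then have "cos (\<beta> * (pi / 2)) \<le> cos \<bar>\<beta> * Arg \<zeta>\<bar>"
      by (intro cos_monotone_0_pi_le) (use b2 pi_gt_zero in linarith)+
    then show ?thesis by (simp add: cb)
  qed
  have Rez: "c * cmod \<zeta> powr - \<beta> \<le> Re (w (-1) \<zeta>)" if "0 \<le> Re \<zeta>" "\<zeta> \<noteq> 0" for \<zeta>
    using Re_w[OF that(2), of "-1"] cosb[OF that(1)] by (simp add: mult.commute mult_right_mono)
  have Rez0: "0 < Re (w (-1) \<zeta>)" if "0 \<le> Re \<zeta>" "\<zeta> \<noteq> 0" for \<zeta>
    by (rule less_le_trans[OF _ Rez[OF that]]) (use c0 that in simp)
  \<comment> \<open>The point 0 corresponds to \<open>z\<close> at infinity. There the factor
    \<open>C / Re z\<close> of the growth bound becomes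
    \<open>C' * cmod \<zeta> powr \<beta>\<close>, so 0 is the continuous value.\<close>
  define G where "G \<zeta> = (if \<zeta> = 0 then 0 else F (w (-1) \<zeta>))" for \<zeta>
  define C' where "C' = C / c"
  define L' where "L' = L * c powr (- \<alpha>)"
  have G1: "cmod (G \<zeta>) \<le> C' * cmod \<zeta> powr \<beta> * exp (L' * cmod \<zeta>)" if "0 \<le> Re \<zeta>" for \<zeta>
  proof (cases "\<zeta> = 0")
    case False
    have z: "0 < Re (w (-1) \<zeta>)" by (rule Rez0[OF that False])
    have n: "0 < cmod \<zeta>" using False by simp
    have "cmod (G \<zeta>) \<le> C / Re (w (-1) \<zeta>) * exp (L * Re (w (-1) \<zeta>) powr (- \<alpha>))"
      using growth[OF z] False by (simp add: G_def)
    also have "\<dots> \<le> C / (c * cmod \<zeta> powr - \<beta>) * exp (L * (c * cmod \<zeta> powr - \<beta>) powr (- \<alpha>))"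
    proof (intro mult_mono divide_left_mono iffD2[OF exp_le_cancel_iff] mult_left_mono)
      show "Re (w (-1) \<zeta>) powr (- \<alpha>) \<le> (c * cmod \<zeta> powr - \<beta>) powr (- \<alpha>)"
        by (rule powr_mono2') (use Rez[OF that False] c0 n \<alpha> in auto)
    qed (use Rez[OF that False] C0 L c0 n z in auto)
    also have "(c * cmod \<zeta> powr - \<beta>) powr (- \<alpha>) = c powr (- \<alpha>) * cmod \<zeta>"
      using \<beta>(3) n by (simp add: powr_mult powr_powr)
    also have "C / (c * cmod \<zeta> powr - \<beta>) = C' * cmod \<zeta> powr \<beta>"
      by (simp add: C'_def powr_minus divide_inverse)
    finally show ?thesis by (simp add: L'_def mult.assoc)
  qed (simp add: G_def)
  define K' where "K' = max C' K"
  have C'0: "0 \<le> C'" using C0 c0 by (simp add: C'_def)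
  have K': "C' \<le> K'" "K \<le> K'" "0 \<le> K'" using C'0 by (auto simp: K'_def)
  have wcont: "isCont (w (-1)) \<zeta>" and wdiff: "w (-1) field_differentiable (at \<zeta>)" if "0 \<le> Re \<zeta>" "\<zeta> \<noteq> 0" for \<zeta>
  proof -
    have nz: "\<zeta> \<notin> \<real>\<^sub>\<le>\<^sub>0" using that by (auto simp: complex_nonpos_Reals_iff complex_eq_iff)
    show "w (-1) field_differentiable (at \<zeta>)"
      unfolding w_def field_differentiable_def by (rule exI) (rule has_field_derivative_powr[OF nz])
    then show "isCont (w (-1)) \<zeta>" by (rule field_differentiable_imp_continuous_at)
  qed
  have "G (of_real (r powr (- \<alpha>))) = 0"
  \<comment> \<open>The extra 1 in the type absorbs
    \<open>cmod \<zeta> powr \<beta> \<le> exp (cmod \<zeta>)\<close>.\<close>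
  proof (rule half_plane_exponential_type_eq_0[where f = G and K = K' and L = "1 + L'" and \<epsilon> = \<epsilon>])
    have "w (-1) holomorphic_on {\<zeta>. 0 < Re \<zeta>}"
      unfolding holomorphic_on_def
    proof
      fix \<zeta> assume "\<zeta> \<in> {\<zeta>. 0 < Re \<zeta>}"
      then have "0 \<le> Re \<zeta>" "\<zeta> \<noteq> 0" by auto
      then show "w (-1) field_differentiable (at \<zeta> within {\<zeta>. 0 < Re \<zeta>})"
        by (rule field_differentiable_at_within[OF wdiff])
    qed
    then have "(\<lambda>\<zeta>. F (w (-1) \<zeta>)) holomorphic_on {\<zeta>. 0 < Re \<zeta>}"
      by (rule holomorphic_on_compose_gen[OF _ F, unfolded o_def]) (auto intro!: Rez0)
    then show "G holomorphic_on {\<zeta>. 0 < Re \<zeta>}"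
      by (rule holomorphic_transform) (auto simp: G_def)
    have "continuous (at \<zeta> within {\<zeta>. 0 \<le> Re \<zeta>}) G" if \<zeta>: "0 \<le> Re \<zeta>" for \<zeta>
    proof (cases "\<zeta> = 0")
      case True
      have "((\<lambda>\<zeta>. C' * cmod \<zeta> powr \<beta> * exp (L' * cmod \<zeta>)) \<longlongrightarrow> C' * 0 * exp (L' * 0)) (at 0 within {\<zeta>. 0 \<le> Re \<zeta>})"
      proof (intro tendsto_mult tendsto_const tendsto_exp)
        show n: "(cmod \<longlongrightarrow> 0) (at 0 within {\<zeta>. 0 \<le> Re \<zeta>})" by (intro tendsto_norm_zero tendsto_ident_at)
        show "((\<lambda>\<zeta>. cmod \<zeta> powr \<beta>) \<longlongrightarrow> 0) (at 0 within {\<zeta>. 0 \<le> Re \<zeta>})"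
          using tendsto_powr2[OF n tendsto_const[of \<beta>]] \<beta>(1) by simp
      qed
      then have l: "((\<lambda>\<zeta>. C' * cmod \<zeta> powr \<beta> * exp (L' * cmod \<zeta>)) \<longlongrightarrow> 0) (at 0 within {\<zeta>. 0 \<le> Re \<zeta>})"
        by simp
      have "eventually (\<lambda>\<zeta>. cmod (G \<zeta>) \<le> C' * cmod \<zeta> powr \<beta> * exp (L' * cmod \<zeta>)) (at 0 within {\<zeta>. 0 \<le> Re \<zeta>})"
        unfolding eventually_at_filter by (rule always_eventually) (simp add: G1)
      then have "(G \<longlongrightarrow> 0) (at 0 within {\<zeta>. 0 \<le> Re \<zeta>})"
        using l by (rule Lim_null_comparison)
      then show ?thesis using True by (simp add: continuous_within G_def)
    next
      case False
      have "isCont F (w (-1) \<zeta>)"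
        using holomorphic_on_imp_continuous_on[OF F] Rez0[OF \<zeta> False]
        by (simp add: continuous_on_eq_continuous_at open_halfspace_Re_gt)
      then have "isCont (\<lambda>\<zeta>. F (w (-1) \<zeta>)) \<zeta>"
        by (rule isCont_o2[OF wcont[OF \<zeta> False]])
      moreover have "eventually (\<lambda>x. G x = F (w (-1) x)) (nhds \<zeta>)"
        by (rule eventually_mono[OF t1_space_nhds[OF False]]) (simp add: G_def)
      ultimately have "isCont G \<zeta>" by (simp add: isCont_cong)
      then show ?thesis by (rule continuous_at_imp_continuous_at_within)
    qed
    then show "continuous_on {\<zeta>. 0 \<le> Re \<zeta>} G" by (simp add: continuous_on_eq_continuous_within)
    show "cmod (G \<zeta>) \<le> K' * exp ((1 + L') * cmod \<zeta>)" if \<zeta>: "0 \<le> Re \<zeta>" for \<zeta>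
    proof -
      have "cmod \<zeta> powr \<beta> \<le> exp (cmod \<zeta>)"
      proof (cases "cmod \<zeta> \<le> 1")
        case True
        then have "cmod \<zeta> powr \<beta> \<le> 1" using \<beta> by (intro powr_le1) auto
        also have "1 \<le> exp (cmod \<zeta>)" by simp
        finally show ?thesis .
      next
        case False
        then have "cmod \<zeta> powr \<beta> \<le> cmod \<zeta> powr 1" using \<beta> by (intro powr_mono) auto
        also have "\<dots> = cmod \<zeta>" by simp
        also have "\<dots> \<le> exp (cmod \<zeta>)" using exp_ge_add_one_self[of "cmod \<zeta>"] by linarith
        finally show ?thesis .
      qed
      then have "C' * cmod \<zeta> powr \<beta> * exp (L' * cmod \<zeta>) \<le> K' * exp (cmod \<zeta>) * exp (L' * cmod \<zeta>)"
        using K' by (intro mult_mono) auto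
      with G1[OF \<zeta>] have "cmod (G \<zeta>) \<le> K' * exp (cmod \<zeta>) * exp (L' * cmod \<zeta>)" by (rule order_trans)
      then show ?thesis by (simp add: exp_add distrib_right mult.assoc)
    qed
    show "cmod (G (Complex 0 y)) \<le> K' * exp (- \<epsilon> * \<bar>y\<bar>)" for y
    proof (cases "y = 0")
      case True
      then show ?thesis using K' by (simp add: G_def complex_eq_iff)
    next
      case False
      define \<zeta> where "\<zeta> = Complex 0 y"
      have \<zeta>: "\<zeta> \<noteq> 0" "cmod \<zeta> = \<bar>y\<bar>" using False by (simp_all add: \<zeta>_def complex_eq_iff cmod_def)
      have "\<bar>Arg \<zeta>\<bar> = pi / 2"
      proof -
        have eq: "\<zeta> = of_real y * \<i>" by (simp add: \<zeta>_def complex_eq_iff)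
        show ?thesis
        proof (cases "0 < y")
          case True
          then have "Arg \<zeta> = pi / 2" unfolding eq by (subst Arg_times_of_real) (simp_all add: Arg_eq_Im_Ln)
          then show ?thesis using pi_gt_zero by linarith
        next
          case f: False
          then have "\<zeta> = of_real (- y) * (- \<i>)" using eq by simp
          then have "Arg \<zeta> = - (pi / 2)" using f False
            by (simp only:) (subst Arg_times_of_real; simp add: Arg_eq_Im_Ln)
          then show ?thesis using pi_gt_zero by linarith
        qed
      qed
      then have "\<bar>s * \<beta> * Arg \<zeta>\<bar> = \<beta> * (pi / 2)" if "\<bar>s\<bar> = 1" for s
        using that \<beta>(1) by (simp only: abs_mult abs_of_pos mult_1_left)
      then have cs: "cos (s * \<beta> * Arg \<zeta>) = c" if "\<bar>s\<bar> = 1" for s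
        using that by (metis cb cos_abs_real)
      have "1 / w (-1) \<zeta> = w 1 \<zeta>" by (simp add: w_def powr_minus divide_inverse)
      then have "Re (1 / w (-1) \<zeta>) = c * (\<bar>y\<bar> powr \<beta>)"
        using Re_w[OF \<zeta>(1), of 1] cs[of 1] by (simp add: \<zeta>(2) mult.commute)
      moreover have "Re (w (-1) \<zeta>) = c / (\<bar>y\<bar> powr \<beta>)"
        using Re_w[OF \<zeta>(1), of "-1"] cs[of "-1"] by (simp add: \<zeta>(2) powr_minus divide_inverse mult.commute)
      \<comment> \<open>The imaginary axis is mapped to the two rays, with parameter
        \<open>\<rho> = \<bar>y\<bar> powr \<beta>\<close>; then
        \<open>\<rho> powr \<alpha> = \<bar>y\<bar>\<close> turns the decay on the rays into
        exponential decay in \<open>y\<close>.\<close>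
      ultimately have "cmod (F (w (-1) \<zeta>)) \<le> K * exp (- \<epsilon> * (\<bar>y\<bar> powr \<beta>) powr \<alpha>)"
        by (intro decay) (use False in auto)
      also have "(\<bar>y\<bar> powr \<beta>) powr \<alpha> = \<bar>y\<bar>" using \<beta>(3) False by (simp add: powr_powr)
      also have "K * exp (- \<epsilon> * \<bar>y\<bar>) \<le> K' * exp (- \<epsilon> * \<bar>y\<bar>)" using K' by (intro mult_right_mono) auto
      finally show ?thesis using \<zeta>(1) by (simp add: G_def \<zeta>_def)
    qed
  qed (use \<epsilon> r in auto)
  moreover have "w (-1) (of_real (r powr (- \<alpha>))) = of_real r"
  proof -
    have "w (-1) (of_real (r powr (- \<alpha>))) = of_real ((r powr (- \<alpha>)) powr (- \<beta>))"
      using powr_of_real[of "r powr (- \<alpha>)" "- \<beta>"] r by (simp add: w_def)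
    also have "(r powr (- \<alpha>)) powr (- \<beta>) = r" using \<beta>(3) r by (simp add: powr_powr mult.commute)
    finally show ?thesis .
  qed
  ultimately show ?thesis using r by (simp add: G_def)
qed

text \<open>Vanishing on the axis \<open>x = 0\<close> leaves only \<open>u (a, 0)\<close> of the
  corner terms; Fubini and the reflection \<open>y = - s\<close> turn the double integral into the
  required order.\<close>

lemma klein_gordon_goursat:
  fixes u :: "real \<times> real \<Rightarrow> complex"
  assumes u: "continuous_on ({0..} \<times> {..0}) u"
    and kg: "klein_gordon_distributional ({0<..} \<times> {..<0}) u"
    and u0: "\<And>y. y \<le> 0 \<Longrightarrow> u (0, y) = 0"
  shows "goursat (\<lambda>x t. u (x, - t))"
  unfolding goursat_def
proof (intro conjI allI impI)
  have "continuous_on ({0..} \<times> {0..}) (\<lambda>p. u (fst p, - snd p))"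
    by (rule continuous_on_compose2[OF u], intro continuous_intros) auto
  then show "continuous_on ({0..} \<times> {0..}) (\<lambda>(x, t). u (x, - t))" by (simp add: case_prod_beta')
  fix a b :: real assume ab: "0 \<le> a" "0 \<le> b"
  have c: "continuous_on (cbox (0, - b) (a, 0)) u"
    by (rule continuous_on_subset[OF u]) (auto simp: cbox_Pair_eq)
  have "u (a, - b) = u (a, 0) + integral (cbox (0, - b) (a, 0)) u"
    using klein_gordon_integrated[OF u kg ab] u0[of 0] u0[of "- b"] ab by simp
  also have "integral (cbox (0, - b) (a, 0)) u = integral (cbox 0 a) (\<lambda>x. integral (cbox (- b) 0) (\<lambda>y. u (x, y)))"
    by (rule integral_prod_continuous[OF c])
  also have "\<dots> = integral (cbox (- b) 0) (\<lambda>y. integral (cbox 0 a) (\<lambda>x. u (x, y)))"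
    by (rule integral_swap_continuous) (use c in simp)
  also have "\<dots> = integral {0..b} (\<lambda>s. integral {0..a} (\<lambda>x. u (x, - s)))"
    using Henstock_Kurzweil_Integration.integral_reflect_real[of b 0 "\<lambda>s. integral {0..a} (\<lambda>x. u (x, - s))"]
    by simp
  finally show "u (a, - b) = u (a, - 0) + integral {0..b} (\<lambda>s. integral {0..a} (\<lambda>x. u (x, - s)))" by simp
qed

theorem theorem1p20:
  fixes \<theta>\<^sub>1 \<theta>\<^sub>2 q q'' :: real
    and u :: "real \<times> real \<Rightarrow> complex"
    and Y :: "real set"
  assumes "0 < \<theta>\<^sub>1" and "0 < \<theta>\<^sub>2"
    and "1 / 2 < q" and "q < 1" and "q'' = dual_exponent q"
    and "continuous_on ({0..} \<times> {..0}) u"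
    and "klein_gordon_distributional ({0<..} \<times> {..<0}) u"
    and "\<forall>y\<le>0. u (0, y) = 0"
    and "Y \<subseteq> {..0}" and "0 \<in> Y" and "asymptotic_covering q Y"
    and "\<exists>C. \<forall>x\<ge>0. \<forall>y\<in>Y.
           cmod (u (x, y)) \<le> C * exp (\<theta>\<^sub>1 * \<bar>x\<bar> powr q + \<theta>\<^sub>2 * \<bar>y\<bar> powr q'')"
    and "\<theta>\<^sub>1 powr (1 / q) * \<theta>\<^sub>2 powr (1 / q'')
           < (1 / q) powr (1 / q) * (1 / q'') powr (1 / q'') * (sin (pi / (2 * q)))\<^sup>2"
  shows "\<forall>x\<ge>0. \<forall>y\<le>0. u (x, y) = 0"
proof -
  note q = assms(3,4)
  have q0: "0 < q" using q by simp
  define v where "v x t = u (x, - t)" for x t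
  have v: "goursat v"
    unfolding v_def[abs_def] by (rule klein_gordon_goursat) (use assms(6,7,8) in auto)
  define T where "T = uminus ` Y"
  have T: "0 \<in> T" "T \<subseteq> {0..}" using assms(9,10) by (force simp: T_def)+
  obtain C where C: "\<And>x y. 0 \<le> x \<Longrightarrow> y \<in> Y \<Longrightarrow> cmod (u (x, y)) \<le> C * exp (\<theta>\<^sub>1 * \<bar>x\<bar> powr q + \<theta>\<^sub>2 * \<bar>y\<bar> powr q'')"
    using assms(12) by blast
  have growth: "cmod (v x t) \<le> C * exp (\<theta>\<^sub>1 * x powr q + \<theta>\<^sub>2 * t powr q'')" if "0 \<le> x" "t \<in> T" for x t
    using C[of x "- t"] that T by (auto simp: v_def T_def)
  have C0: "0 \<le> C"
  proof -
    have "0 \<le> C * exp (\<theta>\<^sub>1 * 0 powr q + \<theta>\<^sub>2 * 0 powr q'')" by (rule order_trans[OF norm_ge_zero growth[OF order_refl T(1)]])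
    then show ?thesis by (simp add: zero_le_mult_iff)
  qed
  define \<alpha> where "\<alpha> = q / (1 - q)"
  have \<alpha>: "1 < \<alpha>" using q by (simp add: \<alpha>_def)
  define A where "A = (1 - q) * \<theta>\<^sub>1 powr (1 / (1 - q)) * q powr (q / (1 - q))"
  have A0: "0 \<le> A" using q by (simp add: A_def)
  define c where "c = cos (pi / (2 * \<alpha>))"
  have c_sin: "c = sin (pi / (2 * q))"
  proof -
    have "pi / (2 * \<alpha>) = - (pi / 2 - pi / (2 * q))" using q by (simp add: \<alpha>_def field_simps)
    then show ?thesis unfolding c_def by (simp only: cos_minus cos_sin_eq) simp
  qed
  have c0: "0 < c" unfolding c_def by (rule cos_gt_zero) (use \<alpha> in \<open>simp_all add: field_simps\<close>)
  have v0: "continuous_on {0..} (\<lambda>x. v x 0)"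
    unfolding v_def by (rule continuous_on_compose2[OF assms(6)], intro continuous_intros) auto
  have v0_bound: "\<exists>K. \<forall>x\<ge>0. cmod (v x 0) \<le> K * exp (\<sigma> * x)" if \<sigma>: "0 < \<sigma>" for \<sigma>
  proof (intro exI allI impI)
    fix x :: real assume x: "0 \<le> x"
    have "cmod (v x 0) \<le> C * exp (\<theta>\<^sub>1 * x powr q)" using growth[OF x T(1)] by simp
    also have "\<dots> \<le> C * exp (\<sigma> * x + A * \<sigma> powr (- (q / (1 - q))))"
      using powr_le_linear[OF assms(1) q0 q(2) \<sigma> x] C0 by (intro mult_left_mono) (simp_all add: A_def)
    finally show "cmod (v x 0) \<le> (C * exp (A * \<sigma> powr (- (q / (1 - q))))) * exp (\<sigma> * x)"
      by (simp add: exp_add mult_ac)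
  qed
  obtain F where F: "F holomorphic_on {z. 0 < Re z}"
    and Flim: "\<And>z. 0 < Re z \<Longrightarrow> ((\<lambda>X. integral {0..X} (\<lambda>x. v x 0 * exp (- z * of_real x))) \<longlongrightarrow> F z) at_top"
    using Laplace_transform_exists[OF v0 v0_bound] by blast
  have bound: "cmod (F z) \<le> C / (\<kappa> * Re z) * exp (A * ((1 - \<kappa>) * Re z) powr (- \<alpha>) + (\<theta>\<^sub>2 * t powr q'' - t * Re (1 / z)))"
    if "0 < \<kappa>" "\<kappa> < 1" "0 < Re z" "t \<in> T" for \<kappa> z t
    unfolding \<alpha>_def
    by (rule goursat_Laplace_bound[OF v assms(1) q0 q(2) A_def growth T(2,1) that(3,1,2,4) Flim[OF that(3)]])
  have dense: "eventually (\<lambda>t0. \<exists>t\<in>T. \<bar>t - t0\<bar> \<le> \<nu> * t0) at_top" if "0 < \<nu>" for \<nu>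
    using asymptotic_covering_dense[OF assms(11,3) that]
    by (rule eventually_mono) (force simp: T_def)
  have dual: "q'' * (\<alpha> - 1) = \<alpha>"
  proof -
    have 1: "\<alpha> * (1 - q) = q" and 2: "q'' * (2 * q - 1) = q"
      using q by (simp_all add: \<alpha>_def assms(5) dual_exponent_def)
    have "(\<alpha> - 1) * (1 - q) = 2 * q - 1" unfolding left_diff_distrib 1 by simp
    then have "q'' * (\<alpha> - 1) * (1 - q) = \<alpha> * (1 - q)" by (simp only: mult.assoc 1 2)
    then show ?thesis using q by simp
  qed
  have less: "A * c powr (- \<alpha>) < \<theta>\<^sub>2 * (c / (\<theta>\<^sub>2 * q'')) powr \<alpha> * (q'' - 1)"
    unfolding A_def \<alpha>_def
    by (rule exponent_condition[OF assms(1,2) q assms(5) c0]) (use assms(13) c_sin in simp)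
  have "\<exists>K \<epsilon>. 0 < \<epsilon> \<and> (\<forall>\<rho> z. 0 < \<rho> \<longrightarrow> Re z = c / \<rho> \<longrightarrow> Re (1 / z) = c * \<rho> \<longrightarrow>
      cmod (F z) \<le> K * exp (- \<epsilon> * \<rho> powr \<alpha>))"
    by (rule ray_decay[OF bound T dense assms(2) c0 A0 \<alpha> C0 dual less])
  then obtain K \<epsilon> where \<epsilon>: "0 < \<epsilon>"
    and K: "\<forall>\<rho> z. 0 < \<rho> \<longrightarrow> Re z = c / \<rho> \<longrightarrow> Re (1 / z) = c * \<rho> \<longrightarrow>
      cmod (F z) \<le> K * exp (- \<epsilon> * \<rho> powr \<alpha>)"
    by (elim exE conjE)
  have decay: "cmod (F z) \<le> K * exp (- \<epsilon> * \<rho> powr \<alpha>)"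
    if "0 < \<rho>" "Re z = c / \<rho>" "Re (1 / z) = c * \<rho>" for \<rho> z
    using K that by blast
  \<comment> \<open>The choice \<open>\<kappa> = 1 / 2\<close>, \<open>t = 0\<close> loses in the
    constants but holds in the whole half-plane; it supplies the finite exponential type in the
    variable \<open>\<zeta>\<close>.\<close>
  have coarse: "cmod (F z) \<le> (2 * C) / Re z * exp (A * (1 / 2) powr (- \<alpha>) * Re z powr (- \<alpha>))" if "0 < Re z" for z
  proof -
    have "cmod (F z) \<le> C / (1 / 2 * Re z) * exp (A * (1 / 2 * Re z) powr (- \<alpha>))"
      using bound[of "1 / 2" z 0] that T(1) by simp
    also have "(1 / 2 * Re z) powr (- \<alpha>) = (1 / 2) powr (- \<alpha>) * Re z powr (- \<alpha>)" by (rule powr_mult)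
    also have "C / (1 / 2 * Re z) = 2 * C / Re z" by simp
    finally show ?thesis by (simp only: mult.assoc)
  qed
  have F0: "F (of_real r) = 0" if "0 < r" for r
    by (rule sector_decay_eq_0[OF F \<alpha> c_def coarse _ decay \<epsilon> that]) (use A0 in simp_all)
  have v00: "v x 0 = 0" if x: "0 \<le> x" for x
  proof -
    have int: "(\<lambda>x. v x 0 * exp (- of_real r * of_real x)) integrable_on {0..X}" for r X
      by (intro integrable_continuous_interval continuous_intros continuous_on_subset[OF v0]) auto
    have lim: "((\<lambda>X. integral {0..X} (\<lambda>x. v x 0 * exp (- of_real r * of_real x))) \<longlongrightarrow> 0) at_top" if "0 < r" for r
      using Flim[of "of_real r"] F0[OF that] that by simp
    have e: "exp (- complex_of_real r * of_real x) = of_real (exp (- r * x))" for r x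
      by (simp add: exp_of_real[symmetric])
    \<comment> \<open>For real \<open>r\<close> the kernel is real, so the transforms of the real
      and imaginary parts vanish separately.\<close>
    have "Re (v x 0) = 0"
    proof (rule Laplace_zero_imp_zero[of "\<lambda>x. Re (v x 0)"])
      show "continuous_on {0..} (\<lambda>x. Re (v x 0))" by (intro continuous_intros v0)
      fix r :: real assume "0 < r"
      from tendsto_Re[OF lim[OF this]]
      show "((\<lambda>X. integral {0..X} (\<lambda>x. Re (v x 0) * exp (- r * x))) \<longlongrightarrow> 0) at_top"
        using integral_linear[OF int[of r] bounded_linear_Re, unfolded o_def] unfolding e by simp
    qed (rule x)
    moreover have "Im (v x 0) = 0"
    proof (rule Laplace_zero_imp_zero[of "\<lambda>x. Im (v x 0)"])
      show "continuous_on {0..} (\<lambda>x. Im (v x 0))" by (intro continuous_intros v0)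
      fix r :: real assume "0 < r"
      from tendsto_Im[OF lim[OF this]]
      show "((\<lambda>X. integral {0..X} (\<lambda>x. Im (v x 0) * exp (- r * x))) \<longlongrightarrow> 0) at_top"
        using integral_linear[OF int[of r] bounded_linear_Im, unfolded o_def] unfolding e by simp
    qed (rule x)
    ultimately show ?thesis by (simp add: complex_eq_iff)
  qed
  show ?thesis
  proof (intro allI impI)
    fix x y :: real assume xy: "0 \<le> x" "y \<le> 0"
    \<comment> \<open>The a priori bound with \<open>K = 0\<close> and \<open>\<sigma> = 1\<close>
      carries the zero data on \<open>t = 0\<close> to every \<open>t\<close>.\<close>
    have "cmod (v x (- y)) \<le> 2 * 0 * exp (1 * x + 2 / 1 * (- y))"
      by (rule goursat_exp_bound[OF v]) (use v00 xy in auto)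
    then show "u (x, y) = 0" by (simp add: v_def)
  qed
qed

end
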